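(* Let $X=\{x_1,\dots,x_n\}$ be a set of $n=|X|\le 5$ pairwise distinct nonzero complex numbers. The algebra $Q_X$ (see context) has the following representations of dimension $\dim V\le 6$ (that is, in each case the assignment given for $g_1,g_2$ extends to a representation of $Q_X$). * $|X|=\dim V=1$: $\rho^{(1)}_X(g_1)=\rho^{(1)}_X(g_2)=x_1$. * $|X|=\dim V=2$: $\rho^{(2)}_X(g_1)=\mathrm{diag}\{x_1,x_2\}$, $\rho^{(2)}_X(g_2)=\frac1{x_1-x_2}\begin{pmatrix}-x_2^2&-x_1x_2\\ x_1^2-x_1x_2+x_2^2&x_1^2\end{pmatrix}$. * $|X|=\dim V=3$: $\rho^{(3)}_X(g_1)=\mathrm{diag}\{x_1,x_2,x_3\}$, $$\rho^{(3)}_X(g_2)=\begin{pmatrix}\frac{x_2x_3(x_2+x_3)}{\Delta_1(X)}&\frac{x_3(x_1^2+x_2x_3)}{\Delta_1(X)}&\frac{x_2(x_1^2+x_2x_3)}{\Delta_1(X)}\\ \frac{x_3(x_2^2+x_1x_3)}{\Delta_2(X)}&\frac{x_1x_3(x_1+x_3)}{\Delta_2(X)}&\frac{x_1(x_2^2+x_1x_3)}{\Delta_2(X)}\\ \frac{x_2(x_3^2+x_1x_2)}{\Delta_3(X)}&\frac{x_1(x_3^2+x_1x_2)}{\Delta_3(X)}&\frac{x_1x_2(x_1+x_2)}{\Delta_3(X)}\end{pmatrix}.$$ * $|X|=\dim V=4$: there are two inequivalent representations, depending on the choice of the square root $h=\sqrt{e_4(X)}$: $\rho^{(4)}_{h,X}(g_1)=\mathrm{diag}\{x_1,x_2,x_3,x_4\}$,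 $$\rho^{(4)}_{h,X}(g_2)=\begin{pmatrix}\frac{\alpha_1}{\Delta_1(X)}&\frac{\beta_1\gamma_3\gamma_4}{\Delta_1(X)}&\frac{\beta_1\gamma_2\gamma_4}{\Delta_1(X)}&\frac{\beta_1\gamma_2\gamma_3}{\Delta_1(X)}\\ \frac{\beta_2}{\Delta_2(X)}&\frac{\alpha_2}{\Delta_2(X)}&\frac{\beta_2\gamma_2}{\Delta_2(X)}&\frac{\beta_2\gamma_2}{\Delta_2(X)}\\ \frac{\beta_3}{\Delta_3(X)}&\frac{\beta_3\gamma_3}{\Delta_3(X)}&\frac{\alpha_3}{\Delta_3(X)}&\frac{\beta_3\gamma_3}{\Delta_3(X)}\\ \frac{\beta_4}{\Delta_4(X)}&\frac{\beta_4\gamma_4}{\Delta_4(X)}&\frac{\beta_4\gamma_4}{\Delta_4(X)}&\frac{\alpha_4}{\Delta_4(X)}\end{pmatrix},$$ where $\alpha_i=e_3(X^{\setminus i})e_1(X^{\setminus i})-h\,e_2(X^{\setminus i})$, $\beta_i=e_4(X)/x_i^2-h$ ($i=1,\dots,4$), $\gamma_a=x_1x_a+x_bx_c-h$ with $\{a,b,c\}=\{2,3,4\}$. * $|X|=\dim V=5$: there are five inequivalent representations, corresponding to the different values of the root $f=\sqrt[5]{e_5(X)}$: $\rho^{(5)}_{f,X}(g_1)=\mathrm{diag}\{x_1,\dots,x_5\}$, $\rho^{(5)}_{f,X}(g_2)=(m_{ij})_{i,j=1}^5$, $$m_{ii}=\frac{e_4(X^{\setminus i})e_1(X^{\setminus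 i})+f x_i e_3(X^{\setminus i})+f\prod_{k\ne i}(f+x_k)}{\Delta_i(X)},\qquad m_{ij}=\frac{(x_i^2+fx_i+f^2)\prod_{k\neq i,j}(f^2+x_ix_k)}{f x_ix_j\Delta_i(X)}\ (i\ne j).$$ * $|X|=5$, $\dim V=6$: there are five inequivalent representations $\rho^{(6)}_{i,X}$, $i=1,\dots,5$, where in $\rho^{(6)}_{i,X}$ the central element $c=(g_1g_2)^3$ acts as the scalar $-x_ie_5(X)$. The representation $\rho^{(6)}_{5,X}$ is given by $\rho^{(6)}_{5,X}(g_1)=\mathrm{diag}\{x_1,x_2,x_3,x_4,x_5,x_5\}$, $\rho^{(6)}_{5,X}(g_2)=(g_{ij})_{i,j=1}^6$ with the following entries, where $q_a=x_1x_a+x_bx_c$ for $\{a,b,c\}=\{2,3,4\}$ and $p_i=e_5(X)-x_i^3x_5^2$: - $g_{ii}=\frac{e_4(X^{\setminus i})e_1(X^{\setminus i})-x_ix_5e_3(X^{\setminus i})}{\Delta_i(X)}$ for $i=1,\dots,4$; for pairwise distinct $a,b,c\in\{2,3,4\}$: $g_{1a}=\frac{p_aq_bq_c}{x_1^2\Delta_a(X)}$, $g_{a1}=\frac{p_1}{x_a^2\Delta_1(X)}$, $g_{ab}=\frac{q_ap_b}{x_a^2\Delta_b(X)}$. - $g_{51}=\frac1{\Delta_1(X)}$, $g_{52}=g_{61}=0$, $g_{62}=\frac1{\Delta_2(X)}$. - $g_{53}=q_4r$, $g_{54}=q_3(\sigma_{34}\circ r)$, $g_{63}=\sigma_{12}\circ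 r$, $g_{64}=\sigma_{12}\sigma_{34}\circ r$, where $r=\frac{x_3}{x_1(x_2-x_1)\Delta_3(X^{\setminus2})}$. - $g_{55}=u$, $g_{56}=q_3q_4v$, $g_{65}=\sigma_{12}\circ v$, $g_{66}=\sigma_{12}\circ u$, where $v=\frac{p_2}{x_1x_5(x_2-x_1)\Delta_5(X^{\setminus2})}$ and $u=\frac{x_1x_2(x_3+x_4)(x_3x_4-x_1x_5)+x_3x_4(x_2-x_1)(x_1^2+x_2x_5)}{(x_2-x_1)\Delta_5(X^{\setminus2})}$. - $g_{35}=\frac{w}{x_3^2x_5\Delta_5(X)}$, $g_{36}=\frac{q_3(\sigma_{12}\circ w)}{x_3^2x_5\Delta_5(X)}$, $g_{45}=\frac{\sigma_{34}\circ w}{x_4^2x_5\Delta_5(X)}$, $g_{46}=\frac{q_4(\sigma_{12}\sigma_{34}\circ w)}{x_4^2x_5\Delta_5(X)}$, where $w=p_1\bigl(x_1x_2x_3x_4\{x_1x_3+x_5(x_2+x_4)\}-x_5^3\{x_1x_3(x_2+x_4)+x_5x_2x_4\}\bigr)$. - $g_{15}=\frac{z}{x_1\Delta_5(X)}$, $g_{16}=\frac{q_3q_4(\sigma_{12}\sigma_{23}\circ w)}{x_1^2x_5\Delta_5(X)}$, $g_{25}=\frac{\sigma_{23}\circ w}{x_2^2x_5\Delta_5(X)}$, $g_{26}=\frac{\sigma_{12}\circ z}{x_2\Delta_5(X)}$, where, with $e_1,e_2,e_3$ the elementary symmetric polynomials in $x_2,x_3,x_4$, $z=(e_1e_3-x_1^2e_2)(x_1e_1e_3-e_2x_5^3)x_1x_5+e_3(x_1-x_5)\bigl(x_1^2(e_1-x_1)\{e_3(x_1-x_5)-e_1x_5^3\}+(x_1e_2-e_3)\{x_1e_2+(x_1-x_5)x_5^2\}x_5\bigr)$.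 For $i=1,\dots,4$, $\rho^{(6)}_{i,X}=\sigma_{i5}\circ\rho^{(6)}_{5,X}$, i.e. it is obtained by interchanging $x_5$ and $x_i$ in the formulas for $\rho^{(6)}_{5,X}$.
   Context: $B_3$ is the 3-string braid group, generated by $g_1,g_2$ with the relation $g_1g_2g_1=g_2g_1g_2$; the element $c=(g_1g_2)^3=(g_1g_2g_1)^2$ is central. For a set $X=\{x_1,\dots,x_n\}$ of pairwise distinct nonzero complex numbers let $P_X(g)=\prod_{i=1}^n(g-x_i1)$ and $Q_X=\mathbb C[B_3]/\langle P_X(g_1)\rangle$ (two-sided ideal; since $g_1,g_2$ are conjugate, also $P_X(g_2)=0$ in $Q_X$). Notation: $e_k(\cdot)$ is the $k$-th elementary symmetric polynomial of the elements of the given set. $X^{\setminus i}=X\setminus\{x_i\}$. $\Delta_i(X)=\prod_{j\ne i}(x_j-x_i)$, the product over all indices $j\neq i$ of elements of $X$; similarly $\Delta_i(X^{\setminus k})=\prod_{j\ne i,k}(x_j-x_i)$. For a function $F(x_1,\dots,x_5)$, $\sigma_{ij}\circ F$ is the function obtained from $F$ by interchanging $x_i$ and $x_j$, and $\sigma_{ij}\sigma_{kl}\circ F=\sigma_{ij}\circ(\sigma_{kl}\circ F)$. *)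

theory Defs
  imports
    "HOL-Library.Poly_Mapping"
    "HOL-Algebra.QuotRing"
    "Jordan_Normal_Form.Matrix"
begin

text \<open>
  A letter is a generator together with a flag which is \<^term>\<open>False\<close> for the inverse
  of the generator. Words are compared by the smallest congruence that contains the free
  cancellations and the braid relation.
\<close>

datatype braid_gen = Gen1 | Gen2

type_synonym braid_word = "(braid_gen \<times> bool) list"

inductive braid_eq :: "braid_word \<Rightarrow> braid_word \<Rightarrow> bool" where
  refl: "braid_eq u u"
| sym: "braid_eq u v \<Longrightarrow> braid_eq v u"
| trans: "braid_eq u v \<Longrightarrow> braid_eq v w \<Longrightarrow> braid_eq u w"
| cong: "braid_eq u v \<Longrightarrow> braid_eq (l @ u @ r) (l @ v @ r)"
| cancel: "braid_eq [(a, b), (a, \<not> b)] []"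
| braid: "braid_eq [(Gen1, True), (Gen2, True), (Gen1, True)]
                   [(Gen2, True), (Gen1, True), (Gen2, True)]"

definition word_inv :: "braid_word \<Rightarrow> braid_word" where
  "word_inv u = rev (map (\<lambda>(a, b). (a, \<not> b)) u)"

lemma braid_eq_append:
  assumes "braid_eq u u'" "braid_eq v v'"
  shows "braid_eq (u @ v) (u' @ v')"
proof -
  have "braid_eq (u @ v) (u' @ v)"
    using braid_eq.cong[OF assms(1), of "[]" v] by simp
  moreover have "braid_eq (u' @ v) (u' @ v')"
    using braid_eq.cong[OF assms(2), of u' "[]"] by simp
  ultimately show ?thesis by (rule braid_eq.trans)
qed

lemma word_inv_right: "braid_eq (u @ word_inv u) []"
proof (induction u)
  case Nil
  then show ?case by (simp add: word_inv_def braid_eq.refl)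
next
  case (Cons y u)
  obtain a b where y: "y = (a, b)" by (cases y)
  have "braid_eq ([y] @ (u @ word_inv u) @ [(a, \<not> b)]) ([y] @ [] @ [(a, \<not> b)])"
    by (rule braid_eq.cong[OF Cons.IH])
  moreover have "braid_eq ([y] @ [] @ [(a, \<not> b)]) []"
    using braid_eq.cancel[of a b] by (simp add: y)
  ultimately have "braid_eq ([y] @ (u @ word_inv u) @ [(a, \<not> b)]) []"
    by (rule braid_eq.trans)
  then show ?case by (simp add: y word_inv_def)
qed

lemma word_inv_word_inv: "word_inv (word_inv u) = u"
  by (simp add: word_inv_def rev_map case_prod_unfold comp_def)

lemma word_inv_left: "braid_eq (word_inv u @ u) []"
  using word_inv_right[of "word_inv u"] by (simp add: word_inv_word_inv)

lemma word_inv_cong: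
  assumes "braid_eq u v"
  shows "braid_eq (word_inv u) (word_inv v)"
proof -
  have "braid_eq (word_inv u @ (v @ word_inv v)) (word_inv u @ [])"
    by (intro braid_eq_append braid_eq.refl word_inv_right)
  moreover have "braid_eq ((word_inv u @ v) @ word_inv v) ((word_inv u @ u) @ word_inv v)"
    by (intro braid_eq_append braid_eq.refl braid_eq.sym[OF assms])
  moreover have "braid_eq ((word_inv u @ u) @ word_inv v) ([] @ word_inv v)"
    by (intro braid_eq_append braid_eq.refl word_inv_left)
  ultimately show ?thesis
    by simp (meson braid_eq.sym braid_eq.trans)
qed

quotient_type braid3 = braid_word / braid_eq
  by (intro equivpI reflpI sympI transpI)
    (blast intro: braid_eq.refl braid_eq.sym braid_eq.trans)+

text \<open>
  The group is written additively (although it is not abelian), because the convolution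
  product on finitely supported functions in \<^theory>\<open>HOL-Library.Poly_Mapping\<close> is
  defined for additively written monoids.
\<close>

instantiation braid3 :: group_add
begin

lift_definition zero_braid3 :: braid3 is "[]" .

lift_definition plus_braid3 :: "braid3 \<Rightarrow> braid3 \<Rightarrow> braid3" is "(@)"
  by (rule braid_eq_append)

lift_definition uminus_braid3 :: "braid3 \<Rightarrow> braid3" is word_inv
  by (rule word_inv_cong)

definition minus_braid3 :: "braid3 \<Rightarrow> braid3 \<Rightarrow> braid3" where
  "minus_braid3 a b = a + (- b)"

instance
proof
  fix a b c :: braid3
  show "a + b + c = a + (b + c)"
    by transfer (simp add: braid_eq.refl)
  show "0 + a = a" by transfer (simp add: braid_eq.refl)
  show "a + 0 = a" by transfer (simp add: braid_eq.refl)
  show "- a + a = 0" by transfer (rule word_inv_left)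
  show "a + - b = a - b" by (simp add: minus_braid3_def)
qed

end

lift_definition braid_generator :: "braid_gen \<Rightarrow> braid3" is "\<lambda>a. [(a, True)]" .

type_synonym braid_alg = "braid3 \<Rightarrow>\<^sub>0 complex"

definition g1 :: braid_alg where "g1 = Poly_Mapping.single (braid_generator Gen1) 1"
definition g2 :: braid_alg where "g2 = Poly_Mapping.single (braid_generator Gen2) 1"

definition scalar :: "complex \<Rightarrow> braid_alg" where
  "scalar k = Poly_Mapping.single 0 k"

definition c_elt :: braid_alg where "c_elt = (g1 * g2) ^ 3"

definition CB3 :: "braid_alg ring" where
  "CB3 = \<lparr>carrier = UNIV, monoid.mult = (*), one = 1, zero = 0, add = (+)\<rparr>"

text \<open>
  A set $X$ with $n$ elements is given by an enumeration \<open>x\<close> on \<^term>\<open>{1..n}\<close>. The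
  factors of $P_X(a)$ commute with each other, so their order is irrelevant.
\<close>

definition P_X :: "nat \<Rightarrow> (nat \<Rightarrow> complex) \<Rightarrow> braid_alg \<Rightarrow> braid_alg" where
  "P_X n x a = prod_list (map (\<lambda>i. a - scalar (x i)) [1..<Suc n])"

definition Q_ideal :: "nat \<Rightarrow> (nat \<Rightarrow> complex) \<Rightarrow> braid_alg set" where
  "Q_ideal n x = Idl\<^bsub>CB3\<^esub> {P_X n x g1}"

definition Q_X :: "nat \<Rightarrow> (nat \<Rightarrow> complex) \<Rightarrow> braid_alg set ring" where
  "Q_X n x = CB3 Quot (Q_ideal n x)"

definition Q_class :: "nat \<Rightarrow> (nat \<Rightarrow> complex) \<Rightarrow> braid_alg \<Rightarrow> braid_alg set" where
  "Q_class n x a = Q_ideal n x +>\<^bsub>CB3\<^esub> a"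

definition Q_representation ::
  "nat \<Rightarrow> (nat \<Rightarrow> complex) \<Rightarrow> nat \<Rightarrow> (braid_alg set \<Rightarrow> complex mat) \<Rightarrow> bool" where
  "Q_representation n x d \<rho> \<longleftrightarrow>
     \<rho> \<in> Ring.ring_hom (Q_X n x) (ring_mat TYPE(complex) d ()) \<and>
     (\<forall>k a. \<rho> (Q_class n x (scalar k * a)) = k \<cdot>\<^sub>m \<rho> (Q_class n x a))"

definition Q_rep_extending ::
  "nat \<Rightarrow> (nat \<Rightarrow> complex) \<Rightarrow> nat \<Rightarrow> complex mat \<Rightarrow> complex mat
    \<Rightarrow> (braid_alg set \<Rightarrow> complex mat) \<Rightarrow> bool" where
  "Q_rep_extending n x d A B \<rho> \<longleftrightarrow>
     Q_representation n x d \<rho> \<and> \<rho> (Q_class n x g1) = A \<and> \<rho> (Q_class n x g2) = B"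

definition Q_equivalent ::
  "nat \<Rightarrow> (nat \<Rightarrow> complex) \<Rightarrow> (braid_alg set \<Rightarrow> complex mat)
    \<Rightarrow> (braid_alg set \<Rightarrow> complex mat) \<Rightarrow> bool" where
  "Q_equivalent n x \<rho> \<rho>' \<longleftrightarrow>
     (\<exists>S T. \<forall>q\<in>carrier (Q_X n x). similar_mat_wit (\<rho> q) (\<rho>' q) S T)"

definition esym :: "nat \<Rightarrow> (nat \<Rightarrow> complex) \<Rightarrow> nat set \<Rightarrow> complex" where
  "esym k x I = (\<Sum>S | S \<subseteq> I \<and> card S = k. \<Prod>i\<in>S. x i)"

definition Delta :: "nat \<Rightarrow> (nat \<Rightarrow> complex) \<Rightarrow> nat set \<Rightarrow> complex" where
  "Delta i x I = (\<Prod>j\<in>I - {i}. x j - x i)"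

definition sigma :: "nat \<Rightarrow> nat \<Rightarrow> ((nat \<Rightarrow> complex) \<Rightarrow> 'a) \<Rightarrow> (nat \<Rightarrow> complex) \<Rightarrow> 'a" where
  "sigma i j F = (\<lambda>x. F (x(i := x j, j := x i)))"

definition rho1_mat :: "(nat \<Rightarrow> complex) \<Rightarrow> complex mat" where
  "rho1_mat x = mat_of_rows_list 1 [[x 1]]"

definition rho2_g1 :: "(nat \<Rightarrow> complex) \<Rightarrow> complex mat" where
  "rho2_g1 x = mk_diagonal [x 1, x 2]"

definition rho2_g2 :: "(nat \<Rightarrow> complex) \<Rightarrow> complex mat" where
  "rho2_g2 x = (1 / (x 1 - x 2)) \<cdot>\<^sub>m mat_of_rows_list 2
     [[- ((x 2)\<^sup>2), - (x 1 * x 2)],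
      [(x 1)\<^sup>2 - x 1 * x 2 + (x 2)\<^sup>2, (x 1)\<^sup>2]]"

definition rho3_g1 :: "(nat \<Rightarrow> complex) \<Rightarrow> complex mat" where
  "rho3_g1 x = mk_diagonal [x 1, x 2, x 3]"

definition rho3_g2 :: "(nat \<Rightarrow> complex) \<Rightarrow> complex mat" where
  "rho3_g2 x = (let x1 = x 1; x2 = x 2; x3 = x 3;
       D1 = Delta 1 x {1..3}; D2 = Delta 2 x {1..3}; D3 = Delta 3 x {1..3}
     in mat_of_rows_list 3
     [[x2 * x3 * (x2 + x3) / D1, x3 * (x1\<^sup>2 + x2 * x3) / D1, x2 * (x1\<^sup>2 + x2 * x3) / D1],
      [x3 * (x2\<^sup>2 + x1 * x3) / D2, x1 * x3 * (x1 + x3) / D2, x1 * (x2\<^sup>2 + x1 * x3) / D2],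
      [x2 * (x3\<^sup>2 + x1 * x2) / D3, x1 * (x3\<^sup>2 + x1 * x2) / D3, x1 * x2 * (x1 + x2) / D3]])"

definition alpha4 :: "complex \<Rightarrow> (nat \<Rightarrow> complex) \<Rightarrow> nat \<Rightarrow> complex" where
  "alpha4 h x i = esym 3 x ({1..4} - {i}) * esym 1 x ({1..4} - {i}) - h * esym 2 x ({1..4} - {i})"

definition beta4 :: "complex \<Rightarrow> (nat \<Rightarrow> complex) \<Rightarrow> nat \<Rightarrow> complex" where
  "beta4 h x i = esym 4 x {1..4} / (x i)\<^sup>2 - h"

definition gamma4 :: "complex \<Rightarrow> (nat \<Rightarrow> complex) \<Rightarrow> nat \<Rightarrow> complex" where
  "gamma4 h x a = x 1 * x a + (\<Prod>b\<in>{2, 3, 4} - {a}. x b) - h"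

definition rho4_g1 :: "(nat \<Rightarrow> complex) \<Rightarrow> complex mat" where
  "rho4_g1 x = mk_diagonal [x 1, x 2, x 3, x 4]"

definition rho4_g2 :: "complex \<Rightarrow> (nat \<Rightarrow> complex) \<Rightarrow> complex mat" where
  "rho4_g2 h x = (let D = (\<lambda>i. Delta i x {1..4});
       al = alpha4 h x; be = beta4 h x; ga = gamma4 h x
     in mat_of_rows_list 4
     [[al 1 / D 1, be 1 * ga 3 * ga 4 / D 1, be 1 * ga 2 * ga 4 / D 1, be 1 * ga 2 * ga 3 / D 1],
      [be 2 / D 2, al 2 / D 2, be 2 * ga 2 / D 2, be 2 * ga 2 / D 2],
      [be 3 / D 3, be 3 * ga 3 / D 3, al 3 / D 3, be 3 * ga 3 / D 3],
      [be 4 / D 4, be 4 * ga 4 / D 4, be 4 * ga 4 / D 4, al 4 / D 4]])"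

definition m5 :: "complex \<Rightarrow> (nat \<Rightarrow> complex) \<Rightarrow> nat \<Rightarrow> nat \<Rightarrow> complex" where
  "m5 f x i j =
     (if i = j then
        (esym 4 x ({1..5} - {i}) * esym 1 x ({1..5} - {i}) + f * x i * esym 3 x ({1..5} - {i})
          + f * (\<Prod>k\<in>{1..5} - {i}. f + x k)) / Delta i x {1..5}
      else
        ((x i)\<^sup>2 + f * x i + f\<^sup>2) * (\<Prod>k\<in>{1..5} - {i, j}. f\<^sup>2 + x i * x k)
          / (f * x i * x j * Delta i x {1..5}))"

definition rho5_g1 :: "(nat \<Rightarrow> complex) \<Rightarrow> complex mat" where
  "rho5_g1 x = mk_diagonal [x 1, x 2, x 3, x 4, x 5]"

text \<open>Matrix indices of \<^const>\<open>mat\<close> start at 0.\<close>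

definition rho5_g2 :: "complex \<Rightarrow> (nat \<Rightarrow> complex) \<Rightarrow> complex mat" where
  "rho5_g2 f x = mat 5 5 (\<lambda>(i, j). m5 f x (Suc i) (Suc j))"

definition p6 :: "(nat \<Rightarrow> complex) \<Rightarrow> nat \<Rightarrow> complex" where
  "p6 x i = esym 5 x {1..5} - x i ^ 3 * (x 5)\<^sup>2"

definition q6 :: "(nat \<Rightarrow> complex) \<Rightarrow> nat \<Rightarrow> complex" where
  "q6 x a = x 1 * x a + (\<Prod>b\<in>{2, 3, 4} - {a}. x b)"

definition r6 :: "(nat \<Rightarrow> complex) \<Rightarrow> complex" where
  "r6 x = x 3 / (x 1 * (x 2 - x 1) * Delta 3 x ({1..5} - {2}))"

definition v6 :: "(nat \<Rightarrow> complex) \<Rightarrow> complex" where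
  "v6 x = p6 x 2 / (x 1 * x 5 * (x 2 - x 1) * Delta 5 x ({1..5} - {2}))"

definition u6 :: "(nat \<Rightarrow> complex) \<Rightarrow> complex" where
  "u6 x = (x 1 * x 2 * (x 3 + x 4) * (x 3 * x 4 - x 1 * x 5)
            + x 3 * x 4 * (x 2 - x 1) * ((x 1)\<^sup>2 + x 2 * x 5))
          / ((x 2 - x 1) * Delta 5 x ({1..5} - {2}))"

definition w6 :: "(nat \<Rightarrow> complex) \<Rightarrow> complex" where
  "w6 x = p6 x 1 *
     (x 1 * x 2 * x 3 * x 4 * (x 1 * x 3 + x 5 * (x 2 + x 4))
       - x 5 ^ 3 * (x 1 * x 3 * (x 2 + x 4) + x 5 * x 2 * x 4))"

definition z6 :: "(nat \<Rightarrow> complex) \<Rightarrow> complex" where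
  "z6 x = (let e1 = esym 1 x {2, 3, 4}; e2 = esym 2 x {2, 3, 4}; e3 = esym 3 x {2, 3, 4};
       x1 = x 1; x5 = x 5
     in (e1 * e3 - x1\<^sup>2 * e2) * (x1 * e1 * e3 - e2 * x5 ^ 3) * x1 * x5
        + e3 * (x1 - x5) *
          (x1\<^sup>2 * (e1 - x1) * (e3 * (x1 - x5) - e1 * x5 ^ 3)
           + (x1 * e2 - e3) * (x1 * e2 + (x1 - x5) * x5\<^sup>2) * x5))"

text \<open>
  In the following definition \<open>d i\<close>, \<open>t a\<close>, \<open>s a\<close> and \<open>g a b\<close> are the entries
  $g_{ii}$, $g_{1a}$, $g_{a1}$ and $g_{ab}$ of the upper left block.
\<close>

definition rho6_g1 :: "(nat \<Rightarrow> complex) \<Rightarrow> complex mat" where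
  "rho6_g1 x = mk_diagonal [x 1, x 2, x 3, x 4, x 5, x 5]"

definition rho6_g2 :: "(nat \<Rightarrow> complex) \<Rightarrow> complex mat" where
  "rho6_g2 x = (let D = (\<lambda>i. Delta i x {1..5}); p = p6 x; q = q6 x;
       d = (\<lambda>i. (esym 4 x ({1..5} - {i}) * esym 1 x ({1..5} - {i})
                   - x i * x 5 * esym 3 x ({1..5} - {i})) / D i);
       t = (\<lambda>a. p a * (\<Prod>b\<in>{2, 3, 4} - {a}. q b) / ((x 1)\<^sup>2 * D a));
       s = (\<lambda>a. p 1 / ((x a)\<^sup>2 * D 1));
       g = (\<lambda>a b. q a * p b / ((x a)\<^sup>2 * D b))
     in mat_of_rows_list 6
     [[d 1, t 2, t 3, t 4,
         z6 x / (x 1 * D 5),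
         q 3 * q 4 * sigma 1 2 (sigma 2 3 w6) x / ((x 1)\<^sup>2 * x 5 * D 5)],
      [s 2, d 2, g 2 3, g 2 4,
         sigma 2 3 w6 x / ((x 2)\<^sup>2 * x 5 * D 5),
         sigma 1 2 z6 x / (x 2 * D 5)],
      [s 3, g 3 2, d 3, g 3 4,
         w6 x / ((x 3)\<^sup>2 * x 5 * D 5),
         q 3 * sigma 1 2 w6 x / ((x 3)\<^sup>2 * x 5 * D 5)],
      [s 4, g 4 2, g 4 3, d 4,
         sigma 3 4 w6 x / ((x 4)\<^sup>2 * x 5 * D 5),
         q 4 * sigma 1 2 (sigma 3 4 w6) x / ((x 4)\<^sup>2 * x 5 * D 5)],
      [1 / D 1, 0, q 4 * r6 x, q 3 * sigma 3 4 r6 x, u6 x, q 3 * q 4 * v6 x],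
      [0, 1 / D 2, sigma 1 2 r6 x, sigma 1 2 (sigma 3 4 r6) x, sigma 1 2 v6 x, sigma 1 2 u6 x]])"

end

theory Submission
  imports Defs "Jordan_Normal_Form.Determinant"
begin

text \<open>
  A representation of $Q_X$ is a pair of invertible matrices $A$, $B$ with $ABA = BAB$ and
  $P_X(A) = 0$. In all the listed cases $A$ is diagonal with entries in $X$, so that $P_X(A) = 0$
  is clear, and the braid relation for $A$, $B$ is what has to be shown. It is shown together
  with $(ABA)^2 = s \cdot 1$ for an explicit $s \neq 0$. The second equation supplies the inverses
  of $A$ and $B$ and says that $c$ acts as the scalar $s$. Equivalent representations have the
  same $s$ (\<open>Q_equivalent_central_scalar\<close>), and since $s$ is $h^3$, $f^6$ and $-x_i e_5(X)$
  in dimension 4, 5 and 6, different parameters give inequivalent representations.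

  Let $A = \mathrm{diag}(a_1, \dots, a_d)$ and $B = (b_{ij})$. As $(ABA)^2 = A(BA^2B)A$, the two
  matrix equations say $\sum_k b_{ik} a_k b_{kj} = a_i a_j b_{ij}$ and
  $\sum_k b_{ik} a_k^2 b_{kj} = \delta_{ij}\, s / a_i^2$. Both are instances of one identity with
  the weight $y + t y^2$ in place of $a_k$ and $a_k^2$, in which $t$ is arbitrary
  (\<open>braid_matrix_pair_diagonalI\<close>).

  In dimensions 3 and 4, and in the upper left block of dimension 6, the factor $b_{ij}$ splits off
  from the left hand side of the identity at $(i, j)$, $i \neq j$. In dimensions 4 and 6 this
  rests on one cocycle-like property of the off-diagonal entries (\<open>kappa_chain\<close>). What remains
  is a sum of fractions with denominators $\Delta_k(X)$. All of these divide the Vandermonde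
  product, so it becomes a polynomial identity. For such a block one identity on the diagonal and
  one outside of it are enough, since they are stated for arbitrary distinct numbers and used in all orders.

  In dimension 5 the formulas are homogeneous in $f$ and $X$, so $f = 1$ may be assumed. The basis
  change by the Vandermonde matrix with rows divided by $\Delta_i(X)$ takes $A$ to a companion matrix
  and $B$ to a matrix whose entries are affine in the $e_k(X)$. There $ABA$ is a constant
  matrix with square 1, and this is a direct computation (\<open>companion_braid_matrix_pair\<close>).

  In dimension 6 the eigenvalue $x_5$ is double, and the entries for its eigenspace are the
  complicated ones. In the upper left block of the identity they enter only through
  $g_{i5} g_{5j} + g_{i6} g_{6j}$, and each of these sums collapses to one fraction of the same kind
  as for a simple eigenvalue (\<open>g6_block_off_diag\<close>, \<open>g6_block_diag\<close>). Rows 5 and 6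
  of the first four columns need three more identities (\<open>weighted_entry_51\<close>,
  \<open>weighted_entry_61\<close>, \<open>weighted_entry_53\<close>), up to symmetry. The last two
  columns need no computation: because $g_{52} = g_{61} = 0$ while $g_{51}$ and $g_{62}$ are not
  zero, the vectors $e_1, \dots, e_4, ABe_1, ABe_2$ form a basis, and the braid relation on $ABe_1$,
  $ABe_2$ follows from the identities in the first columns (\<open>braid_matrix_pair_six\<close>).
\<close>

section \<open>Representations from pairs of braided matrices\<close>

lemma mk_diagonal_eq_mat:
  "mk_diagonal as = mat (length as) (length as) (\<lambda>(i, j). if i = j then as ! i else 0)"
proof (induction as)
  case Nil
  then show ?case by (intro eq_matI) (auto simp: mk_diagonal_def)
next
  case (Cons a as)
  have "mk_diagonal (a # as)
      = four_block_mat (mat 1 1 (\<lambda>_. a)) (0\<^sub>m 1 (length as)) (0\<^sub>m (length as) 1) (mk_diagonal as)"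
    using mk_diagonal_dim[of as] by (simp add: mk_diagonal_def Let_def)
  then show ?case
    by (auto intro!: eq_matI simp: Cons.IH nth_Cons')
qed

lemma ring_CB3: "ring CB3"
proof (rule ringI)
  show "abelian_group CB3"
  proof (rule abelian_groupI)
    fix x assume "x \<in> carrier CB3"
    show "\<exists>y\<in>carrier CB3. y \<oplus>\<^bsub>CB3\<^esub> x = \<zero>\<^bsub>CB3\<^esub>"
      by (rule bexI[of _ "- x"]) (simp_all add: CB3_def)
  qed (simp_all add: CB3_def add.assoc add.commute)
  show "Group.monoid CB3"
    by unfold_locales (simp_all add: CB3_def mult.assoc)
qed (simp_all add: CB3_def distrib_left distrib_right)

text \<open>
  It reduces the multiplicativity of the linear extension of a group homomorphism to the product
  of two group elements.
\<close>
lemma poly_mapping_induct_add_single [case_names zero single_add]: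
  fixes a :: "'k \<Rightarrow>\<^sub>0 'c::comm_monoid_add"
  assumes "P 0" and "\<And>g c b. P b \<Longrightarrow> P (Poly_Mapping.single g c + b)"
  shows "P a"
proof -
  have "P (\<Sum>g\<in>K. Poly_Mapping.single g (Poly_Mapping.lookup a g))" if "finite K" for K
    using that by (induction K rule: finite_induct) (simp_all add: assms)
  moreover have "(\<Sum>g\<in>Poly_Mapping.keys a. Poly_Mapping.single g (Poly_Mapping.lookup a g)) = a"
    by (rule poly_mapping_eqI)
      (auto simp: lookup_sum lookup_single when_def in_keys_iff)
  ultimately show ?thesis by (metis finite_keys)
qed

text \<open>
  By Schur's lemma $c = (g_1 g_2 g_1)^2$ acts as a nonzero scalar in every irreducible
  representation, so little is lost by having the scalar among the data. It makes $A$ and $B$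
  invertible, with inverses that are polynomials in $A$ and $B$.
\<close>
locale braid_matrix_pair =
  fixes d :: nat and A B :: "complex mat" and s :: complex
  assumes A [simp]: "A \<in> carrier_mat d d" and B [simp]: "B \<in> carrier_mat d d"
    and braid_rel: "A * B * A = B * A * B"
    and central: "(A * B * A) * (A * B * A) = s \<cdot>\<^sub>m 1\<^sub>m d" and s: "s \<noteq> 0"
begin

lemma square_mat_simps [simp]:
  fixes X :: "complex mat"
  assumes "X \<in> carrier_mat d d"
  shows "1\<^sub>m d * X = X" "X * 1\<^sub>m d = X"
    "0\<^sub>m d d * X = 0\<^sub>m d d" "X * 0\<^sub>m d d = 0\<^sub>m d d" "c \<cdot>\<^sub>m 0\<^sub>m d d = 0\<^sub>m d d" "0\<^sub>m d d + X = X"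
    "1 \<cdot>\<^sub>m X = X" "b \<cdot>\<^sub>m (c \<cdot>\<^sub>m X) = (b * c) \<cdot>\<^sub>m X"
  using assms by auto

lemma square_mat_mult_simps [simp]:
  fixes X Y :: "complex mat"
  assumes "X \<in> carrier_mat d d" "Y \<in> carrier_mat d d"
  shows "X * Y \<in> carrier_mat d d"
    "c \<cdot>\<^sub>m X * Y = c \<cdot>\<^sub>m (X * Y)" "X * (c \<cdot>\<^sub>m Y) = c \<cdot>\<^sub>m (X * Y)"
  using assms by auto

lemma square_mat_assoc:
  fixes X Y Z :: "complex mat"
  assumes "X \<in> carrier_mat d d" "Y \<in> carrier_mat d d" "Z \<in> carrier_mat d d"
  shows "X * Y * Z = X * (Y * Z)"
  using assms by (rule assoc_mult_mat)

text \<open>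
  The inverses come from $A \cdot BA(ABA) = (ABA)^2 = s$ and
  $B \cdot AB(ABA) = (BAB)(ABA) = (ABA)^2 = s$.
\<close>
fun letter_mat :: "braid_gen \<times> bool \<Rightarrow> complex mat" where
  "letter_mat (Gen1, True) = A"
| "letter_mat (Gen1, False) = inverse s \<cdot>\<^sub>m (B * A * (A * B * A))"
| "letter_mat (Gen2, True) = B"
| "letter_mat (Gen2, False) = inverse s \<cdot>\<^sub>m (A * B * (A * B * A))"

lemma letter_mat_carrier [simp]: "letter_mat l \<in> carrier_mat d d"
  by (cases l rule: letter_mat.cases) auto

lemma letter_mat_inverse: "letter_mat (g, b) * letter_mat (g, \<not> b) = 1\<^sub>m d"
proof -
  have right: "letter_mat (g, True) * letter_mat (g, False) = 1\<^sub>m d" for g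
  proof (cases g)
    case Gen1
    have "A * (B * A * (A * B * A)) = (A * B * A) * (A * B * A)"
      by (simp add: square_mat_assoc)
    then show ?thesis using Gen1 s
      by (simp add: central)
  next
    case Gen2
    have "B * (A * B * (A * B * A)) = (B * A * B) * (A * B * A)"
      by (simp add: square_mat_assoc)
    then show ?thesis using Gen2 s
      by (simp add: central
          braid_rel[symmetric])
  qed
  moreover have "letter_mat (g, False) * letter_mat (g, True) = 1\<^sub>m d"
    by (rule mat_mult_left_right_inverse[OF _ _ right]) auto
  ultimately show ?thesis by (cases b) auto
qed

fun word_mat :: "braid_word \<Rightarrow> complex mat" where
  "word_mat [] = 1\<^sub>m d"
| "word_mat (l # w) = letter_mat l * word_mat w"

lemma word_mat_carrier [simp]: "word_mat w \<in> carrier_mat d d"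
  by (induction w) (auto intro: mult_carrier_mat)

lemma word_mat_append: "word_mat (u @ v) = word_mat u * word_mat v"
  by (induction u) (simp_all add: square_mat_assoc)

lemma word_mat_braid_eq: "braid_eq u v \<Longrightarrow> word_mat u = word_mat v"
proof (induction rule: braid_eq.induct)
  case (cancel a b)
  then show ?case by (simp add: letter_mat_inverse)
next
  case braid
  then show ?case
    using braid_rel by (simp add: square_mat_assoc)
qed (simp_all add: word_mat_append)

definition group_mat :: "braid3 \<Rightarrow> complex mat" where
  "group_mat g = word_mat (rep_braid3 g)"

lemma group_mat_carrier [simp]: "group_mat g \<in> carrier_mat d d"
  by (simp add: group_mat_def)

lemma group_mat_abs: "group_mat (abs_braid3 w) = word_mat w"
  unfolding group_mat_def
  by (intro word_mat_braid_eq) (metis Quotient3_braid3 Quotient3_rep_abs braid_eq.refl)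

lemma group_mat_add: "group_mat (g + h) = group_mat g * group_mat h"
proof -
  have "g + h = abs_braid3 (rep_braid3 g @ rep_braid3 h)"
    by (metis Quotient3_abs_rep Quotient3_braid3 plus_braid3.abs_eq)
  then show ?thesis
    by (simp add: group_mat_abs word_mat_append) (simp add: group_mat_def)
qed

lemma group_mat_zero: "group_mat 0 = 1\<^sub>m d"
  by (simp add: zero_braid3_def group_mat_abs)

lemma group_mat_generator:
  "group_mat (braid_generator Gen1) = A" "group_mat (braid_generator Gen2) = B"
  by (simp_all add: braid_generator_def group_mat_abs)

definition alg_mat :: "braid_alg \<Rightarrow> complex mat" where
  "alg_mat a = mat d d (\<lambda>ij. \<Sum>g\<in>Poly_Mapping.keys a. Poly_Mapping.lookup a g * group_mat g $$ ij)"

lemma alg_mat_carrier [simp]: "alg_mat a \<in> carrier_mat d d"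
  by (simp add: alg_mat_def)

lemma alg_mat_add: "alg_mat (a + b) = alg_mat a + alg_mat b"
proof (rule eq_matI)
  fix i j assume "i < dim_row (alg_mat a + alg_mat b)" "j < dim_col (alg_mat a + alg_mat b)"
  then have ij: "i < d" "j < d" by (simp_all add: alg_mat_def)
  have "(\<Sum>g\<in>Poly_Mapping.keys (a + b). Poly_Mapping.lookup (a + b) g * group_mat g $$ (i, j))
      = (\<Sum>g\<in>Poly_Mapping.keys a. Poly_Mapping.lookup a g * group_mat g $$ (i, j))
      + (\<Sum>g\<in>Poly_Mapping.keys b. Poly_Mapping.lookup b g * group_mat g $$ (i, j))"
    by (rule setsum_keys_plus_distrib) (simp_all add: distrib_right)
  then show "alg_mat (a + b) $$ (i, j) = (alg_mat a + alg_mat b) $$ (i, j)"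
    using ij by (simp add: alg_mat_def)
qed (simp_all add: alg_mat_def)

lemma alg_mat_zero: "alg_mat 0 = 0\<^sub>m d d"
  by (rule eq_matI) (simp_all add: alg_mat_def)

lemma alg_mat_single: "alg_mat (Poly_Mapping.single g c) = c \<cdot>\<^sub>m group_mat g"
proof -
  have "dim_row (group_mat g) = d" "dim_col (group_mat g) = d"
    using group_mat_carrier by blast+
  then show ?thesis by (intro eq_matI) (auto simp: alg_mat_def)
qed

lemma alg_mat_one: "alg_mat 1 = 1\<^sub>m d"
  by (simp flip: single_one add: alg_mat_single group_mat_zero)

lemma alg_mat_mult: "alg_mat (a * b) = alg_mat a * alg_mat b"
proof (induction a rule: poly_mapping_induct_add_single)
  case zero
  then show ?case by (simp add: alg_mat_zero)
next
  case (single_add g c a)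
  have "alg_mat (Poly_Mapping.single g c * b) = c \<cdot>\<^sub>m group_mat g * alg_mat b"
  proof (induction b rule: poly_mapping_induct_add_single)
    case zero
    then show ?case by (simp add: alg_mat_zero)
  next
    case (single_add h e b)
    have "(c * e) \<cdot>\<^sub>m (group_mat g * group_mat h) = (c \<cdot>\<^sub>m group_mat g) * (e \<cdot>\<^sub>m group_mat h)"
      by (simp add: mult.commute)
    then show ?case
      using single_add.IH
      by (simp add: distrib_left alg_mat_add mult_single alg_mat_single group_mat_add
          mult_add_distrib_mat[of _ d d _ d])
  qed
  then show ?case
    using single_add.IH
    by (simp add: distrib_right alg_mat_add alg_mat_single add_mult_distrib_mat[of _ d d _ _ d])
qed

lemma alg_mat_scalar: "alg_mat (scalar k) = k \<cdot>\<^sub>m 1\<^sub>m d"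
  by (simp add: scalar_def alg_mat_single group_mat_zero)

lemma alg_mat_scalar_mult: "alg_mat (scalar k * a) = k \<cdot>\<^sub>m alg_mat a"
  by (simp add: alg_mat_mult alg_mat_scalar)

lemma alg_mat_generators: "alg_mat g1 = A" "alg_mat g2 = B"
  by (simp_all add: g1_def g2_def alg_mat_single group_mat_generator)

lemma alg_mat_c_elt: "alg_mat c_elt = s \<cdot>\<^sub>m 1\<^sub>m d"
proof -
  have "alg_mat c_elt = (A * B * A) * (B * A * B)"
    by (simp add: c_elt_def power3_eq_cube alg_mat_mult alg_mat_generators
        square_mat_assoc)
  then show ?thesis by (simp add: central flip: braid_rel)
qed

text \<open>
  If the linear extension kills the ideal, it is constant on each coset. The image of a coset is
  then a singleton, and its element is the value of the induced map.
\<close>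
lemma quotient_representation:
  assumes I: "Q_ideal n x \<subseteq> {a. alg_mat a = 0\<^sub>m d d}"
  shows "\<exists>\<rho>. Q_rep_extending n x d A B \<rho> \<and> \<rho> (Q_class n x c_elt) = s \<cdot>\<^sub>m 1\<^sub>m d"
proof -
  interpret CB3: ring CB3 by (rule ring_CB3)
  interpret I: ideal "Q_ideal n x" CB3
    unfolding Q_ideal_def by (rule CB3.genideal_ideal) (simp add: CB3_def)
  have carrier [simp]: "a \<in> carrier CB3" for a by (simp add: CB3_def)
  define \<rho> where "\<rho> = (\<lambda>C. the_elem (alg_mat ` C))"
  have coset: "Q_class n x a = {h + a |h. h \<in> Q_ideal n x}" for a
    by (auto simp: Q_class_def a_r_coset_def' CB3_def)
  have \<rho>: "\<rho> (Q_class n x a) = alg_mat a" for a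
  proof -
    have "alg_mat ` Q_class n x a = {alg_mat a}"
    proof (rule equalityI)
      show "alg_mat ` Q_class n x a \<subseteq> {alg_mat a}"
        using I by (auto simp: coset alg_mat_add)
      have "a \<in> Q_class n x a"
        unfolding Q_class_def by (rule I.a_rcos_self) simp
      then show "{alg_mat a} \<subseteq> alg_mat ` Q_class n x a" by blast
    qed
    then show ?thesis by (simp add: \<rho>_def)
  qed
  have ex_class: "\<exists>a. C = Q_class n x a" if "C \<in> carrier (Q_X n x)" for C
    using that by (auto simp: Q_X_def FactRing_def A_RCOSETS_def' Q_class_def)
  have mult: "Q_class n x a \<otimes>\<^bsub>Q_X n x\<^esub> Q_class n x b = Q_class n x (a * b)" for a b
    using I.rcoset_mult_add[of a b] by (simp add: Q_X_def FactRing_def Q_class_def CB3_def)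
  have add: "Q_class n x a \<oplus>\<^bsub>Q_X n x\<^esub> Q_class n x b = Q_class n x (a + b)" for a b
    using I.a_rcos_sum[of a b] by (simp add: Q_X_def FactRing_def Q_class_def CB3_def)
  have one: "\<one>\<^bsub>Q_X n x\<^esub> = Q_class n x 1"
    by (simp add: Q_X_def FactRing_def Q_class_def CB3_def)
  have "\<rho> \<in> Ring.ring_hom (Q_X n x) (ring_mat TYPE(complex) d ())"
  proof (rule ring_hom_memI)
    fix C E assume "C \<in> carrier (Q_X n x)" "E \<in> carrier (Q_X n x)"
    then obtain a b where CE: "C = Q_class n x a" "E = Q_class n x b"
      using ex_class by metis
    show "\<rho> C \<in> carrier (ring_mat TYPE(complex) d ())"
      by (simp add: CE \<rho> ring_mat_simps)
    show "\<rho> (C \<otimes>\<^bsub>Q_X n x\<^esub> E) = \<rho> C \<otimes>\<^bsub>ring_mat TYPE(complex) d ()\<^esub> \<rho> E"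
      by (simp add: CE \<rho> mult ring_mat_simps alg_mat_mult)
    show "\<rho> (C \<oplus>\<^bsub>Q_X n x\<^esub> E) = \<rho> C \<oplus>\<^bsub>ring_mat TYPE(complex) d ()\<^esub> \<rho> E"
      by (simp add: CE \<rho> add ring_mat_simps alg_mat_add)
  qed (simp add: one \<rho> ring_mat_simps alg_mat_one)
  moreover have "\<rho> (Q_class n x (scalar k * a)) = k \<cdot>\<^sub>m \<rho> (Q_class n x a)" for k a
    by (simp add: \<rho> alg_mat_scalar_mult)
  ultimately have "Q_rep_extending n x d A B \<rho>"
    by (simp add: Q_rep_extending_def Q_representation_def \<rho> alg_mat_generators)
  then show ?thesis using \<rho> alg_mat_c_elt by metis
qed

text \<open>
  The image of \<^term>\<open>P_X n x g1\<close> is a product of diagonal matrices. Its entry at a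
  position \<open>k\<close> contains the factor $a_k - x_i$ for the \<open>i\<close> with $a_k = x_i$.
\<close>
lemma alg_mat_P_X:
  assumes A_eq: "A = mk_diagonal as" and as: "set as \<subseteq> x ` {1..n}"
  shows "alg_mat (P_X n x g1) = 0\<^sub>m d d"
proof -
  have d: "d = length as" using A by (auto simp: A_eq mk_diagonal_dim)
  have entry: "A $$ (i, j) = (if i = j then as ! i else 0)" if "i < d" "j < d" for i j
    using that by (simp add: A_eq d mk_diagonal_eq_mat)
  have prod: "alg_mat (prod_list (map (\<lambda>i. g1 - scalar (x i)) is))
      = mat d d (\<lambda>(k, l). if k = l then \<Prod>i\<leftarrow>is. as ! k - x i else 0)" for "is"
  proof (induction "is")
    case Nil
    then show ?case by (auto simp: alg_mat_one)
  next
    case (Cons i "is")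
    have "alg_mat (g1 - scalar (x i)) = A + (- x i) \<cdot>\<^sub>m 1\<^sub>m d"
    proof -
      have "g1 - scalar (x i) = g1 + scalar (- x i)" by (simp add: scalar_def single_uminus)
      show ?thesis
        unfolding \<open>g1 - scalar (x i) = g1 + scalar (- x i)\<close>
        by (simp add: alg_mat_add alg_mat_generators alg_mat_scalar)
    qed
    also have "\<dots> = mat d d (\<lambda>(k, l). if k = l then as ! k - x i else 0)"
      by (rule eq_matI) (auto simp: entry)
    finally show ?case
      by (auto intro!: eq_matI sum.neutral simp: Cons.IH alg_mat_mult scalar_prod_def
          if_distrib[of "\<lambda>y. y * _"] if_distrib[of "\<lambda>y. _ * y"] cong: if_cong)
  qed
  have "(\<Prod>i\<leftarrow>[1..<Suc n]. as ! k - x i) = 0" if "k < d" for k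
  proof -
    have "as ! k \<in> x ` {1..n}" using that as d by (meson nth_mem subsetD)
    then show ?thesis by (auto simp: prod_list_zero_iff)
  qed
  then show ?thesis
    unfolding P_X_def prod by (intro eq_matI) auto
qed

text \<open>
  The kernel of \<^term>\<open>alg_mat\<close> is a two-sided ideal, so it contains the ideal generated by
  \<^term>\<open>P_X n x g1\<close> as soon as it contains the generator.
\<close>
theorem diagonal_braid_pair_representation:
  assumes A_eq: "A = mk_diagonal as" and as: "set as \<subseteq> x ` {1..n}"
  shows "\<exists>\<rho>. Q_rep_extending n x d A B \<rho> \<and> \<rho> (Q_class n x c_elt) = s \<cdot>\<^sub>m 1\<^sub>m d"
proof (rule quotient_representation)
  interpret CB3: ring CB3 by (rule ring_CB3)
  have "ideal {a. alg_mat a = 0\<^sub>m d d} CB3"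
  proof (rule idealI[OF ring_CB3])
    have "alg_mat (- a) = 0\<^sub>m d d" if "alg_mat a = 0\<^sub>m d d" for a
    proof -
      have "alg_mat (scalar (- 1) * a) = 0\<^sub>m d d" using that by (simp add: alg_mat_scalar_mult)
      moreover have "scalar (- 1) = - 1" by (simp add: scalar_def single_uminus)
      ultimately show ?thesis by simp
    qed
    moreover have "\<ominus>\<^bsub>CB3\<^esub> a = - a" for a
      by (rule CB3.minus_equality) (simp_all add: CB3_def)
    ultimately show "subgroup {a. alg_mat a = 0\<^sub>m d d} (add_monoid CB3)"
      by unfold_locales (auto simp: CB3_def alg_mat_add alg_mat_zero a_inv_def)
  qed (auto simp: CB3_def alg_mat_mult)
  then show "Q_ideal n x \<subseteq> {a. alg_mat a = 0\<^sub>m d d}"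
    unfolding Q_ideal_def
    by (rule CB3.genideal_minimal) (use alg_mat_P_X[OF assms] in simp)
qed

end

text \<open>Conjugation does not change a scalar matrix, so the action of $c$ is an invariant.\<close>
lemma Q_equivalent_central_scalar:
  assumes "Q_equivalent n x \<rho> \<rho>'" "0 < d"
    and "\<rho> (Q_class n x c_elt) = s \<cdot>\<^sub>m 1\<^sub>m d" "\<rho>' (Q_class n x c_elt) = s' \<cdot>\<^sub>m 1\<^sub>m d"
  shows "s = s'"
proof -
  interpret CB3: ring CB3 by (rule ring_CB3)
  interpret I: ideal "Q_ideal n x" CB3
    unfolding Q_ideal_def by (rule CB3.genideal_ideal) (simp add: CB3_def)
  have "Q_class n x c_elt \<in> carrier (Q_X n x)"
    by (auto simp: Q_X_def FactRing_def A_RCOSETS_def' Q_class_def CB3_def)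
  with assms obtain S T where "similar_mat_wit (s \<cdot>\<^sub>m 1\<^sub>m d) (s' \<cdot>\<^sub>m 1\<^sub>m d) S T"
    unfolding Q_equivalent_def by metis
  then have ST: "S \<in> carrier_mat d d" "T \<in> carrier_mat d d" "S * T = 1\<^sub>m d"
    and eq: "s \<cdot>\<^sub>m 1\<^sub>m d = S * (s' \<cdot>\<^sub>m 1\<^sub>m d) * T"
    by (auto simp: similar_mat_wit_def Let_def)
  from eq have "s \<cdot>\<^sub>m 1\<^sub>m d = s' \<cdot>\<^sub>m 1\<^sub>m d"
    using ST by (simp add: mult_smult_distrib[of _ d d _ d] mult_smult_assoc_mat[of _ d d _ d])
  then have "(s \<cdot>\<^sub>m 1\<^sub>m d) $$ (0, 0) = (s' \<cdot>\<^sub>m 1\<^sub>m d) $$ (0, 0)" by simp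
  then show ?thesis using \<open>0 < d\<close> by simp
qed

section \<open>A weighted quadratic identity for a diagonal first generator\<close>

lemma diagonal_pair_mats:
  fixes as :: "complex list" and \<beta> :: "nat \<Rightarrow> nat \<Rightarrow> complex"
  assumes d: "length as = d"
  defines "A \<equiv> mk_diagonal as" and "B \<equiv> mat d d (\<lambda>(i, j). \<beta> i j)"
  shows "A \<in> carrier_mat d d" "B \<in> carrier_mat d d"
    and "A * B = mat d d (\<lambda>(i, j). as ! i * \<beta> i j)"
    and "A * B * A = mat d d (\<lambda>(i, j). as ! i * as ! j * \<beta> i j)"
    and "B * A * B = mat d d (\<lambda>(i, j). \<Sum>k<d. \<beta> i k * as ! k * \<beta> k j)"
    and "A * B * A * (A * B * A)
      = mat d d (\<lambda>(i, j). as ! i * as ! j * (\<Sum>k<d. \<beta> i k * (as ! k)\<^sup>2 * \<beta> k j))"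
proof -
  have A: "A = mat d d (\<lambda>(i, j). if i = j then as ! i else 0)"
    by (simp add: A_def mk_diagonal_eq_mat d)
  show "A \<in> carrier_mat d d" "B \<in> carrier_mat d d" by (simp_all add: A B_def)
  show AB: "A * B = mat d d (\<lambda>(i, j). as ! i * \<beta> i j)"
    by (intro eq_matI) (auto simp: A B_def scalar_prod_def if_distrib[of "\<lambda>y. y * _"] cong: if_cong)
  show ABA: "A * B * A = mat d d (\<lambda>(i, j). as ! i * as ! j * \<beta> i j)"
    unfolding AB
    by (intro eq_matI) (auto simp: A B_def scalar_prod_def if_distrib cong: if_cong)
  have "B * A = mat d d (\<lambda>(i, j). \<beta> i j * as ! j)"
    by (intro eq_matI) (auto simp: A B_def scalar_prod_def if_distrib cong: if_cong)
  then show "B * A * B = mat d d (\<lambda>(i, j). \<Sum>k<d. \<beta> i k * as ! k * \<beta> k j)"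
    by (intro eq_matI) (auto simp: B_def scalar_prod_def atLeast0LessThan)
  show "A * B * A * (A * B * A)
      = mat d d (\<lambda>(i, j). as ! i * as ! j * (\<Sum>k<d. \<beta> i k * (as ! k)\<^sup>2 * \<beta> k j))"
    unfolding ABA
    by (intro eq_matI)
      (auto simp: scalar_prod_def atLeast0LessThan sum_distrib_left power2_eq_square mult_ac
        intro!: sum.cong)
qed

text \<open>Both sides are affine in \<open>t\<close>, so the values at 0 and 1 decide.\<close>
lemma weighted_sum_split:
  fixes \<beta> :: "nat \<Rightarrow> nat \<Rightarrow> complex"
  assumes "\<And>t. (\<Sum>k<d. \<beta> i k * (as ! k + t * (as ! k)\<^sup>2) * \<beta> k j) = p + t * q"
  shows "(\<Sum>k<d. \<beta> i k * as ! k * \<beta> k j) = p" "(\<Sum>k<d. \<beta> i k * (as ! k)\<^sup>2 * \<beta> k j) = q"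
proof -
  show 0: "(\<Sum>k<d. \<beta> i k * as ! k * \<beta> k j) = p" using assms[of 0] by simp
  show "(\<Sum>k<d. \<beta> i k * (as ! k)\<^sup>2 * \<beta> k j) = q"
    using assms[of 1] 0 by (simp add: algebra_simps sum.distrib)
qed

text \<open>
  The constant term in \<open>t\<close> of the weighted identity is the entry of $BAB = ABA$ at
  $(i, j)$. The coefficient of \<open>t\<close> is the entry of $BA^2B = s A^{-2}$, which is
  $(ABA)^2 = s$ multiplied by $A^{-1}$ from both sides.
\<close>
lemma braid_matrix_pair_diagonalI:
  fixes as :: "complex list" and \<beta> :: "nat \<Rightarrow> nat \<Rightarrow> complex"
  assumes d: "length as = d" and nz: "0 \<notin> set as" "s \<noteq> 0"
    and weighted: "\<And>t i j. i < d \<Longrightarrow> j < d \<Longrightarrow>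
      (\<Sum>k<d. \<beta> i k * (as ! k + t * (as ! k)\<^sup>2) * \<beta> k j)
        = as ! i * as ! j * \<beta> i j + t * (if i = j then s / (as ! i)\<^sup>2 else 0)"
  shows "braid_matrix_pair d (mk_diagonal as) (mat d d (\<lambda>(i, j). \<beta> i j)) s"
proof -
  note split = weighted_sum_split[OF weighted]
  have nz': "as ! i \<noteq> 0" if "i < d" for i using nz(1) that d by (metis nth_mem)
  note mats = diagonal_pair_mats(2-)[OF d, of \<beta>]
  show ?thesis
  proof
    show "mk_diagonal as \<in> carrier_mat d d" by (rule diagonal_pair_mats(1)[OF d])
    show "mat d d (\<lambda>(i, j). \<beta> i j) \<in> carrier_mat d d" by simp
    show "mk_diagonal as * mat d d (\<lambda>(i, j). \<beta> i j) * mk_diagonal as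
        = mat d d (\<lambda>(i, j). \<beta> i j) * mk_diagonal as * mat d d (\<lambda>(i, j). \<beta> i j)"
      unfolding mats(3,4) by (intro eq_matI) (simp_all add: split)
    show "mk_diagonal as * mat d d (\<lambda>(i, j). \<beta> i j) * mk_diagonal as
        * (mk_diagonal as * mat d d (\<lambda>(i, j). \<beta> i j) * mk_diagonal as) = s \<cdot>\<^sub>m 1\<^sub>m d"
      unfolding mats(5) by (intro eq_matI) (auto simp: split, simp add: nz' power2_eq_square)
  qed (rule nz(2))
qed

lemma (in braid_matrix_pair) conjugate:
  assumes V: "V \<in> carrier_mat d d" and U: "U \<in> carrier_mat d d" and VU: "V * U = 1\<^sub>m d"
  shows "braid_matrix_pair d (V * A * U) (V * B * U) s"
proof -
  have UV: "U * V = 1\<^sub>m d" by (rule mat_mult_left_right_inverse[OF V U VU])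
  have conj: "(V * X * U) * (V * Y * U) = V * (X * Y) * U"
    if X: "X \<in> carrier_mat d d" and Y: "Y \<in> carrier_mat d d" for X Y
  proof -
    have "(V * X * U) * (V * Y * U) = V * X * (U * V) * (Y * U)"
      using U V X Y by (simp add: square_mat_assoc)
    then show ?thesis using U V X Y by (simp add: UV square_mat_assoc)
  qed
  show ?thesis
  proof
    show "V * A * U * (V * B * U) * (V * A * U) = V * B * U * (V * A * U) * (V * B * U)"
      by (simp add: conj braid_rel)
    have "V * (s \<cdot>\<^sub>m 1\<^sub>m d) * U = s \<cdot>\<^sub>m (V * U)" using U V by simp
    then show "V * A * U * (V * B * U) * (V * A * U) * (V * A * U * (V * B * U) * (V * A * U)) = s \<cdot>\<^sub>m 1\<^sub>m d"
      by (simp add: conj central VU)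
  qed (use U V s in simp_all)
qed

lemma (in braid_matrix_pair) scale:
  assumes "c \<noteq> 0"
  shows "braid_matrix_pair d (c \<cdot>\<^sub>m A) (c \<cdot>\<^sub>m B) (c ^ 6 * s)"
  by unfold_locales
    (use assms braid_rel central s in \<open>simp_all add: eval_nat_numeral mult_ac\<close>)

text \<open>
  The conditions on \<open>C\<close> say that its first two columns, together with the first four unit
  vectors, span the whole space. \<open>D\<close> vanishes on all of these vectors.
\<close>
lemma columns_from_generators:
  fixes D C :: "complex mat"
  assumes D: "D \<in> carrier_mat 6 6" and C: "C \<in> carrier_mat 6 6"
    and cols: "\<And>i j. i < 6 \<Longrightarrow> j < 4 \<Longrightarrow> D $$ (i, j) = 0"
    and DC: "\<And>i j. i < 6 \<Longrightarrow> j < 2 \<Longrightarrow> (D * C) $$ (i, j) = 0"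
    and C_entries: "C $$ (4, 0) \<noteq> 0" "C $$ (5, 0) = 0" "C $$ (4, 1) = 0" "C $$ (5, 1) \<noteq> 0"
  shows "D = 0\<^sub>m 6 6"
proof (rule eq_matI)
  fix i j assume "i < dim_row (0\<^sub>m 6 6 :: complex mat)" "j < dim_col (0\<^sub>m 6 6 :: complex mat)"
  then have ij: "i < 6" "j < 6" by simp_all
  have sum: "(D * C) $$ (i, l) = D $$ (i, 4) * C $$ (4, l) + D $$ (i, 5) * C $$ (5, l)" if "l < 6" for l
    using D C ij that cols by (simp add: scalar_prod_def atLeast0LessThan eval_nat_numeral)
  have "D $$ (i, 4) = 0" using sum[of 0] DC[of i 0] ij C_entries by simp
  moreover have "D $$ (i, 5) = 0" using sum[of 1] DC[of i 1] ij C_entries by simp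
  moreover have "j < 4 \<or> j = 4 \<or> j = 5" using ij by linarith
  ultimately show "D $$ (i, j) = 0\<^sub>m 6 6 $$ (i, j)" using ij cols by auto
qed (use D in auto)

text \<open>
  The hypothesis gives $BAB = ABA$, $(ABA)^2 = s$ and $BA^2B = sA^{-2}$ only in the first four
  columns. It remains to prove the first two equations on $ABe_1$ and $ABe_2$, because by the
  conditions on the entries these vectors complete $e_1, \dots, e_4$ to a basis.
\<close>
lemma braid_matrix_pair_six:
  fixes as :: "complex list" and \<beta> :: "nat \<Rightarrow> nat \<Rightarrow> complex"
  assumes d: "length as = 6" and nz: "0 \<notin> set as" "s \<noteq> 0"
    and weighted: "\<And>t i j. i < 6 \<Longrightarrow> j < 4 \<Longrightarrow>
      (\<Sum>k<6. \<beta> i k * (as ! k + t * (as ! k)\<^sup>2) * \<beta> k j)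
        = as ! i * as ! j * \<beta> i j + t * (if i = j then s / (as ! i)\<^sup>2 else 0)"
    and \<beta>: "\<beta> 4 0 \<noteq> 0" "\<beta> 5 0 = 0" "\<beta> 4 1 = 0" "\<beta> 5 1 \<noteq> 0"
  shows "braid_matrix_pair 6 (mk_diagonal as) (mat 6 6 (\<lambda>(i, j). \<beta> i j)) s"
proof -
  define A where "A = mk_diagonal as"
  define B where "B = mat 6 6 (\<lambda>(i, j). \<beta> i j)"
  note mats = diagonal_pair_mats(1)[OF d, folded A_def]
    diagonal_pair_mats(2-)[OF d, of \<beta>, folded A_def B_def]
  note A [simp] = mats(1) and B [simp] = mats(2)
  note split = weighted_sum_split[OF weighted]
  have nz': "as ! i \<noteq> 0" if "i < 6" for i using nz(1) that d by (metis nth_mem)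
  have mult [simp]: "X * Y \<in> carrier_mat 6 6" if "X \<in> carrier_mat 6 6" "Y \<in> carrier_mat 6 6"
    for X Y :: "complex mat" using that by simp
  have assoc: "X * Y * Z = X * (Y * Z)"
    if "X \<in> carrier_mat 6 6" "Y \<in> carrier_mat 6 6" "Z \<in> carrier_mat 6 6" for X Y Z :: "complex mat"
    using that by (rule assoc_mult_mat)
  have AB_entries: "(A * B) $$ (4, 0) \<noteq> 0" "(A * B) $$ (5, 0) = 0"
    "(A * B) $$ (4, 1) = 0" "(A * B) $$ (5, 1) \<noteq> 0"
    using \<beta> nz' by (simp_all add: mats(3))
  have col: "(X * Y) $$ (i, j) = (X * Y') $$ (i, j)"
    if "X \<in> carrier_mat 6 6" "Y \<in> carrier_mat 6 6" "Y' \<in> carrier_mat 6 6" "i < 6" "j < 6"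
      and "\<And>k. k < 6 \<Longrightarrow> Y $$ (k, j) = Y' $$ (k, j)" for X Y Y' :: "complex mat" and i j
    using that by (auto simp: scalar_prod_def intro!: sum.cong)
  have sub: "((X - X') * Y) $$ (i, j) = (X * Y) $$ (i, j) - (X' * Y) $$ (i, j)"
    if "X \<in> carrier_mat 6 6" "X' \<in> carrier_mat 6 6" "Y \<in> carrier_mat 6 6" "i < 6" "j < 6"
    for X X' Y :: "complex mat" and i j
    using that by (subst minus_mult_distrib_mat[of _ 6 6]) auto
  have minus_zero: "X = Y" if "X - Y = 0\<^sub>m 6 6" "X \<in> carrier_mat 6 6" "Y \<in> carrier_mat 6 6"
    for X Y :: "complex mat"
  proof (rule eq_matI)
    fix i j assume ij: "i < dim_row Y" "j < dim_col Y"
    then have "X $$ (i, j) - Y $$ (i, j) = (X - Y) $$ (i, j)" by simp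
    also have "\<dots> = 0" unfolding that(1) using ij that by simp
    finally show "X $$ (i, j) = Y $$ (i, j)" by simp
  qed (use that in auto)
  have minus [simp]: "X - Y \<in> carrier_mat 6 6" "i < 6 \<Longrightarrow> j < 6 \<Longrightarrow> (X - Y) $$ (i, j) = X $$ (i, j) - Y $$ (i, j)"
    if "X \<in> carrier_mat 6 6" "Y \<in> carrier_mat 6 6" for X Y :: "complex mat" and i j
    using that by auto
  have BAB_col: "(B * A * B) $$ (i, j) = (A * B * A) $$ (i, j)" if "i < 6" "j < 4" for i j
    using that by (simp only: mats(4,5)) (simp add: split)
  have TT_col: "(A * B * A * (A * B * A)) $$ (i, j) = (s \<cdot>\<^sub>m 1\<^sub>m 6) $$ (i, j)" if "i < 6" "j < 4" for i j
    using that unfolding mats(6) by (auto simp: split) (simp add: nz' power2_eq_square)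
  have F_col: "(B * (A * (A * B))) $$ (i, j) = (if i = j then s / (as ! i)\<^sup>2 else 0)"
    if "i < 6" "j < 4" for i j
  proof -
    have "A * (A * B) = mat 6 6 (\<lambda>(i, j). (as ! i)\<^sup>2 * \<beta> i j)"
      using A unfolding mats(3) unfolding A_def mk_diagonal_eq_mat d
      by (intro eq_matI) (auto simp: scalar_prod_def power2_eq_square if_distrib[of "\<lambda>y. y * _"] cong: if_cong)
    then have "(B * (A * (A * B))) $$ (i, j) = (\<Sum>k<6. \<beta> i k * (as ! k)\<^sup>2 * \<beta> k j)"
      using that by (simp add: B_def scalar_prod_def atLeast0LessThan mult.assoc)
    then show ?thesis using that by (simp add: split)
  qed
  have diag_left: "(A * X) $$ (i, j) = as ! i * X $$ (i, j)"
    if "X \<in> carrier_mat 6 6" "i < 6" "j < 6" for X i j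
    using that by (simp add: A_def mk_diagonal_eq_mat d scalar_prod_def
        if_distrib[of "\<lambda>y. y * _"] cong: if_cong)
  have diag_right: "(X * A) $$ (i, j) = X $$ (i, j) * as ! j"
    if "X \<in> carrier_mat 6 6" "i < 6" "j < 6" for X i j
    using that by (simp add: A_def mk_diagonal_eq_mat d scalar_prod_def
        if_distrib[of "\<lambda>y. _ * y"] cong: if_cong)
  \<comment> \<open>For $j \le 2$ the braid relation on $e_j$ gives $BAB \cdot AB e_j = BA \cdot ABA e_j = BA^2B \cdot A e_j$.
    Here $BA^2B$ is diagonal on $e_j$, so that the last vector is $A \cdot BA^2B e_j = ABA \cdot AB e_j$.\<close>
  have "B * A * B - A * B * A = 0\<^sub>m 6 6"
  proof (rule columns_from_generators[OF _ _ _ _ AB_entries])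
    fix i j :: nat assume ij: "i < 6" "j < 2"
    have "(B * A * B * (A * B)) $$ (i, j) = (B * A * (B * A * B)) $$ (i, j)"
      by (simp add: assoc)
    also have "\<dots> = (B * A * (A * B * A)) $$ (i, j)"
      using ij by (intro col) (auto intro: BAB_col)
    also have "\<dots> = (B * (A * (A * B)) * A) $$ (i, j)" by (simp add: assoc)
    also have "\<dots> = (A * (B * (A * (A * B)))) $$ (i, j)"
      using ij by (simp add: diag_left diag_right F_col)
    also have "\<dots> = (A * B * A * (A * B)) $$ (i, j)" by (simp add: assoc)
    finally show "((B * A * B - A * B * A) * (A * B)) $$ (i, j) = 0"
      using ij by (simp add: sub)
  qed (simp_all add: BAB_col)
  then have braid: "A * B * A = B * A * B" by (rule minus_zero[symmetric]) simp_all
  \<comment> \<open>Once the braid relation is known, $(ABA)^2 = (AB)^3$ commutes with $AB$.\<close>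
  have "A * B * A * (A * B * A) - s \<cdot>\<^sub>m 1\<^sub>m 6 = 0\<^sub>m 6 6"
  proof (rule columns_from_generators[OF _ _ _ _ AB_entries])
    fix i j :: nat assume ij: "i < 6" "j < 2"
    have "A * B * A * (A * B * A) = A * B * A * (B * A * B)" by (rule arg_cong[OF braid])
    then have TT: "A * B * A * (A * B * A) = A * B * (A * B * (A * B))" by (simp only: assoc A B mult)
    have "A * B * A * (A * B * A) * (A * B) = A * B * (A * B * A * (A * B * A))"
      unfolding TT by (simp only: assoc A B mult)
    also have "\<dots> $$ (i, j) = (A * B * (s \<cdot>\<^sub>m 1\<^sub>m 6)) $$ (i, j)"
      using ij by (intro col) (simp_all add: TT_col del: index_smult_mat index_one_mat)
    also have "\<dots> = (s \<cdot>\<^sub>m 1\<^sub>m 6 * (A * B)) $$ (i, j)"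
      by (simp add: mult_smult_distrib[of _ 6 6 _ 6] mult_smult_assoc_mat[of _ 6 6 _ 6]
          left_mult_one_mat[of _ 6 6] right_mult_one_mat[of _ 6 6])
    finally show "((A * B * A * (A * B * A) - s \<cdot>\<^sub>m 1\<^sub>m 6) * (A * B)) $$ (i, j) = 0"
      using ij by (simp add: sub)
  qed (simp_all add: TT_col del: index_smult_mat index_one_mat)
  then have "A * B * A * (A * B * A) = s \<cdot>\<^sub>m 1\<^sub>m 6" by (rule minus_zero) simp_all
  with braid show ?thesis unfolding A_def[symmetric] B_def[symmetric]
    by unfold_locales (use nz in auto)
qed

section \<open>Elementary symmetric polynomials\<close>

lemma esym_0 [simp]: "finite I \<Longrightarrow> esym 0 x I = 1"
proof -
  assume I: "finite I"
  then have "{S. S \<subseteq> I \<and> card S = 0} = {{}}"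
    by (auto dest: finite_subset)
  then show ?thesis by (simp add: esym_def)
qed

lemma esym_empty [simp]: "esym (Suc k) x {} = 0"
proof -
  have "{S. S \<subseteq> ({}::nat set) \<and> card S = Suc k} = {}" by auto
  then show ?thesis by (simp only: esym_def sum.empty)
qed

lemma esym_insert:
  assumes I: "finite I" and i: "i \<notin> I"
  shows "esym (Suc k) x (insert i I) = esym (Suc k) x I + x i * esym k x I"
proof -
  have split: "{S. S \<subseteq> insert i I \<and> card S = Suc k}
      = {S. S \<subseteq> I \<and> card S = Suc k} \<union> insert i ` {S. S \<subseteq> I \<and> card S = k}" (is "_ = ?L \<union> ?R")
  proof (intro equalityI subsetI)
    fix S assume "S \<in> {S. S \<subseteq> insert i I \<and> card S = Suc k}"
    then have S: "S \<subseteq> insert i I" "card S = Suc k" by auto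
    then have fin: "finite S" using I finite_subset by blast
    show "S \<in> ?L \<union> ?R"
    proof (cases "i \<in> S")
      case True
      then have "S = insert i (S - {i})" "S - {i} \<subseteq> I" "card (S - {i}) = k"
        using S fin by auto
      then show ?thesis by blast
    qed (use S in auto)
  next
    fix S assume "S \<in> ?L \<union> ?R"
    then show "S \<in> {S. S \<subseteq> insert i I \<and> card S = Suc k}"
    proof (elim UnE imageE)
      fix T assume "T \<in> {S. S \<subseteq> I \<and> card S = k}" "S = insert i T"
      moreover from this have "finite T" "i \<notin> T" using I i by (auto dest: finite_subset)
      ultimately show ?thesis by auto
    qed auto
  qed
  have inj: "inj_on (insert i) {S. S \<subseteq> I \<and> card S = k}"
  proof (rule inj_onI)
    fix S T assume ST: "S \<in> {S. S \<subseteq> I \<and> card S = k}" "T \<in> {S. S \<subseteq> I \<and> card S = k}" "insert i S = insert i T"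
    then show "S = T" using i by (metis (mono_tags, lifting) insert_ident mem_Collect_eq subsetD)
  qed
  have "(\<Sum>S\<in>?R. \<Prod>j\<in>S. x j) = (\<Sum>S | S \<subseteq> I \<and> card S = k. x i * (\<Prod>j\<in>S. x j))"
    unfolding sum.reindex[OF inj] o_def
  proof (rule sum.cong[OF HOL.refl])
    fix S assume "S \<in> {S. S \<subseteq> I \<and> card S = k}"
    then have "finite S" "i \<notin> S" using I i by (auto dest: finite_subset)
    then show "(\<Prod>j\<in>insert i S. x j) = x i * (\<Prod>j\<in>S. x j)" by simp
  qed
  moreover have "(\<Sum>S\<in>?L \<union> ?R. \<Prod>j\<in>S. x j) = (\<Sum>S\<in>?L. \<Prod>j\<in>S. x j) + (\<Sum>S\<in>?R. \<Prod>j\<in>S. x j)"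
    using I i by (intro sum.union_disjoint) auto
  ultimately show ?thesis
    by (simp add: esym_def split sum_distrib_left)
qed

lemma esym_numeral_insert:
  assumes "finite I" "i \<notin> I"
  shows "esym (numeral k) x (insert i I) = esym (numeral k) x I + x i * esym (pred_numeral k) x I"
  using esym_insert[OF assms] by (simp add: numeral_eq_Suc)

lemma esym_numeral_empty: "esym (numeral k) x {} = 0"
  by (simp add: numeral_eq_Suc)

lemmas esym_simps [simp] = esym_insert esym_numeral_insert esym_numeral_empty

lemma esym_card_less:
  assumes "finite I" "card I < k"
  shows "esym k x I = 0"
proof -
  have "{S. S \<subseteq> I \<and> card S = k} = {}" using assms by (auto dest: card_mono)
  then show ?thesis by (simp only: esym_def sum.empty)
qed

lemma esym_full: "esym n x {1..n} = (\<Prod>i\<in>{1..n}. x i)"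
proof -
  have "{S. S \<subseteq> {1..n} \<and> card S = n} = {{1..n}}"
  proof (intro equalityI subsetI)
    fix S assume "S \<in> {S. S \<subseteq> {1..n} \<and> card S = n}"
    then have "S = {1..n}" by (intro card_subset_eq) simp_all
    then show "S \<in> {{1..n}}" by simp
  qed simp
  then show ?thesis by (simp only: esym_def) simp
qed

section \<open>Dimensions one, two and three\<close>

text \<open>
  The rational identities below are proved by writing all fractions over the Vandermonde product
  of the variables involved, a common multiple of the denominators. The rest is a polynomial
  identity.
\<close>
lemma divide_common_denominator:
  fixes D c V N :: complex
  assumes "V = D * c" "V \<noteq> 0"
  shows "N / D = N * c / V"
  using assms by simp

text \<open>
  The product $\Delta_i(X)$ as a function of values, the first of which is $x_i$. The order of
  the others does not matter. With this an identity proved once can be used for all positions.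
\<close>
definition root_diff3 :: "complex \<Rightarrow> complex \<Rightarrow> complex \<Rightarrow> complex" where
  "root_diff3 a b c = (b - a) * (c - a)"

context
  fixes a b c t V :: complex
  assumes dist: "distinct [a, b, c]"
  defines "V \<equiv> (a - b) * (a - c) * (b - c)"
begin

lemma vandermonde3: "V \<noteq> 0" using dist by (simp add: V_def)

lemma vandermonde_denominators3:
  "N / root_diff3 a b c = N * (b - c) / V"
  "N / root_diff3 b a c = N * (- (a - c)) / V"
  "N / root_diff3 c a b = N * (a - b) / V"
  by - (rule divide_common_denominator[OF _ vandermonde3], (unfold V_def root_diff3_def)[1], Groebner_Basis.algebra)+

lemmas clear_denominators3 = vandermonde_denominators3 add_divide_distrib[symmetric] nonzero_divide_eq_eq[OF vandermonde3]

text \<open>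
  The weighted identity at a position outside of the diagonal, divided by the entry of $\rho(g_2)$
  at that position. The numbers \<open>a\<close> and \<open>b\<close> are the eigenvalues of the row and the
  column.
\<close>
lemma pair3:
  "(a + t*a^2) * (b*c*(b+c)) / root_diff3 a b c + (b + t*b^2) * (a*c*(a+c)) / root_diff3 b a c
    + (1 + t*c) * (a*b*(c^2 + a*b)) / root_diff3 c a b = a * b"
  unfolding clear_denominators3 unfolding V_def by Groebner_Basis.algebra

text \<open>The weighted identity on the diagonal, multiplied by $\Delta_i(X)$.\<close>
lemma diag3:
  "(a + t*a^2) * (b*c*(b+c))^2 / root_diff3 a b c + (b + t*b^2) * (c^2*(a^2 + b*c)*(b^2 + a*c)) / root_diff3 b a c
    + (c + t*c^2) * (b^2*(a^2 + b*c)*(c^2 + a*b)) / root_diff3 c a b = a^2 * (b*c*(b+c)) + t * (b^2*c^2 * root_diff3 a b c)"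
  unfolding clear_denominators3 unfolding V_def root_diff3_def by Groebner_Basis.algebra

lemma off_diag_weighted3:
  "b*c*(b+c) / root_diff3 a b c * (a + t*a^2) * (c*(a^2 + b*c) / root_diff3 a b c)
    + c*(a^2 + b*c) / root_diff3 a b c * (b + t*b^2) * (a*c*(a+c) / root_diff3 b a c)
    + b*(a^2 + b*c) / root_diff3 a b c * (c + t*c^2) * (a*(c^2 + a*b) / root_diff3 c a b)
    = a * b * (c*(a^2 + b*c) / root_diff3 a b c)"
proof -
  define F where "F = c*(a^2 + b*c) / root_diff3 a b c"
  have weight: "c + t*c^2 = c * (1 + t*c)" by (simp add: power2_eq_square algebra_simps)
  have 1: "n / P * w * F = F * (w * n / P)" and 2: "F * w * (n / P) = F * (w * n / P)" for n P w
    by (simp_all add: mult_ac)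
  have 3: "b*(a^2 + b*c) / root_diff3 a b c * (c + t*c^2) * (a*(c^2 + a*b) / P) = F * ((1 + t*c) * (a*b*(c^2 + a*b)) / P)" for P
    unfolding weight by (simp add: F_def mult_ac)
  show ?thesis
    unfolding 3 F_def[symmetric] 1 2
    using arg_cong[OF pair3, of "\<lambda>y. F * y"] by (simp only: distrib_left[of F] mult.commute[of "a * b" F])
qed

lemma diag_weighted3:
  assumes "a \<noteq> 0"
  shows "b*c*(b+c) / root_diff3 a b c * (a + t*a^2) * (b*c*(b+c) / root_diff3 a b c)
    + c*(a^2 + b*c) / root_diff3 a b c * (b + t*b^2) * (c*(b^2 + a*c) / root_diff3 b a c)
    + b*(a^2 + b*c) / root_diff3 a b c * (c + t*c^2) * (b*(c^2 + a*b) / root_diff3 c a b)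
    = a * a * (b*c*(b+c) / root_diff3 a b c) + t * ((a*b*c)^2 / a^2)"
proof -
  have "root_diff3 a b c \<noteq> 0" using dist by (auto simp: root_diff3_def)
  then show ?thesis
    using arg_cong[OF diag3, of "\<lambda>y. 1 / root_diff3 a b c * y"] assms
    by (simp only: distrib_left[of "1 / _"]) (simp add: power2_eq_square mult_ac)
qed

end

theorem rho3_braid_matrix_pair:
  assumes inj: "inj_on x {1..3}" and nz: "\<forall>i\<in>{1..3}. x i \<noteq> 0"
  shows "braid_matrix_pair 3 (rho3_g1 x) (rho3_g2 x) ((x 1 * x 2 * x 3)\<^sup>2)"
proof -
  define g where "g = (\<lambda>i j. rho3_g2 x $$ (i, j))"
  have "{1..3::nat} - {1} = {2, 3}" "{1..3::nat} - {2} = {1, 3}" "{1..3::nat} - {3} = {1, 2}" by auto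
  then have D: "Delta 1 x {1..3} = root_diff3 (x 1) (x 2) (x 3)" "Delta 2 x {1..3} = root_diff3 (x 2) (x 1) (x 3)"
    "Delta 3 x {1..3} = root_diff3 (x 3) (x 1) (x 2)"
    unfolding Delta_def root_diff3_def by simp_all
  have g: "rho3_g2 x = mat 3 3 (\<lambda>(i, j). g i j)"
    by (rule eq_matI) (simp_all add: g_def rho3_g2_def mat_of_rows_list_def Let_def)
  have sets: "distinct [x 1, x 2, x 3]"
    using inj_onD[OF inj, of 1 2] inj_onD[OF inj, of 1 3] inj_onD[OF inj, of 2 3] by auto
  have nz': "x 1 \<noteq> 0" "x 2 \<noteq> 0" "x 3 \<noteq> 0" using nz by auto
  show ?thesis
    unfolding rho3_g1_def g
  proof (rule braid_matrix_pair_diagonalI)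
    show "length [x 1, x 2, x 3] = 3" by simp
    show "0 \<notin> set [x 1, x 2, x 3]" "(x 1 * x 2 * x 3)\<^sup>2 \<noteq> 0" using nz' by simp_all
    fix t :: complex and i j :: nat
    assume ij: "i < 3" "j < 3"
    let ?as = "[x 1, x 2, x 3]"
    note e = off_diag_weighted3[of "x 1" "x 2" "x 3" t] off_diag_weighted3[of "x 1" "x 3" "x 2" t]
      off_diag_weighted3[of "x 2" "x 1" "x 3" t] off_diag_weighted3[of "x 2" "x 3" "x 1" t]
      off_diag_weighted3[of "x 3" "x 1" "x 2" t] off_diag_weighted3[of "x 3" "x 2" "x 1" t]
      diag_weighted3[of "x 1" "x 2" "x 3" t] diag_weighted3[of "x 2" "x 1" "x 3" t] diag_weighted3[of "x 3" "x 1" "x 2" t]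
    have sum: "(\<Sum>k<3. g i k * (?as ! k + t * (?as ! k)\<^sup>2) * g k j)
      = g i 0 * (x 1 + t * (x 1)\<^sup>2) * g 0 j + g i 1 * (x 2 + t * (x 2)\<^sup>2) * g 1 j + g i 2 * (x 3 + t * (x 3)\<^sup>2) * g 2 j"
      by (simp add: eval_nat_numeral)
    have entries:
      "g 0 0 = x 2 * x 3 * (x 2 + x 3) / root_diff3 (x 1) (x 2) (x 3)"
      "g 0 1 = x 3 * ((x 1)\<^sup>2 + x 2 * x 3) / root_diff3 (x 1) (x 2) (x 3)"
      "g 0 2 = x 2 * ((x 1)\<^sup>2 + x 2 * x 3) / root_diff3 (x 1) (x 2) (x 3)"
      "g 1 0 = x 3 * ((x 2)\<^sup>2 + x 1 * x 3) / root_diff3 (x 2) (x 1) (x 3)"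
      "g 1 1 = x 1 * x 3 * (x 1 + x 3) / root_diff3 (x 2) (x 1) (x 3)"
      "g 1 2 = x 1 * ((x 2)\<^sup>2 + x 1 * x 3) / root_diff3 (x 2) (x 1) (x 3)"
      "g 2 0 = x 2 * ((x 3)\<^sup>2 + x 1 * x 2) / root_diff3 (x 3) (x 1) (x 2)"
      "g 2 1 = x 1 * ((x 3)\<^sup>2 + x 1 * x 2) / root_diff3 (x 3) (x 1) (x 2)"
      "g 2 2 = x 1 * x 2 * (x 1 + x 2) / root_diff3 (x 3) (x 1) (x 2)"
      by (simp_all add: g_def rho3_g2_def mat_of_rows_list_def Let_def D del: One_nat_def)
    have root_diff3_swap: "root_diff3 u w v = root_diff3 u v w" for u v w by (simp add: root_diff3_def)
    have "distinct [x 1, x 3, x 2]" "distinct [x 2, x 1, x 3]" "distinct [x 2, x 3, x 1]"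
      "distinct [x 3, x 1, x 2]" "distinct [x 3, x 2, x 1]" using sets by auto
    note e = e(1)[OF sets] e(2)[OF this(1)] e(3)[OF this(2)] e(4)[OF this(3)] e(5)[OF this(4)] e(6)[OF this(5)]
      e(7)[OF sets nz'(1)] e(8)[OF this(2) nz'(2)] e(9)[OF this(4) nz'(3)]
    let ?S = "\<lambda>i j. g i 0 * (x 1 + t * (x 1)\<^sup>2) * g 0 j + g i 1 * (x 2 + t * (x 2)\<^sup>2) * g 1 j + g i 2 * (x 3 + t * (x 3)\<^sup>2) * g 2 j"
    have "?S 0 1 = x 1 * x 2 * g 0 1"
      using e(1) unfolding entries by (simp only: root_diff3_swap add_ac mult_ac)
    moreover have "?S 0 2 = x 1 * x 3 * g 0 2"
      using e(2) unfolding entries by (simp only: root_diff3_swap add_ac mult_ac)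
    moreover have "?S 1 0 = x 2 * x 1 * g 1 0"
      using e(3) unfolding entries by (simp only: root_diff3_swap add_ac mult_ac)
    moreover have "?S 1 2 = x 2 * x 3 * g 1 2"
      using e(4) unfolding entries by (simp only: root_diff3_swap add_ac mult_ac)
    moreover have "?S 2 0 = x 3 * x 1 * g 2 0"
      using e(5) unfolding entries by (simp only: root_diff3_swap add_ac mult_ac)
    moreover have "?S 2 1 = x 3 * x 2 * g 2 1"
      using e(6) unfolding entries by (simp only: root_diff3_swap add_ac mult_ac)
    moreover have "?S 0 0 = x 1 * x 1 * g 0 0 + t * ((x 1 * x 2 * x 3)\<^sup>2 / (x 1)\<^sup>2)"
      using e(7) unfolding entries by (simp only: root_diff3_swap add_ac mult_ac)
    moreover have "?S 1 1 = x 2 * x 2 * g 1 1 + t * ((x 1 * x 2 * x 3)\<^sup>2 / (x 2)\<^sup>2)"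
      using e(8) unfolding entries by (simp only: root_diff3_swap add_ac mult_ac)
    moreover have "?S 2 2 = x 3 * x 3 * g 2 2 + t * ((x 1 * x 2 * x 3)\<^sup>2 / (x 3)\<^sup>2)"
      using e(9) unfolding entries by (simp only: root_diff3_swap add_ac mult_ac)
    moreover have "i = 0 \<or> i = 1 \<or> i = 2" "j = 0 \<or> j = 1 \<or> j = 2" using ij by auto
    ultimately show "(\<Sum>k<3. g i k * (?as ! k + t * (?as ! k)\<^sup>2) * g k j)
      = ?as ! i * ?as ! j * g i j + t * (if i = j then (x 1 * x 2 * x 3)\<^sup>2 / (?as ! i)\<^sup>2 else 0)"
      unfolding sum by (elim disjE) simp_all
  qed
qed

theorem rho2_braid_matrix_pair:
  assumes inj: "inj_on x {1..2}" and nz: "\<forall>i\<in>{1..2}. x i \<noteq> 0"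
  shows "braid_matrix_pair 2 (rho2_g1 x) (rho2_g2 x) (- ((x 1 * x 2) ^ 3))"
proof -
  define g where "g = (\<lambda>i j. rho2_g2 x $$ (i, j))"
  define a b where "a = x 1" and "b = x 2"
  have ab: "a \<noteq> 0" "b \<noteq> 0" "a - b \<noteq> 0" using inj nz inj_onD[OF inj, of 1 2] by (auto simp: a_def b_def)
  have g: "rho2_g2 x = mat 2 2 (\<lambda>(i, j). g i j)"
    by (rule eq_matI) (simp_all add: g_def rho2_g2_def mat_of_rows_list_def)
  have entries: "g 0 0 = -(b^2) / (a - b)" "g 0 1 = - (a * b) / (a - b)"
    "g 1 0 = (a^2 - a * b + b^2) / (a - b)" "g 1 1 = a^2 / (a - b)"
    by (simp_all add: g_def rho2_g2_def mat_of_rows_list_def a_def b_def)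
  show ?thesis
    unfolding rho2_g1_def g a_def[symmetric] b_def[symmetric]
  proof (rule braid_matrix_pair_diagonalI)
    show "length [a, b] = 2" by simp
    show "0 \<notin> set [a, b]" "-((a * b) ^ 3) \<noteq> 0" using ab by simp_all
    fix t :: complex and i j :: nat
    assume ij: "i < 2" "j < 2"
    have d: "t * (-((a * b) ^ 3) / a^2) = - (t * a * b^3)" "t * (-((a * b) ^ 3) / b^2) = - (t * a^3 * b)"
      using ab by (simp_all add: power2_eq_square power3_eq_cube field_simps)
    have frac: "n / D * w * (m / D) + n' / D * w' * (m' / D) = p * (q / D) + r"
      if "n * w * m + n' * w' * m' = p * q * D + r * D^2" "D \<noteq> 0" for n m w n' m' w' p q r D :: complex
      using that by (simp add: field_simps power2_eq_square)
    let ?S = "\<lambda>i j. g i 0 * (a + t*a^2) * g 0 j + g i 1 * (b + t*b^2) * g 1 j"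
    have sum: "(\<Sum>k<2. g i k * ([a, b] ! k + t * ([a, b] ! k)\<^sup>2) * g k j) = ?S i j"
      by (simp add: numeral_2_eq_2)
    have "?S 0 0 = a * a * g 0 0 + t * (-((a * b) ^ 3) / a^2)"
      unfolding entries d by (rule frac[OF _ ab(3)]) Groebner_Basis.algebra
    moreover have "?S 0 1 = a * b * g 0 1 + 0"
      unfolding entries by (rule frac[OF _ ab(3)]) Groebner_Basis.algebra
    moreover have "?S 1 0 = b * a * g 1 0 + 0"
      unfolding entries by (rule frac[OF _ ab(3)]) Groebner_Basis.algebra
    moreover have "?S 1 1 = b * b * g 1 1 + t * (-((a * b) ^ 3) / b^2)"
      unfolding entries d by (rule frac[OF _ ab(3)]) Groebner_Basis.algebra
    moreover have "i = 0 \<or> i = 1" "j = 0 \<or> j = 1" using ij by auto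
    ultimately show "(\<Sum>k<2. g i k * ([a, b] ! k + t * ([a, b] ! k)\<^sup>2) * g k j)
      = [a, b] ! i * [a, b] ! j * g i j + t * (if i = j then -((a * b) ^ 3) / ([a, b] ! i)\<^sup>2 else 0)"
      unfolding sum by (elim disjE) simp_all
  qed
qed

lemma rho1_mat_eq_diagonal: "rho1_mat x = mk_diagonal [x 1]"
  by (rule eq_matI) (auto simp: rho1_mat_def mat_of_rows_list_def mk_diagonal_eq_mat)

theorem rho1_braid_matrix_pair:
  assumes "x 1 \<noteq> 0"
  shows "braid_matrix_pair 1 (rho1_mat x) (rho1_mat x) (x 1 ^ 6)"
proof -
  have B: "rho1_mat x = mat 1 1 (\<lambda>(i, j). x 1)"
    by (rule eq_matI) (auto simp: rho1_mat_def mat_of_rows_list_def)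
  have "braid_matrix_pair 1 (mk_diagonal [x 1]) (mat 1 1 (\<lambda>(i, j). x 1)) (x 1 ^ 6)"
    using assms
    by (intro braid_matrix_pair_diagonalI)
      (simp_all add: eval_nat_numeral algebra_simps)
  then show ?thesis using rho1_mat_eq_diagonal B by simp
qed

section \<open>Dimension four\<close>

text \<open>
  $q_a$ and $\gamma_a$ depend only on the partition of $\{1,2,3,4\}$ into $\{1, a\}$ and the complementary
  pair. \<^term>\<open>pairing i j\<close> is the $a$ whose partition has $\{i, j\}$ as a block. For
  $i, j \neq 1$ the partner of 1 is the remaining element of $\{2,3,4\}$, which is $9 - i - j$.
\<close>
definition pairing :: "nat \<Rightarrow> nat \<Rightarrow> nat" where
  "pairing i j = (if i = 1 then j else if j = 1 then i else 9 - i - j)"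

text \<open>
  The part of the entries outside of the diagonal that depends on the row and the column jointly.
  It has the same shape in dimension 4 (with $\gamma$ for \<open>q\<close>) and in the upper left block
  of dimension 6. The remaining factors of such an entry depend on the row alone or on the column
  alone.
\<close>
definition kappa :: "(nat \<Rightarrow> complex) \<Rightarrow> nat \<Rightarrow> nat \<Rightarrow> complex" where
  "kappa q i j = (if i = 1 then \<Prod>b\<in>{2, 3, 4} - {j}. q b else if j = 1 then 1 else q i)"

text \<open>
  The statements about a position $(i, j)$ also mention the two other indices \<open>k\<close> and
  \<open>l\<close>. Quantifying over all orderings of $\{1,2,3,4\}$ treats all positions at once, although
  the formulas for the entries single out the index 1.
\<close>
definition enum4 :: "nat \<Rightarrow> nat \<Rightarrow> nat \<Rightarrow> nat \<Rightarrow> bool" where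
  "enum4 i j k l \<longleftrightarrow> distinct [i, j, k, l] \<and> {i, j, k, l} = {1, 2, 3, 4}"

lemma enum4_cases:
  assumes "enum4 i j k l"
  shows "(i, j, k, l) \<in> {(1,2,3,4), (1,2,4,3), (1,3,2,4), (1,3,4,2), (1,4,2,3), (1,4,3,2),
    (2,1,3,4), (2,1,4,3), (2,3,1,4), (2,3,4,1), (2,4,1,3), (2,4,3,1),
    (3,1,2,4), (3,1,4,2), (3,2,1,4), (3,2,4,1), (3,4,1,2), (3,4,2,1),
    (4,1,2,3), (4,1,3,2), (4,2,1,3), (4,2,3,1), (4,3,1,2), (4,3,2,1)}"
proof -
  have "i \<in> {1, 2, 3, 4}" "j \<in> {1, 2, 3, 4}" "k \<in> {1, 2, 3, 4}" "l \<in> {1, 2, 3, 4}"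
    "distinct [i, j, k, l]"
    using assms unfolding enum4_def by blast+
  then show ?thesis by (elim insertE emptyE) simp_all
qed

text \<open>
  This is why \<^term>\<open>kappa q i j\<close> is a common factor of the terms with $k \neq i, j$ in the
  weighted identity at $(i, j)$, and why the cofactor $q$ is the same for both such $k$.
\<close>
lemma kappa_chain:
  assumes "enum4 i j k l"
  shows "kappa q i k * kappa q k j = kappa q i j * q (pairing i j)"
  using enum4_cases[OF assms]
  by (elim insertE emptyE) (simp_all add: kappa_def pairing_def insert_Diff_if)

text \<open>
  On the diagonal the products are symmetric in the remaining indices, so the exceptional role of the
  index 1 disappears there.
\<close>
lemma kappa_cycle:
  assumes "enum4 i j k l"
  shows "kappa q i j * kappa q j i = q (pairing i k) * q (pairing i l)"
  using enum4_cases[OF assms]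
  by (elim insertE emptyE) (simp_all add: kappa_def pairing_def insert_Diff_if)

lemma q6_pairing:
  assumes "enum4 i j k l"
  shows "q6 x (pairing i j) = x i * x j + x k * x l"
  using enum4_cases[OF assms]
  by (elim insertE emptyE) (simp_all add: q6_def pairing_def insert_Diff_if)

lemma gamma4_pairing:
  assumes "enum4 i j k l"
  shows "gamma4 h x (pairing i j) = x i * x j + x k * x l - h"
  using enum4_cases[OF assms]
  by (elim insertE emptyE) (simp_all add: gamma4_def pairing_def insert_Diff_if)

lemma Diff_enum4:
  assumes "enum4 i j k l"
  shows "{1..5} - {i} = {j, k, l, 5}" "{1..5} - {5::nat} = {i, j, k, l}" "{1..4} - {i} = {j, k, l}"
    "{1..5::nat} = {i, j, k, l, 5}" "{1..4::nat} = {i, j, k, l}" "5 \<notin> {i, j, k, l}"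
proof -
  have *: "{1..5::nat} = insert 5 {1, 2, 3, 4}" "{1..4::nat} = {1, 2, 3, 4}" by auto
  have "{i, j, k, l} = {1, 2, 3, 4}" and d: "distinct [i, j, k, l]" using assms by (auto simp: enum4_def)
  then have **: "{1..5::nat} = insert 5 {i, j, k, l}" "{1..4::nat} = {i, j, k, l}" using * by simp_all
  show "5 \<notin> {i, j, k, l}" using \<open>{i, j, k, l} = {1, 2, 3, 4}\<close> by simp
  then show "{1..5} - {i} = {j, k, l, 5}" "{1..5} - {5::nat} = {i, j, k, l}" "{1..4} - {i} = {j, k, l}"
    "{1..5::nat} = {i, j, k, l, 5}" "{1..4::nat} = {i, j, k, l}"
    unfolding ** using d by auto
qed

lemma enum4_exists:
  assumes "i \<in> {1, 2, 3, 4}" "j \<in> {1, 2, 3, 4}" "i \<noteq> j"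
  shows "\<exists>k l. enum4 i j k l"
proof -
  have "card ({1, 2, 3, 4} - {i, j}) = 2" using assms by (simp add: card_Diff_subset)
  then obtain k l where kl: "{1, 2, 3, 4} - {i, j} = {k, l}" "k \<noteq> l" by (auto simp: card_2_iff)
  have "{i, j} \<union> {k, l} = {1, 2, 3, 4}" unfolding kl(1)[symmetric] using assms by blast
  moreover have "k \<notin> {i, j}" "l \<notin> {i, j}" using kl(1) by blast+
  ultimately have "enum4 i j k l" using assms kl(2) by (simp add: enum4_def insert_commute)
  then show ?thesis by blast
qed

text \<open>
  $\alpha_i$, $\beta_i$ and $\Delta_i(X)$ as functions of $x_i$ and the three other values, where
  $e_4(X)/x_i^2$ is simplified to the product of the others divided by $x_i$.
\<close>
definition alpha4_val where "alpha4_val h a b c (d::complex) = b*c*d*(b+c+d) - h*(b*c+b*d+c*d)"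
definition beta4_val where "beta4_val h a b c (d::complex) = b*c*d/a - h"
definition root_diff4 where "root_diff4 a b c (d::complex) = (b-a)*(c-a)*(d-a)"

context
  fixes a b c d h t V :: complex
  assumes dist: "distinct [a, b, c, d]" and nz: "a \<noteq> 0" "b \<noteq> 0" "c \<noteq> 0" "d \<noteq> 0"
    and h: "h^2 = a*b*c*d"
  defines "V \<equiv> (a-b)*(a-c)*(a-d)*(b-c)*(b-d)*(c-d)"
begin

lemma vandermonde4: "V \<noteq> 0" using dist by (simp add: V_def)

lemma vandermonde_denominators4:
  "N / root_diff4 a b c d = N * (-(b-c)*(b-d)*(c-d)) / V"
  "N / root_diff4 b a c d = N * ((a-c)*(a-d)*(c-d)) / V"
  "N / root_diff4 c a b d = N * (-(a-b)*(a-d)*(b-d)) / V"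
  "N / root_diff4 d a b c = N * ((a-b)*(a-c)*(b-c)) / V"
  by - (rule divide_common_denominator[OF _ vandermonde4], (unfold V_def root_diff4_def)[1], Groebner_Basis.algebra)+

lemmas clear_denominators4 = vandermonde_denominators4 add_divide_distrib[symmetric] nonzero_divide_eq_eq[OF vandermonde4]

text \<open>
  The weight contains a factor that cancels the denominator of $\beta$, so that only the
  denominators $\Delta_k(X)$ are left.
\<close>
lemma beta4_val_eq: "(c + t*c^2) * beta4_val h c a b d = (1 + t * c) * (a*b*d - h*c)"
  "(d + t*d^2) * beta4_val h d a b c = (1 + t * d) * (a*b*c - h*d)"
  "(b + t*b^2) * beta4_val h b a c d = (1 + t * b) * (a*c*d - h*b)"
  "a * beta4_val h a b c d = b*c*d - h*a"
  using nz by (simp_all add: beta4_val_def field_simps power2_eq_square)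

text \<open>
  The weighted identity outside of the diagonal, divided by the entry at that position. By
  \<open>kappa_chain\<close> both \<open>c\<close> and \<open>d\<close> come with the factor
  $\gamma = ab + cd - h$.
\<close>
lemma pair4:
  "(a + t*a^2) * alpha4_val h a b c d / root_diff4 a b c d + (b + t*b^2) * alpha4_val h b a c d / root_diff4 b a c d
   + (c + t*c^2) * beta4_val h c a b d * (a*b+c*d-h) / root_diff4 c a b d
   + (d + t*d^2) * beta4_val h d a b c * (a*b+c*d-h) / root_diff4 d a b c = a * b"
  unfolding clear_denominators4 beta4_val_eq
  unfolding V_def alpha4_val_def using h by Groebner_Basis.algebra

text \<open>
  The weighted identity on the diagonal, multiplied by $a\,\Delta_i(X)$. The factor
  $bcd - ha$ is $a$ times $\beta_i$.
\<close>
lemma diag4: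
  "a * (a + t*a^2) * (alpha4_val h a b c d)^2 / root_diff4 a b c d
   + (b + t*b^2) * beta4_val h b a c d * ((b*c*d - h*a) * (a*c+b*d-h) * (a*d+b*c-h)) / root_diff4 b a c d
   + (c + t*c^2) * beta4_val h c a b d * ((b*c*d - h*a) * (a*b+c*d-h) * (a*d+b*c-h)) / root_diff4 c a b d
   + (d + t*d^2) * beta4_val h d a b c * ((b*c*d - h*a) * (a*b+c*d-h) * (a*c+b*d-h)) / root_diff4 d a b c
   = a^3 * alpha4_val h a b c d + t * h * b*c*d * root_diff4 a b c d"
  unfolding clear_denominators4 beta4_val_eq
  unfolding V_def alpha4_val_def root_diff4_def using h by Groebner_Basis.algebra
end

definition g4 :: "complex \<Rightarrow> (nat \<Rightarrow> complex) \<Rightarrow> nat \<Rightarrow> nat \<Rightarrow> complex" where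
  "g4 h x i j = rho4_g2 h x $$ (i - 1, j - 1)"

lemma rho4_g2_eq_mat: "rho4_g2 h x = mat 4 4 (\<lambda>(i, j). g4 h x (Suc i) (Suc j))"
  by (rule eq_matI) (simp_all add: g4_def rho4_g2_def mat_of_rows_list_def Let_def)

lemma g4_diag:
  assumes "i \<in> {1, 2, 3, 4}"
  shows "g4 h x i i = alpha4 h x i / Delta i x {1..4}"
  using assms by (auto simp: g4_def rho4_g2_def mat_of_rows_list_def Let_def)

lemma g4_off_diag:
  assumes "enum4 i j k l"
  shows "g4 h x i j = beta4 h x i * kappa (gamma4 h x) i j / Delta i x {1..4}"
  using enum4_cases[OF assms]
  by (elim insertE emptyE)
    (simp_all add: g4_def rho4_g2_def mat_of_rows_list_def Let_def kappa_def insert_Diff_if mult.assoc)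

lemma data4:
  assumes "enum4 i j k l" "x i \<noteq> 0"
  shows "alpha4 h x i = alpha4_val h (x i) (x j) (x k) (x l)"
    and "beta4 h x i = beta4_val h (x i) (x j) (x k) (x l)"
    and "Delta i x {1..4} = root_diff4 (x i) (x j) (x k) (x l)"
    and "esym 4 x {1..4} = x i * x j * x k * x l"
proof -
  note D = Diff_enum4[OF assms(1)]
  have d: "distinct [i, j, k, l]" using assms(1) by (simp only: enum4_def)
  show "alpha4 h x i = alpha4_val h (x i) (x j) (x k) (x l)"
    unfolding alpha4_def D(3) alpha4_val_def using d by (simp add: algebra_simps)
  show e: "esym 4 x {1..4} = x i * x j * x k * x l"
    unfolding D(5) using d by (simp add: mult_ac)
  show "beta4 h x i = beta4_val h (x i) (x j) (x k) (x l)"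
    unfolding beta4_def e beta4_val_def using assms(2) by (simp add: power2_eq_square)
  show "Delta i x {1..4} = root_diff4 (x i) (x j) (x k) (x l)"
    unfolding Delta_def D(3) root_diff4_def using d by (simp add: mult.assoc)
qed

context
  fixes x :: "nat \<Rightarrow> complex" and h t :: complex
  assumes inj: "inj_on x {1..4}" and nz: "\<forall>i\<in>{1..4}. x i \<noteq> 0" and h: "h^2 = esym 4 x {1..4}"
begin

lemma distinct_values4:
  assumes "enum4 i j k l"
  shows "distinct [x i, x j, x k, x l]" "x i \<noteq> 0" "x j \<noteq> 0" "x k \<noteq> 0" "x l \<noteq> 0"
proof -
  have "distinct [i, j, k, l]" using assms by (simp only: enum4_def)
  moreover have *: "{i, j, k, l} = {1..4}" by (rule Diff_enum4(5)[OF assms, symmetric])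
  ultimately show "distinct [x i, x j, x k, x l]"
    using inj distinct_map[of x "[i, j, k, l]"] by simp
  show "x i \<noteq> 0" "x j \<noteq> 0" "x k \<noteq> 0" "x l \<noteq> 0"
    by (rule nz[rule_format], unfold *[symmetric], simp)+
qed

lemma g4_weighted_sum:
  assumes ijkl: "enum4 i j k l"
  shows "(\<Sum>m\<in>{1, 2, 3, 4}. g4 h x i m * (x m + t * (x m)\<^sup>2) * g4 h x m j) = x i * x j * g4 h x i j"
    and "(\<Sum>m\<in>{1, 2, 3, 4}. g4 h x i m * (x m + t * (x m)\<^sup>2) * g4 h x m i)
      = x i * x i * g4 h x i i + t * (h^3 / (x i)\<^sup>2)"
proof -
  have perms: "enum4 j i k l" "enum4 k i j l" "enum4 l i j k" "enum4 i k j l" "enum4 i l j k" "enum4 k j i l" "enum4 l j i k"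
    using ijkl by (auto simp: enum4_def)
  have I: "i \<in> {1, 2, 3, 4}" "j \<in> {1, 2, 3, 4}" using ijkl by (auto simp: enum4_def)
  have sum: "(\<Sum>m\<in>{1, 2, 3, 4}. h m) = h i + h j + h k + h l" for h :: "nat \<Rightarrow> complex"
  proof -
    have "{1, 2, 3, 4} = {i, j, k, l}" "distinct [i, j, k, l]" using ijkl by (simp_all only: enum4_def)
    then show ?thesis by (simp add: add.assoc)
  qed
  note dist = distinct_values4[OF ijkl]
  note data = data4(1-3)[where x = x, OF ijkl dist(2)] data4(1-3)[where x = x, OF perms(1) dist(3)]
    data4(1-3)[where x = x, OF perms(2) dist(4)] data4(1-3)[where x = x, OF perms(3) dist(5)]
  have h': "h^2 = x i * x j * x k * x l" using h data4(4)[where x = x, OF ijkl dist(2)] by simp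
  have chain: "kappa (gamma4 h x) i k * kappa (gamma4 h x) k j = kappa (gamma4 h x) i j * (x i * x j + x k * x l - h)"
    "kappa (gamma4 h x) i l * kappa (gamma4 h x) l j = kappa (gamma4 h x) i j * (x i * x j + x k * x l - h)"
    using kappa_chain[OF ijkl, of "gamma4 h x"] kappa_chain[of i j l k "gamma4 h x"] gamma4_pairing[OF ijkl, of h x] ijkl
    by (auto simp: enum4_def insert_commute)
  have cycle: "kappa (gamma4 h x) i j * kappa (gamma4 h x) j i = (x i * x k + x j * x l - h) * (x i * x l + x j * x k - h)"
    "kappa (gamma4 h x) i k * kappa (gamma4 h x) k i = (x i * x j + x k * x l - h) * (x i * x l + x j * x k - h)"
    "kappa (gamma4 h x) i l * kappa (gamma4 h x) l i = (x i * x j + x k * x l - h) * (x i * x k + x j * x l - h)"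
    unfolding kappa_cycle[OF ijkl] kappa_cycle[OF perms(4)] kappa_cycle[OF perms(5)]
      gamma4_pairing[OF ijkl] gamma4_pairing[OF perms(4)] gamma4_pairing[OF perms(5)]
    by (simp_all only: mult.commute)
  let ?\<phi> = "\<lambda>y. y + t * y\<^sup>2"
  \<comment> \<open>The entry at $(i, j)$ is taken out of the sum. The off-diagonal terms need \<open>kappa_chain\<close> for this.\<close>
  have off: "na / Da * wa * (ba * \<kappa> / Da) + ba * \<kappa> / Da * wb * (nb / Db)
      + ba * \<kappa>ac / Da * wc * (bc * \<kappa>cb / Dc) + ba * \<kappa>ad / Da * wd * (bd * \<kappa>db / Dd)
      = ba * \<kappa> / Da * (wa * na / Da + wb * nb / Db + wc * bc * Q / Dc + wd * bd * Q / Dd)"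
    if "\<kappa>ac * \<kappa>cb = \<kappa> * Q" "\<kappa>ad * \<kappa>db = \<kappa> * Q"
    for na nb wa wb wc wd ba bc bd Da Db Dc Dd \<kappa> \<kappa>ac \<kappa>cb \<kappa>ad \<kappa>db Q :: complex
  proof -
    have k: "ba * \<kappa>ac / Da * wc * (bc * \<kappa>cb / Dc) = (\<kappa>ac * \<kappa>cb) * (ba / Da * wc * bc / Dc)"
      "ba * \<kappa>ad / Da * wd * (bd * \<kappa>db / Dd) = (\<kappa>ad * \<kappa>db) * (ba / Da * wd * bd / Dd)"
      by (simp_all add: mult_ac)
    show ?thesis unfolding k that by (simp add: distrib_left mult_ac)
  qed
  have "g4 h x i i * ?\<phi> (x i) * g4 h x i j + g4 h x i j * ?\<phi> (x j) * g4 h x j j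
      + g4 h x i k * ?\<phi> (x k) * g4 h x k j + g4 h x i l * ?\<phi> (x l) * g4 h x l j = x i * x j * g4 h x i j"
    unfolding g4_diag[OF I(1)] g4_diag[OF I(2)] g4_off_diag[OF ijkl] g4_off_diag[OF perms(4)]
      g4_off_diag[OF perms(5)] g4_off_diag[OF perms(6)] g4_off_diag[OF perms(7)] data off[OF chain]
      pair4[OF dist h']
    by (simp add: mult_ac)
  then show "(\<Sum>m\<in>{1, 2, 3, 4}. g4 h x i m * (x m + t * (x m)\<^sup>2) * g4 h x m j) = x i * x j * g4 h x i j"
    unfolding sum .
  have D: "root_diff4 (x i) (x j) (x k) (x l) \<noteq> 0" using dist(1) by (auto simp: root_diff4_def)
  have diag: "na / Da * wa * (na / Da) + ba * \<kappa>ab / Da * wb * (bb * \<kappa>ba / Db)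
      + ba * \<kappa>ac / Da * wc * (bc * \<kappa>ca / Dc) + ba * \<kappa>ad / Da * wd * (bd * \<kappa>da / Dd)
      = 1 / (a * Da) * (a * wa * na^2 / Da + wb * bb * (a * ba * q1 * q1') / Db
         + wc * bc * (a * ba * q2 * q2') / Dc + wd * bd * (a * ba * q3 * q3') / Dd)"
    if "\<kappa>ab * \<kappa>ba = q1 * q1'" "\<kappa>ac * \<kappa>ca = q2 * q2'" "\<kappa>ad * \<kappa>da = q3 * q3'" "a \<noteq> 0"
    for a na wa wb wc wd ba bb bc bd Da Db Dc Dd \<kappa>ab \<kappa>ba \<kappa>ac \<kappa>ca \<kappa>ad \<kappa>da q1 q2 q3 q1' q2' q3' :: complex
  proof -
    have k: "ba * \<kappa>ab / Da * wb * (bb * \<kappa>ba / Db) = (\<kappa>ab * \<kappa>ba) * (ba / Da * wb * bb / Db)"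
      "ba * \<kappa>ac / Da * wc * (bc * \<kappa>ca / Dc) = (\<kappa>ac * \<kappa>ca) * (ba / Da * wc * bc / Dc)"
      "ba * \<kappa>ad / Da * wd * (bd * \<kappa>da / Dd) = (\<kappa>ad * \<kappa>da) * (ba / Da * wd * bd / Dd)"
      by (simp_all add: mult_ac)
    show ?thesis unfolding k that using \<open>a \<noteq> 0\<close> by (simp add: distrib_left mult_ac power2_eq_square)
  qed
  \<comment> \<open>$h^3/a^2 = hbcd/a$ because $h^2 = abcd$.\<close>
  have r: "1 / (a * Da) * (a^3 * na + t * h * b * c * d * Da) = a * a * (na / Da) + t * (h^3 / a^2)"
    if "a \<noteq> 0" "Da \<noteq> 0" "h^2 = a * b * c * d" for a b c d na Da :: complex
  proof -
    have "h^3 / a^2 = h * b * c * d / a"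
      using that by (simp add: power3_eq_cube power2_eq_square field_simps)
    then show ?thesis using that by (simp add: power3_eq_cube distrib_left mult_ac)
  qed
  have "g4 h x i i * ?\<phi> (x i) * g4 h x i i + g4 h x i j * ?\<phi> (x j) * g4 h x j i
      + g4 h x i k * ?\<phi> (x k) * g4 h x k i + g4 h x i l * ?\<phi> (x l) * g4 h x l i
      = x i * x i * g4 h x i i + t * (h^3 / (x i)\<^sup>2)"
    unfolding g4_diag[OF I(1)] g4_off_diag[OF ijkl] g4_off_diag[OF perms(1)] g4_off_diag[OF perms(2)]
      g4_off_diag[OF perms(3)] g4_off_diag[OF perms(4)] g4_off_diag[OF perms(5)] data diag[OF cycle dist(2)]
      beta4_val_eq(4)[OF dist h'] diag4[OF dist h'] r[OF dist(2) D h'] ..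
  then show "(\<Sum>m\<in>{1, 2, 3, 4}. g4 h x i m * (x m + t * (x m)\<^sup>2) * g4 h x m i)
      = x i * x i * g4 h x i i + t * (h^3 / (x i)\<^sup>2)"
    unfolding sum .
qed

end

theorem rho4_braid_matrix_pair:
  assumes inj: "inj_on x {1..4}" and nz: "\<forall>i\<in>{1..4}. x i \<noteq> 0" and h: "h^2 = esym 4 x {1..4}"
  shows "braid_matrix_pair 4 (rho4_g1 x) (rho4_g2 h x) (h ^ 3)"
  unfolding rho4_g1_def rho4_g2_eq_mat
proof (rule braid_matrix_pair_diagonalI)
  have std: "enum4 1 2 3 4" by (simp add: enum4_def)
  note dist = distinct_values4[OF inj nz h std]
  show "length [x 1, x 2, x 3, x 4] = 4" by simp
  show "0 \<notin> set [x 1, x 2, x 3, x 4]" using dist by simp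
  show "h ^ 3 \<noteq> 0" using h dist data4(4)[where x = x, OF std dist(2)] by auto
  fix t :: complex and i j :: nat
  assume ij: "i < 4" "j < 4"
  let ?as = "[x 1, x 2, x 3, x 4]"
  have I: "Suc i \<in> {1, 2, 3, 4}" "Suc j \<in> {1, 2, 3, 4}" using ij by auto
  have as: "?as ! k = x (Suc k)" if "k < 4" for k using that by (auto simp: less_Suc_eq numeral_eq_Suc)
  have "(\<Sum>k<4. g4 h x (Suc i) (Suc k) * (?as ! k + t * (?as ! k)\<^sup>2) * g4 h x (Suc k) (Suc j))
    = (\<Sum>m\<in>{1, 2, 3, 4}. g4 h x (Suc i) m * (x m + t * (x m)\<^sup>2) * g4 h x m (Suc j))"
    by (simp add: eval_nat_numeral lessThan_Suc add_ac)
  also have "\<dots> = x (Suc i) * x (Suc j) * g4 h x (Suc i) (Suc j)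
      + t * (if i = j then h ^ 3 / (x (Suc i))\<^sup>2 else 0)"
  proof (cases "i = j")
    case True
    obtain j' where "j' \<in> {1, 2, 3, 4}" "Suc i \<noteq> j'" by (metis insertI1 insertI2 n_not_Suc_n numeral_2_eq_2 One_nat_def)
    then obtain k l where "enum4 (Suc i) j' k l" using enum4_exists[OF I(1)] by blast
    then show ?thesis using g4_weighted_sum(2)[OF inj nz h] True by simp
  next
    case False
    then obtain k l where "enum4 (Suc i) (Suc j) k l" using enum4_exists[OF I] by auto
    then show ?thesis using g4_weighted_sum(1)[OF inj nz h] False by simp
  qed
  finally show "(\<Sum>k<4. g4 h x (Suc i) (Suc k) * (?as ! k + t * (?as ! k)\<^sup>2) * g4 h x (Suc k) (Suc j))
    = ?as ! i * ?as ! j * g4 h x (Suc i) (Suc j) + t * (if i = j then h ^ 3 / (?as ! i)\<^sup>2 else 0)"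
    by (simp only: as[OF ij(1)] as[OF ij(2)])
qed

section \<open>Dimension five\<close>

text \<open>
  A model of the five-dimensional representation in terms of $e_1, \dots, e_4$, for $e_5 = 1$ and
  $f = 1$: the companion matrix of $P_X$, the image of the second generator in the same basis, and
  the product $ABA$, which is constant.
\<close>
definition companion5 :: "complex \<Rightarrow> complex \<Rightarrow> complex \<Rightarrow> complex \<Rightarrow> complex mat" where
  "companion5 e1 e2 e3 e4 = mat_of_rows_list 5
     [[0, 0, 0, 0, 1], [1, 0, 0, 0, - e4], [0, 1, 0, 0, e3], [0, 0, 1, 0, - e2], [0, 0, 0, 1, e1]]"

definition companion_partner5 :: "complex \<Rightarrow> complex \<Rightarrow> complex \<Rightarrow> complex \<Rightarrow> complex mat" where
  "companion_partner5 e1 e2 e3 e4 = mat_of_rows_list 5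
     [[1 + e1, - 1, 0, 0, - 1], [e1 + e2, 0, - 1, 1, - 1], [e2 + e3 + e4 - 1, 1, - 1, 0, 0],
      [e4 - e1, 1, 0, 0, 0], [1, 0, 0, 0, 0]]"

definition half_twist5 :: "complex mat" where
  "half_twist5 = mat_of_rows_list 5
     [[0, 0, 0, 0, 1], [- 1, 0, 0, - 1, 1], [0, - 1, 1, - 1, 0], [1, - 1, 0, 0, - 1], [1, 0, 0, 0, 0]]"

lemma less_5: "(i::nat) < 5 \<longleftrightarrow> i = 0 \<or> i = 1 \<or> i = 2 \<or> i = 3 \<or> i = 4"
  by auto

lemma mat5_mult:
  "mat 5 5 f * mat 5 5 g = mat 5 5 (\<lambda>(i, j). f (i, 0) * g (0, j) + f (i, 1) * g (1, j)
     + f (i, 2) * g (2, j) + f (i, 3) * g (3, j) + f (i, 4) * g (4, j) :: complex)"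
  by (rule eq_matI) (simp_all add: scalar_prod_def eval_nat_numeral)

lemma mat_of_five_rows:
  "mat_of_rows_list 5 [r0, r1, r2, r3, r4] = mat 5 5 (\<lambda>(i, j). [r0, r1, r2, r3, r4] ! i ! j)"
  by (simp add: mat_of_rows_list_def numeral_eq_Suc)

text \<open>
  With $C = AB$ the equations $CA = T$ and $BC = T$ are the braid relation, and $T^2 = 1$.
\<close>
lemma companion_braid_matrix_pair: "braid_matrix_pair 5 (companion5 e1 e2 e3 e4) (companion_partner5 e1 e2 e3 e4) 1"
proof -
  define C where "C = mat_of_rows_list 5
     [[1, 0, 0, 0, 0], [1 + e1 - e4, - 1, 0, 0, - 1], [e1 + e2 + e3, 0, - 1, 1, - 1],
      [e3 + e4 - 1, 1, - 1, 0, 0], [e4, 1, 0, 0, 0]]"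
  note mats = companion5_def companion_partner5_def C_def half_twist5_def mat_of_five_rows
  have "companion5 e1 e2 e3 e4 * companion_partner5 e1 e2 e3 e4 = C"
    by (rule eq_matI) (auto simp: mats mat5_mult less_5)
  moreover have "C * companion5 e1 e2 e3 e4 = half_twist5"
    by (rule eq_matI) (auto simp: mats mat5_mult less_5)
  moreover have "companion_partner5 e1 e2 e3 e4 * C = half_twist5"
    by (rule eq_matI) (auto simp: mats mat5_mult less_5 algebra_simps)
  moreover have "half_twist5 * half_twist5 = 1\<^sub>m 5"
    by (rule eq_matI) (auto simp: mats mat5_mult less_5)
  moreover have "companion5 e1 e2 e3 e4 \<in> carrier_mat 5 5" "companion_partner5 e1 e2 e3 e4 \<in> carrier_mat 5 5"
    by (simp_all add: mats)
  ultimately show ?thesis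
    by unfold_locales (auto simp: assoc_mult_mat[of _ 5 5 _ 5 _ 5])
qed

lemma esym_scale: "esym k (\<lambda>i. c * x i) I = c ^ k * esym k x I"
proof (cases "finite I")
  case True
  show ?thesis
    unfolding esym_def sum_distrib_left
    by (rule sum.cong[OF HOL.refl]) (simp add: prod.distrib)
next
  case False
  show ?thesis
    unfolding esym_def sum_distrib_left
    by (rule sum.cong[OF HOL.refl]) (simp add: prod.distrib)
qed

lemma Delta_scale: "Delta i (\<lambda>i. c * x i) I = c ^ card (I - {i}) * Delta i x I"
  by (simp add: Delta_def prod.distrib flip: right_diff_distrib)

text \<open>
  The entries are homogeneous of degree 1 in $f$ and the $x_i$. This allows the reduction to
  $f = 1$, where $e_5(X) = 1$.
\<close>
lemma m5_scale:
  assumes "f \<noteq> 0" "i \<in> {1..5}" "j \<in> {1..5}"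
  shows "m5 f (\<lambda>i. f * y i) i j = f * m5 1 y i j"
proof (cases "i = j")
  case True
  have card: "card ({1..5} - {i}) = 4" using assms(2) by simp
  have "(\<Prod>k\<in>{1..5} - {i}. f + f * y k) = (\<Prod>k\<in>{1..5} - {i}. f * (1 + y k))"
    by (simp add: distrib_left)
  also have "\<dots> = f ^ 4 * (\<Prod>k\<in>{1..5} - {i}. 1 + y k)"
    by (simp only: prod.distrib prod_constant card)
  finally have P: "(\<Prod>k\<in>{1..5} - {i}. f + f * y k) = f ^ 4 * (\<Prod>k\<in>{1..5} - {i}. 1 + y k)" .
  have "f ^ 4 * E4 * (f ^ 1 * E1) + f * (f * z) * (f ^ 3 * E3) + f * (f ^ 4 * Q)
    = f ^ 4 * (f * (E4 * E1 + 1 * z * E3 + 1 * Q))" for E1 E3 E4 z Q by Groebner_Basis.algebra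
  then show ?thesis
    using assms(1) by (simp only: True m5_def if_True esym_scale Delta_scale P[unfolded True] card[unfolded True]) simp
next
  case False
  have card: "card ({1..5} - {i}) = 4" "card ({1..5} - {i, j}) = 3"
    using assms(2,3) False by (simp_all add: card_Diff_subset)
  have "(\<Prod>k\<in>{1..5} - {i, j}. f\<^sup>2 + f * y i * (f * y k)) = (\<Prod>k\<in>{1..5} - {i, j}. f\<^sup>2 * (1 + y i * y k))"
    by (simp add: power2_eq_square algebra_simps)
  also have "\<dots> = (f\<^sup>2) ^ 3 * (\<Prod>k\<in>{1..5} - {i, j}. 1 + y i * y k)"
    by (simp only: prod.distrib prod_constant card)
  finally have P: "(\<Prod>k\<in>{1..5} - {i, j}. f\<^sup>2 + f * y i * (f * y k))
    = (f\<^sup>2) ^ 3 * (\<Prod>k\<in>{1..5} - {i, j}. 1 + y i * y k)" .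
  have "((f * z)\<^sup>2 + f * (f * z) + f\<^sup>2) * ((f\<^sup>2) ^ 3 * Q) = f ^ 7 * (f * ((z\<^sup>2 + z + 1) * Q))"
    and "f * (f * z) * (f * w) * (f ^ 4 * D) = f ^ 7 * (z * w * D)" for z w Q D by Groebner_Basis.algebra+
  then show ?thesis
    using assms(1) False by (simp only: m5_def if_False Delta_scale P card) simp
qed

text \<open>
  The left hand side is $\Delta_i(X)$ times the entry at $(i, j)$ of the second matrix of the
  companion model, transformed back to the eigenbasis of $A$. The right hand side is
  $\Delta_i(X)\, m_{ij}$. Here \<open>a\<close> is $x_i$, \<open>b\<close> is $x_j$, and \<open>s1\<close>, \<open>s2\<close>, \<open>s3\<close>
  are the elementary symmetric polynomials of the three other values. The hypothesis says
  $e_5(X) = 1$.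
\<close>
lemma off_diag5:
  fixes a b s1 s2 s3 :: complex
  assumes "a * b * s3 = 1"
  defines "e1 \<equiv> a + b + s1" and "e2 \<equiv> a*b + (a+b)*s1 + s2" and "e3 \<equiv> a*b*s1 + (a+b)*s2 + s3"
    and "e4 \<equiv> a*b*s2 + (a+b)*s3"
  shows "(1 + e1 + a * (e1 + e2) + a^2 * (e2 + e3 + e4 - 1) + a^3 * (e4 - e1) + a^4) * (a * s3)
    - (- 1 + a^2 + a^3) * (s3 + a * s2) + (- a - a^2) * (s2 + a * s1) - a * (s1 + a) + (- 1 - a)
    = s3 * ((a^2 + a + 1) * (1 + a * s1 + a^2 * s2 + a^3 * s3))"
proof -
  have nz: "a \<noteq> 0" "b \<noteq> 0" using assms(1) by auto
  then have s3: "s3 = 1 / (a * b)" using assms(1) by (simp add: eq_divide_eq mult_ac)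
  show ?thesis
    unfolding e1_def e2_def e3_def e4_def s3 by (simp add: divide_simps nz) Groebner_Basis.algebra
qed

text \<open>
  The same for a position on the diagonal, where \<open>s1\<close> to \<open>s4\<close> are the elementary
  symmetric polynomials of the four other values.
\<close>
lemma diag5:
  fixes a s1 s2 s3 s4 :: complex
  assumes "a * s4 = 1"
  defines "e1 \<equiv> a + s1" and "e2 \<equiv> a*s1 + s2" and "e3 \<equiv> a*s2 + s3" and "e4 \<equiv> a*s3 + s4"
  shows "(1 + e1 + a * (e1 + e2) + a^2 * (e2 + e3 + e4 - 1) + a^3 * (e4 - e1) + a^4) * s4
    - (- 1 + a^2 + a^3) * s3 + (- a - a^2) * s2 - a * s1 + (- 1 - a)
    = s4 * s1 + a * s3 + (1 + s1 + s2 + s3 + s4)"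
proof -
  have nz: "a \<noteq> 0" using assms(1) by auto
  then have s4: "s4 = 1 / a" using assms(1) by (simp add: eq_divide_eq mult_ac)
  show ?thesis
    unfolding e1_def e2_def e3_def e4_def s4 by (simp add: divide_simps nz) Groebner_Basis.algebra
qed

lemma prod_four_minus:
  assumes "card I = 4"
  shows "(\<Prod>k\<in>I. x k - z) = esym 4 x I - z * esym 3 x I + z^2 * esym 2 x I - z^3 * esym 1 x I + z^4"
    and "(\<Prod>k\<in>I. 1 + x k) = 1 + esym 1 x I + esym 2 x I + esym 3 x I + esym 4 x I"
proof -
  obtain a b c d where I: "I = {a, b, c, d}" and "distinct [a, b, c, d]"
    using assms by (auto simp: card_Suc_eq eval_nat_numeral)
  then show "(\<Prod>k\<in>I. x k - z) = esym 4 x I - z * esym 3 x I + z^2 * esym 2 x I - z^3 * esym 1 x I + z^4"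
    by (simp add: algebra_simps eval_nat_numeral)
  show "(\<Prod>k\<in>I. 1 + x k) = 1 + esym 1 x I + esym 2 x I + esym 3 x I + esym 4 x I"
    unfolding I using \<open>distinct [a, b, c, d]\<close> by (simp add: algebra_simps)
qed

lemma prod_three_one_plus:
  assumes "card I = 3"
  shows "(\<Prod>k\<in>I. 1 + z * x k) = 1 + z * esym 1 x I + z^2 * esym 2 x I + z^3 * esym 3 x I"
proof -
  obtain a b c where I: "I = {a, b, c}" and d: "distinct [a, b, c]"
    using assms by (auto simp: card_Suc_eq eval_nat_numeral)
  show "(\<Prod>k\<in>I. 1 + z * x k) = 1 + z * esym 1 x I + z^2 * esym 2 x I + z^3 * esym 3 x I"
    unfolding I using d by (simp add: algebra_simps eval_nat_numeral)
qed

context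
  fixes y :: "nat \<Rightarrow> complex"
  assumes inj: "inj_on y {1..5}" and e5: "esym 5 y {1..5} = 1"
begin

private abbreviation (input) "e k \<equiv> esym k y {1..5}"
private abbreviation (input) "X i \<equiv> {1..5} - {i::nat}"

private lemma esym_remove:
  assumes "i \<in> {1..5}"
  shows "e 1 = y i + esym 1 y (X i)" "e 2 = y i * esym 1 y (X i) + esym 2 y (X i)"
    "e 3 = y i * esym 2 y (X i) + esym 3 y (X i)" "e 4 = y i * esym 3 y (X i) + esym 4 y (X i)"
    "y i * esym 4 y (X i) = 1"
proof -
  have rec: "e (Suc k) = esym (Suc k) y (X i) + y i * esym k y (X i)" for k
    using esym_insert[of "X i" i k y] insert_Diff[OF assms] by (simp del: esym_simps)
  have "esym 5 y (X i) = 0" using assms by (intro esym_card_less) simp_all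
  then show "y i * esym 4 y (X i) = 1"
    using e5 rec[of 4] by (simp del: esym_simps)
  show "e 1 = y i + esym 1 y (X i)" "e 2 = y i * esym 1 y (X i) + esym 2 y (X i)"
    "e 3 = y i * esym 2 y (X i) + esym 3 y (X i)" "e 4 = y i * esym 3 y (X i) + esym 4 y (X i)"
    using rec[of 0] rec[of 1] rec[of 2] rec[of 3]
    by (simp_all add: numeral_2_eq_2[symmetric] del: esym_simps)
qed

private lemma esym_remove2:
  assumes "i \<in> {1..5}" "j \<in> {1..5}" "i \<noteq> j"
  defines "I \<equiv> {1..5} - {i, j}"
  shows "esym 1 y (X j) = esym 1 y I + y i" "esym 2 y (X j) = esym 2 y I + y i * esym 1 y I"
    "esym 3 y (X j) = esym 3 y I + y i * esym 2 y I" "esym 4 y (X j) = y i * esym 3 y I"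
proof -
  have ins: "X j = insert i I" "i \<notin> I" "finite I" using assms by auto
  have "card I = 3" using assms by (simp add: card_Diff_subset)
  then show "esym 1 y (X j) = esym 1 y I + y i" "esym 2 y (X j) = esym 2 y I + y i * esym 1 y I"
    "esym 3 y (X j) = esym 3 y I + y i * esym 2 y I" "esym 4 y (X j) = y i * esym 3 y I"
    unfolding ins(1) using ins(2,3) by (simp_all add: esym_card_less)
qed

text \<open>
  The rows of \<open>vander\<close> are left eigenvectors of the companion matrix. The columns of
  \<open>vander_inv\<close> hold the coefficients of the polynomials $\prod_{k \neq j}(y_k - z)$ in $z$,
  whose values at the $y_i$ are 0 for $i \neq j$ and $\Delta_j$ for $i = j$. This is Lagrange
  interpolation.
\<close>
private definition "vander = mat 5 5 (\<lambda>(i, l). y (Suc i) ^ l / Delta (Suc i) y {1..5})"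
private definition "vander_inv = mat 5 5 (\<lambda>(l, j). (- 1) ^ l * esym (4 - l) y (X (Suc j)))"

private lemma Delta_nz: "i \<in> {1..5} \<Longrightarrow> Delta i y {1..5} \<noteq> 0"
  using inj by (auto simp: Delta_def inj_on_def)

private lemma vander_inverse: "vander * vander_inv = 1\<^sub>m 5"
proof (rule eq_matI)
  fix i j assume "i < dim_row (1\<^sub>m 5 :: complex mat)" "j < dim_col (1\<^sub>m 5 :: complex mat)"
  then have ij: "i < 5" "j < 5" by simp_all
  then have "(vander * vander_inv) $$ (i, j) = (\<Prod>k\<in>X (Suc j). y k - y (Suc i)) / Delta (Suc i) y {1..5}"
    by (simp add: vander_def vander_inv_def mat5_mult prod_four_minus(1) add_divide_distrib diff_divide_distrib)
  also have "\<dots> = (if i = j then 1 else 0)"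
    using ij Delta_nz[of "Suc i"] by (auto simp: Delta_def)
  finally show "(vander * vander_inv) $$ (i, j) = 1\<^sub>m 5 $$ (i, j)" using ij by simp
qed (simp_all add: vander_def vander_inv_def)

text \<open>
  The companion matrix shifts the powers of $y_i$. Its last column uses that $y_i$ is a root of the
  polynomial.
\<close>
private lemma A_conj: "mk_diagonal [y 1, y 2, y 3, y 4, y 5] = vander * companion5 (e 1) (e 2) (e 3) (e 4) * vander_inv"
proof -
  let ?D = "mk_diagonal [y 1, y 2, y 3, y 4, y 5]"
  have D: "?D = mat 5 5 (\<lambda>(i, j). if i = j then y (Suc i) else 0)"
    by (rule eq_matI) (auto simp: mk_diagonal_eq_mat less_Suc_eq numeral_eq_Suc)
  have root: "y i ^ 5 = 1 - e 4 * y i + e 3 * y i ^ 2 - e 2 * y i ^ 3 + e 1 * y i ^ 4" if "i \<in> {1..5}" for i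
    unfolding esym_remove(1-4)[OF that] using esym_remove(5)[OF that] by Groebner_Basis.algebra
  have "vander * companion5 (e 1) (e 2) (e 3) (e 4) = ?D * vander"
  proof (rule eq_matI)
    fix i j assume "i < dim_row (?D * vander)" "j < dim_col (?D * vander)"
    then have ij: "i < 5" "j < 5" by (simp_all add: mk_diagonal_dim vander_def)
    have "(?D * vander) $$ (i, j) = y (Suc i) ^ Suc j / Delta (Suc i) y {1..5}"
      using ij unfolding D by (simp add: vander_def scalar_prod_def if_distrib[of "\<lambda>w. w * _"]
          if_distrib[of "\<lambda>w. w / _"] cong: if_cong)
    moreover have "(vander * companion5 (e 1) (e 2) (e 3) (e 4)) $$ (i, j) = y (Suc i) ^ Suc j / Delta (Suc i) y {1..5}"
    proof (cases "j = 4")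
      case True
      have "y (Suc i) ^ Suc j = 1 - e 4 * y (Suc i) + e 3 * y (Suc i) ^ 2 - e 2 * y (Suc i) ^ 3 + e 1 * y (Suc i) ^ 4"
        using root[of "Suc i"] ij True by (simp add: eval_nat_numeral)
      then show ?thesis
        using ij True by (simp add: vander_def companion5_def mat_of_five_rows mat5_mult add_divide_distrib diff_divide_distrib mult.commute)
    next
      case False
      then have "j = 0 \<or> j = 1 \<or> j = 2 \<or> j = 3" using ij by auto
      then show ?thesis
        using ij by (elim disjE) (simp_all add: vander_def companion5_def mat_of_five_rows mat5_mult numeral_2_eq_2[symmetric] del: power_Suc)
    qed
    ultimately show "(vander * companion5 (e 1) (e 2) (e 3) (e 4)) $$ (i, j) = (?D * vander) $$ (i, j)" by simp
  qed (simp_all add: mk_diagonal_dim vander_def companion5_def mat_of_five_rows)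
  moreover have "?D * vander * vander_inv = ?D"
  proof -
    have carrier: "?D \<in> carrier_mat 5 5" "vander \<in> carrier_mat 5 5" "vander_inv \<in> carrier_mat 5 5"
      unfolding D vander_def vander_inv_def by simp_all
    show ?thesis unfolding assoc_mult_mat[OF carrier] vander_inverse by (rule right_mult_one_mat[OF carrier(1)])
  qed
  ultimately show ?thesis by simp
qed

private lemma B_conj: "mat 5 5 (\<lambda>(i, j). m5 1 y (Suc i) (Suc j)) = vander * companion_partner5 (e 1) (e 2) (e 3) (e 4) * vander_inv"
proof (rule eq_matI)
  fix i j assume "i < dim_row (vander * companion_partner5 (e 1) (e 2) (e 3) (e 4) * vander_inv)" "j < dim_col (vander * companion_partner5 (e 1) (e 2) (e 3) (e 4) * vander_inv)"
  then have ij: "i < 5" "j < 5" by (simp_all add: vander_def vander_inv_def)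
  \<comment> \<open>Row $i$ of the product of the first two factors, times $\Delta_i$, as a function of $z = y_i$.\<close>
  define c where "c = (\<lambda>z. [1 + e 1 + z * (e 1 + e 2) + z^2 * (e 2 + e 3 + e 4 - 1) + z^3 * (e 4 - e 1) + z^4,
    - 1 + z^2 + z^3, - z - z^2, z, - 1 - z])"
  have VB: "vander * companion_partner5 (e 1) (e 2) (e 3) (e 4) = mat 5 5 (\<lambda>(i, l). c (y (Suc i)) ! l / Delta (Suc i) y {1..5})"
    by (rule eq_matI)
      (auto simp: vander_def companion_partner5_def mat_of_five_rows mat5_mult less_5 c_def add_divide_distrib diff_divide_distrib)
  define z where "z = y (Suc i)"
  define D where "D = Delta (Suc i) y {1..5}"
  let ?s = "\<lambda>k. esym k y (X (Suc j))"
  have "(vander * companion_partner5 (e 1) (e 2) (e 3) (e 4) * vander_inv) $$ (i, j)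
      = (c z ! 0 * ?s 4 - c z ! 1 * ?s 3 + c z ! 2 * ?s 2 - c z ! 3 * ?s 1 + c z ! 4) / D"
    unfolding VB vander_inv_def mat5_mult using ij
    by (simp add: z_def D_def add_divide_distrib diff_divide_distrib)
  also have "\<dots> = m5 1 y (Suc i) (Suc j)"
  proof (cases "i = j")
    case True
    have i: "Suc i \<in> {1..5}" using ij by simp
    have P: "(\<Prod>k\<in>X (Suc i). 1 + y k) = 1 + esym 1 y (X (Suc i)) + esym 2 y (X (Suc i))
        + esym 3 y (X (Suc i)) + esym 4 y (X (Suc i))"
      using i by (intro prod_four_minus(2)) simp
    show ?thesis
      using diag5[OF esym_remove(5)[OF i], of "?s 1" "?s 2" "?s 3"]
      by (simp add: True[symmetric] m5_def c_def esym_remove(1-4)[OF i] P z_def D_def del: One_nat_def)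
  next
    case False
    have i: "Suc i \<in> {1..5}" "Suc j \<in> {1..5}" "Suc i \<noteq> Suc j" using ij False by simp_all
    define I where "I = {1..5} - {Suc i, Suc j}"
    have "card I = 3" using i by (simp add: I_def card_Diff_subset)
    note remove2 = esym_remove2[OF i, folded I_def]
    have unit: "z * y (Suc j) * esym 3 y I = 1"
      using esym_remove(5)[OF i(2)] unfolding remove2 z_def by (simp only: mult_ac)
    then have inv: "inverse (z * y (Suc j)) = esym 3 y I" by (rule inverse_unique)
    have frac: "N / (1 * w * v * D) = inverse (w * v) * N / D" for N w v
      by (simp add: divide_inverse mult_ac)
    have "m5 1 y (Suc i) (Suc j) = esym 3 y I * ((z^2 + z + 1) * (1 + z * esym 1 y I + z^2 * esym 2 y I + z^3 * esym 3 y I)) / D"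
      unfolding m5_def I_def[symmetric] z_def[symmetric] D_def[symmetric] frac inv
      using i(3) prod_three_one_plus[OF \<open>card I = 3\<close>, of z y] by simp
    moreover have "e 1 = z + y (Suc j) + esym 1 y I" "e 2 = z * y (Suc j) + (z + y (Suc j)) * esym 1 y I + esym 2 y I"
      "e 3 = z * y (Suc j) * esym 1 y I + (z + y (Suc j)) * esym 2 y I + esym 3 y I"
      "e 4 = z * y (Suc j) * esym 2 y I + (z + y (Suc j)) * esym 3 y I"
      unfolding esym_remove(1-4)[OF i(2)] remove2 z_def by (simp_all add: algebra_simps)
    ultimately show ?thesis
      using off_diag5[OF unit, of "esym 1 y I" "esym 2 y I"]
      by (simp add: c_def remove2 z_def[symmetric] del: One_nat_def)
  qed
  finally show "mat 5 5 (\<lambda>(i, j). m5 1 y (Suc i) (Suc j)) $$ (i, j) = (vander * companion_partner5 (e 1) (e 2) (e 3) (e 4) * vander_inv) $$ (i, j)"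
    using ij by simp
qed (simp_all add: vander_def vander_inv_def)

lemma rho5_braid_matrix_pair_unit:
  "braid_matrix_pair 5 (mk_diagonal [y 1, y 2, y 3, y 4, y 5]) (mat 5 5 (\<lambda>(i, j). m5 1 y (Suc i) (Suc j))) 1"
proof -
  interpret braid_matrix_pair 5 "companion5 (e 1) (e 2) (e 3) (e 4)" "companion_partner5 (e 1) (e 2) (e 3) (e 4)" 1
    by (rule companion_braid_matrix_pair)
  show ?thesis unfolding A_conj B_conj by (rule conjugate[OF _ _ vander_inverse]) (simp_all add: vander_def vander_inv_def)
qed

end

theorem rho5_braid_matrix_pair:
  assumes inj: "inj_on x {1..5}" and nz: "\<forall>i\<in>{1..5}. x i \<noteq> 0" and f: "f ^ 5 = esym 5 x {1..5}"
  shows "braid_matrix_pair 5 (rho5_g1 x) (rho5_g2 f x) (f ^ 6)"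
proof -
  have f0: "f \<noteq> 0" using f nz unfolding esym_full by auto
  define y where "y = (\<lambda>i. x i / f)"
  have x: "x = (\<lambda>i. f * y i)" using f0 by (simp add: y_def)
  have "inj_on y {1..5}" using inj f0 by (auto simp: y_def inj_on_def)
  moreover have "esym 5 y {1..5} = 1"
    using f f0 unfolding x esym_scale by simp
  ultimately interpret unit: braid_matrix_pair 5 "mk_diagonal [y 1, y 2, y 3, y 4, y 5]"
    "mat 5 5 (\<lambda>(i, j). m5 1 y (Suc i) (Suc j))" 1
    by (rule rho5_braid_matrix_pair_unit)
  have "f \<cdot>\<^sub>m mk_diagonal [y 1, y 2, y 3, y 4, y 5] = rho5_g1 x"
    unfolding rho5_g1_def x by (rule eq_matI) (auto simp: mk_diagonal_eq_mat less_Suc_eq numeral_eq_Suc)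
  moreover have "f \<cdot>\<^sub>m mat 5 5 (\<lambda>(i, j). m5 1 y (Suc i) (Suc j)) = rho5_g2 f x"
    unfolding rho5_g2_def x by (rule eq_matI) (use f0 in \<open>simp_all add: m5_scale\<close>)
  ultimately show ?thesis using unit.scale[OF f0] by simp
qed

section \<open>Polynomial identities for dimension six\<close>

definition root_diff :: "complex \<Rightarrow> complex \<Rightarrow> complex \<Rightarrow> complex \<Rightarrow> complex \<Rightarrow> complex" where
  "root_diff a b c d e = (b - a) * (c - a) * (d - a) * (e - a)"

text \<open>
  The ingredients of the six-dimensional representation as functions of values: \<open>num6\<close> is the
  numerator of $g_{ii}$, \<open>pr6\<close> is $p_i/x_i$, and \<open>U6\<close>, \<open>Z6\<close> are the numerator
  of $u$ and the polynomial $z$. \<open>W6\<close> is the second factor of $w$. It depends on its first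
  two arguments symmetrically, and on the next two as well. In all of them the last argument is $x_5$.
\<close>
definition num6 where
  "num6 a b c d e = b*c*d*e*(b + c + d + e) - a*e*(b*c*d + b*c*e + b*d*e + c*d*(e::complex))"
definition pr6 where "pr6 a b c d e = b*c*d*e - a^2*(e::complex)^2"
definition W6 where "W6 a b c d e = a*b*c*d*(a*b + e*(c + d)) - e^3*(a*b*(c + d) + (e::complex)*c*d)"
definition U6 where "U6 a b c d e = a*b*(c + d)*(c*d - a*e) + c*d*(b - a)*(a^2 + b*(e::complex))"
definition Z6 where "Z6 a b c d (e::complex) =
   ((b+c+d) * (b*c*d) - a^2 * (b*c+b*d+c*d)) * (a * (b+c+d) * (b*c*d) - (b*c+b*d+c*d) * e^3) * a * e
        + (b*c*d) * (a - e) *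
          (a^2 * ((b+c+d) - a) * ((b*c*d) * (a - e) - (b+c+d) * e^3)
           + (a * (b*c+b*d+c*d) - b*c*d) * (a * (b*c+b*d+c*d) + (a - e) * e^2) * e)"

context
  fixes a b c d e t V :: complex
  assumes dist: "distinct [a, b, c, d, e]"
  defines "V \<equiv> (a-b)*(a-c)*(a-d)*(a-e)*(b-c)*(b-d)*(b-e)*(c-d)*(c-e)*(d-e)"
begin

lemma vandermonde6: "V \<noteq> 0" using dist by (simp add: V_def)

lemma vandermonde_denominators:
  "N / root_diff a b c d e = N * ((b-c)*(b-d)*(b-e)*(c-d)*(c-e)*(d-e)) / V"
  "N / root_diff b a c d e = N * (-(a-c)*(a-d)*(a-e)*(c-d)*(c-e)*(d-e)) / V"
  "N / root_diff c a b d e = N * ((a-b)*(a-d)*(a-e)*(b-d)*(b-e)*(d-e)) / V"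
  "N / root_diff d a b c e = N * (-(a-b)*(a-c)*(a-e)*(b-c)*(b-e)*(c-e)) / V"
  "N / root_diff e a b c d = N * ((a-b)*(a-c)*(a-d)*(b-c)*(b-d)*(c-d)) / V"
  "N / ((a-b)*(b-c)*(d-c)*(e-c)) = N * ((a-c)*(a-d)*(a-e)*(b-d)*(b-e)*(d-e)) / V"
  "N / ((a-b)*(b-d)*(c-d)*(e-d)) = N * (-(a-c)*(a-d)*(a-e)*(b-c)*(b-e)*(c-e)) / V"
  "N / ((a-b)*(b-e)*(c-e)*(d-e)) = N * ((a-c)*(a-d)*(a-e)*(b-c)*(b-d)*(c-d)) / V"
  "N / ((b-a)*(a-c)*(d-c)*(e-c)) = N * (-(b-c)*(b-d)*(b-e)*(a-d)*(a-e)*(d-e)) / V"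
  "N / ((b-a)*(a-d)*(c-d)*(e-d)) = N * ((b-c)*(b-d)*(b-e)*(a-c)*(a-e)*(c-e)) / V"
  "N / ((b-a)*(a-e)*(c-e)*(d-e)) = N * (-(b-c)*(b-d)*(b-e)*(a-c)*(a-d)*(c-d)) / V"
  by - (rule divide_common_denominator[OF _ vandermonde6], (unfold V_def root_diff_def)[1], Groebner_Basis.algebra)+

lemmas clear_denominators = vandermonde_denominators add_divide_distrib[symmetric] nonzero_divide_eq_eq[OF vandermonde6]

text \<open>
  The weighted identity outside of the diagonal of the upper left block, divided by the entry at
  that position. The term with \<open>W6\<close> is the contribution of the double eigenvalue \<open>e\<close>.
\<close>
lemma pair6:
  "(a + t*a^2) * num6 a b c d e / root_diff a b c d e + (b + t*b^2) * num6 b a c d e / root_diff b a c d e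
   + (1 + t*c) * (a*b + c*d) * pr6 c a b d e / root_diff c a b d e
   + (1 + t*d) * (a*b + c*d) * pr6 d a b c e / root_diff d a b c e
   + (1 + t*e) * W6 a b c d e / root_diff e a b c d = a * b"
  unfolding clear_denominators
  unfolding V_def num6_def pr6_def W6_def by Groebner_Basis.algebra

text \<open>
  The weighted identity on the diagonal of the upper left block, multiplied by
  $a\,\Delta_i(X)$.
\<close>
lemma diag6:
  "a * (a + t*a^2) * (num6 a b c d e)^2 / root_diff a b c d e
   + (1 + t*b) * (pr6 a b c d e * pr6 b a c d e * (a*c+b*d)*(a*d+b*c)) / root_diff b a c d e
   + (1 + t*c) * (pr6 a b c d e * pr6 c a b d e * (a*b+c*d)*(a*d+b*c)) / root_diff c a b d e
   + (1 + t*d) * (pr6 a b c d e * pr6 d a b c e * (a*b+c*d)*(a*c+b*d)) / root_diff d a b c e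
   + (1 + t*e) * (e * Z6 a b c d e) / root_diff e a b c d
   = a^3 * num6 a b c d e - t * (e^2*b*c*d * root_diff a b c d e)"
  unfolding clear_denominators
  unfolding V_def num6_def pr6_def Z6_def root_diff_def by Groebner_Basis.algebra

text \<open>
  Up to the factor $-1/(a-b)$ this is the third divided difference of the polynomial $1 + tz$ at the
  nodes $b, c, d, e$. It is 0 because the degree is less than 3. It is what is left of the weighted identity
  at position $(6, 1)$, where the right hand side is 0.
\<close>
lemma lagrange_entry_61:
  "(1 + t*b) / root_diff b a c d e + (1 + t*c) / ((a-b)*(b-c)*(d-c)*(e-c))
    + (1 + t*d) / ((a-b)*(b-d)*(c-d)*(e-d)) + (1 + t*e) / ((a-b)*(b-e)*(c-e)*(d-e)) = 0"
  unfolding clear_denominators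
  unfolding V_def by Groebner_Basis.algebra

lemma lagrange_entry_51:
  "(a + t*a^2) * num6 a b c d e / root_diff a b c d e
    + (e + t*e^2) * U6 a b c d e / ((b-a)*(a-e)*(c-e)*(d-e))
    + (1 + t*c) * (pr6 a b c d e * (a*d+b*c)) / ((b-a)*(a-c)*(d-c)*(e-c))
    + (1 + t*d) * (pr6 a b c d e * (a*c+b*d)) / ((b-a)*(a-d)*(c-d)*(e-d)) = a * e"
  unfolding clear_denominators
  unfolding V_def num6_def pr6_def U6_def by Groebner_Basis.algebra

lemma lagrange_entry_53:
  "(1 + t*a) * (pr6 c a b d e * (a*b+c*d) * (b-a)) / root_diff a b c d e
   + (c + t*c^2) * ((b-c) * num6 c a b d e) / root_diff c a b d e
   + (1 + t*d) * ((b-a) * pr6 c a b d e * (a*c+b*d)) / ((b-a)*(a-d)*(c-d)*(e-d))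
   + (e + t*e^2) * ((b-c) * U6 a b c d e) / ((b-a)*(a-e)*(c-e)*(d-e))
   + (1 + t*e) * ((c-a) * (a*c+b*d) * pr6 b a c d e) / ((b-a)*(a-e)*(c-e)*(d-e)) = (b-c)*(e*c)"
  unfolding clear_denominators
  unfolding V_def num6_def pr6_def U6_def by Groebner_Basis.algebra
end

lemma W6_commute: "W6 b a c d e = W6 a b c d e" by (simp add: W6_def algebra_simps)

text \<open>
  The following three relations express $g_{i5} g_{5j} + g_{i6} g_{6j}$ by one fraction, for $j = 3$ and
  for $i = 1$, $i = 4$ and $i = 3$. The factors $b - c$ and $c - a$ come from bringing the denominators of
  $g_{53}$ and $g_{63}$ to $\Delta_3(X)$.
\<close>
lemma Z6_W6_relation: "e * Z6 a b c d e * (b - c) + (a*c+b*d) * pr6 b a c d e * W6 a b c d e * (c - a)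
   = (b - a) * (pr6 c a b d e * (a*b+c*d) * W6 a c b d e)"
  unfolding Z6_def W6_def pr6_def by Groebner_Basis.algebra

lemma W6_relation: "pr6 a b c d e * W6 a d b c e * (b - c) + pr6 b a c d e * W6 b d a c e * (c - a)
   = (b - a) * (pr6 c a b d e * W6 c d a b e)"
  unfolding W6_def pr6_def by Groebner_Basis.algebra

lemma W6_Z6_relation: "pr6 a b c d e * W6 a c b d e * (a*d+b*c) * (b - c) + (a*c+b*d) * pr6 b a c d e * W6 b c a d e * (c - a)
   = (b - a) * (e * Z6 c b a d e)"
  unfolding Z6_def W6_def pr6_def by Groebner_Basis.algebra

text \<open>
  The common factor \<open>F\<close> in the proof is the entry at $(i, j)$. Dividing by it turns the
  weighted identity into the hypothesis \<open>L\<close>, of which \<open>pair6\<close> is an instance.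
\<close>
lemma off_diag_combine:
  fixes a b c d e t :: complex
  assumes nz: "a \<noteq> 0" "b \<noteq> 0" "c \<noteq> 0" "d \<noteq> 0" "e \<noteq> 0"
    and L: "(a + t*a^2) * na / Da + (b + t*b^2) * nb / Db
      + (1 + t*c) * Q * pc / Dc + (1 + t*d) * Q * pd / Dd + (1 + t*e) * W / De = a * b"
    and \<kappa>: "\<kappa>ac * \<kappa>cb = \<kappa> * Q" "\<kappa>ad * \<kappa>db = \<kappa> * Q"
    and X: "X = \<kappa> * b * pb * W / (a^2 * e * Db * De)"
  shows "na / Da * (a + t*a^2) * (\<kappa> * (b * pb) / (a^2 * Db))
    + \<kappa> * (b * pb) / (a^2 * Db) * (b + t*b^2) * (nb / Db)
    + \<kappa>ac * (c * pc) / (a^2 * Dc) * (c + t*c^2) * (\<kappa>cb * (b * pb) / (c^2 * Db))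
    + \<kappa>ad * (d * pd) / (a^2 * Dd) * (d + t*d^2) * (\<kappa>db * (b * pb) / (d^2 * Db))
    + (e + t*e^2) * X = a * b * (\<kappa> * (b * pb) / (a^2 * Db))"
proof -
  define F where "F = \<kappa> * (b * pb) / (a^2 * Db)"
  have c: "\<kappa>ac * (c * pc) / (a^2 * Dc) * (c + t*c^2) * (\<kappa>cb * (b * pb) / (c^2 * Db))
      = F * ((1 + t*c) * Q * pc / Dc)"
  proof -
    have "\<kappa>ac * (c * pc) / (a^2 * Dc) * (c + t*c^2) * (\<kappa>cb * (b * pb) / (c^2 * Db))
        = (\<kappa>ac * \<kappa>cb) * (b * pb) / (a^2 * Db) * (c * (c + t*c^2) / c^2 * pc / Dc)" by (simp add: mult_ac)
    also have "c * (c + t*c^2) / c^2 = 1 + t * c" using nz by (simp add: power2_eq_square field_simps)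
    finally show ?thesis by (simp add: \<kappa> F_def)
  qed
  have d: "\<kappa>ad * (d * pd) / (a^2 * Dd) * (d + t*d^2) * (\<kappa>db * (b * pb) / (d^2 * Db))
      = F * ((1 + t*d) * Q * pd / Dd)"
  proof -
    have "\<kappa>ad * (d * pd) / (a^2 * Dd) * (d + t*d^2) * (\<kappa>db * (b * pb) / (d^2 * Db))
        = (\<kappa>ad * \<kappa>db) * (b * pb) / (a^2 * Db) * (d * (d + t*d^2) / d^2 * pd / Dd)" by (simp add: mult_ac)
    also have "d * (d + t*d^2) / d^2 = 1 + t * d" using nz by (simp add: power2_eq_square field_simps)
    finally show ?thesis by (simp add: \<kappa> F_def)
  qed
  have ab: "na / Da * (a + t*a^2) * (\<kappa> * (b * pb) / (a^2 * Db)) = F * ((a + t*a^2) * na / Da)"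
    "\<kappa> * (b * pb) / (a^2 * Db) * (b + t*b^2) * (nb / Db) = F * ((b + t*b^2) * nb / Db)"
    by (simp_all add: F_def mult_ac)
  have e: "(e + t*e^2) * X = F * ((1 + t*e) * W / De)"
  proof -
    have "e + t*e^2 = e * (1 + t*e)" by (simp add: power2_eq_square algebra_simps)
    then show ?thesis using nz by (simp add: X F_def mult_ac)
  qed
  show ?thesis
    unfolding c d e ab unfolding F_def[symmetric]
    using arg_cong[OF L, of "\<lambda>y. F * y"] by (simp only: distrib_left mult.commute[of "a * b"])
qed

text \<open>
  The same for the diagonal and \<open>diag6\<close>, where the common factor is $1/(a\,\Delta_i(X))$.
\<close>
lemma diag_combine:
  fixes a b c d e t :: complex
  assumes nz: "a \<noteq> 0" "b \<noteq> 0" "c \<noteq> 0" "d \<noteq> 0" "e \<noteq> 0" "Da \<noteq> 0"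
    and L: "a * (a + t*a^2) * na^2 / Da + (1 + t*b) * (pa * pb * qb1 * qb2) / Db
      + (1 + t*c) * (pa * pc * qc1 * qc2) / Dc + (1 + t*d) * (pa * pd * qd1 * qd2) / Dd
      + (1 + t*e) * (e * Z) / De = a^3 * na - t * (e^2*b*c*d * Da)"
    and \<kappa>: "\<kappa>ab * \<kappa>ba = qb1 * qb2" "\<kappa>ac * \<kappa>ca = qc1 * qc2" "\<kappa>ad * \<kappa>da = qd1 * qd2"
    and X: "X = Z / (a * De) / Da"
  shows "na / Da * (a + t*a^2) * (na / Da)
    + \<kappa>ab * (b * pb) / (a^2 * Db) * (b + t*b^2) * (\<kappa>ba * (a * pa) / (b^2 * Da))
    + \<kappa>ac * (c * pc) / (a^2 * Dc) * (c + t*c^2) * (\<kappa>ca * (a * pa) / (c^2 * Da))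
    + \<kappa>ad * (d * pd) / (a^2 * Dd) * (d + t*d^2) * (\<kappa>da * (a * pa) / (d^2 * Da))
    + (e + t*e^2) * X = a * a * (na / Da) + t * (-(e^2 * (a*b*c*d)) / a^2)"
proof -
  define F where "F = 1 / (a * Da)"
  have k: "\<kappa>1 * (x * px) / (a^2 * Dx) * (x + t*x^2) * (\<kappa>2 * (a * pa) / (x^2 * Da))
      = F * ((1 + t*x) * (pa * px * q1 * q2) / Dx)" if "\<kappa>1 * \<kappa>2 = q1 * q2" "x \<noteq> 0"
    for \<kappa>1 \<kappa>2 q1 q2 x px Dx
  proof -
    have "\<kappa>1 * (x * px) / (a^2 * Dx) * (x + t*x^2) * (\<kappa>2 * (a * pa) / (x^2 * Da))
        = (\<kappa>1 * \<kappa>2) * (a / a^2) * (pa / Da) * (x * (x + t*x^2) / x^2 * px / Dx)" by (simp add: mult_ac)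
    also have "x * (x + t*x^2) / x^2 = 1 + t * x" using that(2) by (simp add: power2_eq_square field_simps)
    also have "a / a^2 = 1 / a" using nz by (simp add: power2_eq_square)
    finally show ?thesis by (simp add: that(1) F_def)
  qed
  have a: "na / Da * (a + t*a^2) * (na / Da) = F * (a * (a + t*a^2) * na^2 / Da)"
    using nz by (simp add: F_def power2_eq_square)
  have e: "(e + t*e^2) * X = F * ((1 + t*e) * (e * Z) / De)"
  proof -
    have "e + t*e^2 = e * (1 + t*e)" by (simp add: power2_eq_square algebra_simps)
    then show ?thesis using nz by (simp add: X F_def mult_ac)
  qed
  have r: "a * a * (na / Da) + t * (-(e^2 * (a*b*c*d)) / a^2) = F * (a^3 * na - t * (e^2*b*c*d * Da))"
    using nz by (simp add: F_def power2_eq_square power3_eq_cube field_simps)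
  show ?thesis
    unfolding a e r k[OF \<kappa>(1) nz(2)] k[OF \<kappa>(2) nz(3)] k[OF \<kappa>(3) nz(4)]
    using arg_cong[OF L, of "\<lambda>y. F * y"] by (simp only: distrib_left)
qed

section \<open>The entries in dimension six\<close>

definition N6 where
  "N6 x i = esym 4 x ({1..5} - {i}) * esym 1 x ({1..5} - {i}) - x i * x 5 * esym 3 x ({1..5} - {i})"

lemma data6:
  assumes "enum4 i j k l"
  shows "N6 x i = num6 (x i) (x j) (x k) (x l) (x 5)"
    and "Delta i x {1..5} = root_diff (x i) (x j) (x k) (x l) (x 5)"
    and "Delta 5 x {1..5} = root_diff (x 5) (x i) (x j) (x k) (x l)"
    and "p6 x i = x i * pr6 (x i) (x j) (x k) (x l) (x 5)"
proof -
  note D = Diff_enum4[OF assms]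
  have d: "distinct [i, j, k, l]" "5 \<notin> {i, j, k, l}" using assms D(6) by (auto simp: enum4_def)
  show "N6 x i = num6 (x i) (x j) (x k) (x l) (x 5)"
    unfolding N6_def D(1) num6_def using d by (simp add: algebra_simps)
  show "Delta i x {1..5} = root_diff (x i) (x j) (x k) (x l) (x 5)"
    unfolding Delta_def D(1) root_diff_def using d by (simp add: mult.assoc)
  show "Delta 5 x {1..5} = root_diff (x 5) (x i) (x j) (x k) (x l)"
    unfolding Delta_def D(2) root_diff_def using d by (simp add: mult.assoc)
  show "p6 x i = x i * pr6 (x i) (x j) (x k) (x l) (x 5)"
    unfolding p6_def D(4) pr6_def using d
    by (simp add: algebra_simps power2_eq_square power3_eq_cube)
qed

definition g6 :: "(nat \<Rightarrow> complex) \<Rightarrow> nat \<Rightarrow> nat \<Rightarrow> complex" where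
  "g6 x i j = rho6_g2 x $$ (i - 1, j - 1)"

lemma rho6_g2_eq_mat: "rho6_g2 x = mat 6 6 (\<lambda>(i, j). g6 x (Suc i) (Suc j))"
  by (rule eq_matI) (simp_all add: g6_def rho6_g2_def mat_of_rows_list_def Let_def)

lemma g6_diag:
  assumes "i \<in> {1, 2, 3, 4}"
  shows "g6 x i i = N6 x i / Delta i x {1..5}"
  using assms by (auto simp: g6_def rho6_g2_def mat_of_rows_list_def Let_def N6_def)

lemma g6_off_diag:
  assumes "enum4 i j k l"
  shows "g6 x i j = kappa (q6 x) i j * p6 x j / ((x i)\<^sup>2 * Delta j x {1..5})"
  using enum4_cases[OF assms]
  by (elim insertE emptyE)
    (simp_all add: g6_def rho6_g2_def mat_of_rows_list_def Let_def kappa_def insert_Diff_if mult.commute)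

lemma pr6_swaps: "pr6 a c b d e = pr6 a b c d e" "pr6 a d c b e = pr6 a b c d e"
  "pr6 a b d c e = pr6 a b c d e"
  by (simp_all add: pr6_def)

lemma W6_swap: "W6 a b d c e = W6 a b c d e"
  by (simp add: W6_def algebra_simps)

context
  fixes x :: "nat \<Rightarrow> complex" and a b c d e :: complex
  defines "a \<equiv> x 1" and "b \<equiv> x 2" and "c \<equiv> x 3" and "d \<equiv> x 4" and "e \<equiv> x 5"
begin

private lemmas entry = g6_def rho6_g2_def mat_of_rows_list_def Let_def sigma_def

private lemma range5: "{1..5::nat} = {1, 2, 3, 4, 5}" "{Suc 0..5} = {1, 2, 3, 4, 5}" by auto

private lemma base_enum: "enum4 1 2 3 4" "enum4 2 1 3 4" by (auto simp: enum4_def)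

private lemma p6_eq:
  "p6 y 1 = y 1 * pr6 (y 1) (y 2) (y 3) (y 4) (y 5)" "p6 y 2 = y 2 * pr6 (y 2) (y 1) (y 3) (y 4) (y 5)"
  by (rule data6(4)[OF base_enum(1)] data6(4)[OF base_enum(2)])+

private lemma w6_eq: "w6 y = y 1 * pr6 (y 1) (y 2) (y 3) (y 4) (y 5) * W6 (y 1) (y 3) (y 2) (y 4) (y 5)"
  by (simp add: w6_def p6_eq W6_def mult_ac del: One_nat_def)

private lemma z6_eq: "z6 y = Z6 (y 1) (y 2) (y 3) (y 4) (y 5)"
proof -
  have "esym 1 y {2, 3, 4} = y 2 + y 3 + y 4"
    "esym 2 y {2, 3, 4} = y 2 * y 3 + y 2 * y 4 + y 3 * y 4"
    "esym 3 y {2, 3, 4} = y 2 * y 3 * y 4"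
    by (simp_all add: algebra_simps)
  then show ?thesis by (simp only: z6_def Z6_def Let_def)
qed

lemma g6_col5:
  "g6 x 1 5 = Z6 a b c d e / (a * root_diff e a b c d)"
  "g6 x 2 5 = a * pr6 a b c d e * W6 a b c d e / (b\<^sup>2 * e * root_diff e a b c d)"
  "g6 x 3 5 = a * pr6 a b c d e * W6 a c b d e / (c\<^sup>2 * e * root_diff e a b c d)"
  "g6 x 4 5 = a * pr6 a b c d e * W6 a d b c e / (d\<^sup>2 * e * root_diff e a b c d)"
  by (simp_all add: entry w6_eq z6_eq data6(3)[OF base_enum(1)] a_def[symmetric] b_def[symmetric]
    c_def[symmetric] d_def[symmetric] e_def[symmetric] pr6_swaps W6_swap q6_def insert_Diff_if
    del: One_nat_def)

lemma g6_col6: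
  "g6 x 1 6 = (a*c+b*d)*(a*d+b*c) * (b * pr6 b a c d e) * W6 b a c d e / (a\<^sup>2 * e * root_diff e a b c d)"
  "g6 x 2 6 = Z6 b a c d e / (b * root_diff e a b c d)"
  "g6 x 3 6 = (a*c+b*d) * (b * pr6 b a c d e) * W6 b c a d e / (c\<^sup>2 * e * root_diff e a b c d)"
  "g6 x 4 6 = (a*d+b*c) * (b * pr6 b a c d e) * W6 b d a c e / (d\<^sup>2 * e * root_diff e a b c d)"
  by (simp_all add: entry w6_eq z6_eq data6(3)[OF base_enum(1)] a_def[symmetric] b_def[symmetric]
    c_def[symmetric] d_def[symmetric] e_def[symmetric] pr6_swaps W6_swap q6_def insert_Diff_if
    del: One_nat_def)

lemma g6_row5:
  "g6 x 5 1 = 1 / root_diff a b c d e"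
  "g6 x 5 2 = 0"
  "g6 x 5 3 = (a*d+b*c) * c / (a * ((b-a)*(a-c)*(d-c)*(e-c)))"
  "g6 x 5 4 = (a*c+b*d) * d / (a * ((b-a)*(a-d)*(c-d)*(e-d)))"
  "g6 x 5 5 = U6 a b c d e / ((b-a)*(a-e)*(c-e)*(d-e))"
  "g6 x 5 6 = (a*c+b*d)*(a*d+b*c) * (b * pr6 b a c d e) / (a * e * ((b-a)*(a-e)*(c-e)*(d-e)))"
  by (simp_all add: entry range5 p6_eq a_def b_def c_def d_def e_def Delta_def root_diff_def r6_def
    u6_def v6_def U6_def q6_def insert_Diff_if mult.assoc del: One_nat_def)

lemma g6_row6:
  "g6 x 6 1 = 0"
  "g6 x 6 2 = 1 / root_diff b a c d e"
  "g6 x 6 3 = c / (b * ((a-b)*(b-c)*(d-c)*(e-c)))"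
  "g6 x 6 4 = d / (b * ((a-b)*(b-d)*(c-d)*(e-d)))"
  "g6 x 6 5 = a * pr6 a b c d e / (b * e * ((a-b)*(b-e)*(c-e)*(d-e)))"
  "g6 x 6 6 = U6 b a c d e / ((a-b)*(b-e)*(c-e)*(d-e))"
  by (simp_all add: entry range5 p6_eq a_def b_def c_def d_def e_def Delta_def root_diff_def r6_def
    u6_def v6_def U6_def q6_def insert_Diff_if mult.assoc del: One_nat_def)

end

context
  fixes a b c d e t :: complex
  assumes dist: "distinct [a, b, c, d, e]" and nz: "a \<noteq> 0" "b \<noteq> 0" "c \<noteq> 0" "d \<noteq> 0" "e \<noteq> 0"
begin

private lemma weight: "y + t * y^2 = y * (1 + t * y)"
  by (simp add: power2_eq_square algebra_simps)

private lemma rd_nz: "root_diff c a b d e \<noteq> 0" "b - a \<noteq> 0"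
  using dist by (auto simp: root_diff_def)

text \<open>
  The denominators of $r$ and $\sigma_{12} \circ r$ are $\Delta_3(X)$ up to one factor, which is moved to
  the numerator.
\<close>
private lemma partial_c:
  "N / (y * ((b-a)*(a-c)*(d-c)*(e-c))) = N * (b - c) / (y * (b - a) * root_diff c a b d e)"
  "N / (y * ((a-b)*(b-c)*(d-c)*(e-c))) = N * (c - a) / (y * (b - a) * root_diff c a b d e)"
  using dist by (auto simp: root_diff_def divide_simps) (simp_all add: algebra_simps)

text \<open>
  The contribution of the double eigenvalue to column 3. The factor \<open>r\<close> stands for $q_4$ if
  the formula is used for row 1. It is 1 when the roles of 1 and 2 are exchanged, because
  $g_{16}$ and $g_{53}$ carry factors $q$ that $g_{25}$ and $g_{63}$ do not have.
\<close>
lemma double_root_entry_13: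
  "Z6 a b c d e / (a * M) * (r * c / (a * ((b-a)*(a-c)*(d-c)*(e-c))))
   + (a*c+b*d) * r * (b * pr6 b a c d e) * W6 b a c d e / (a^2 * e * M) * (c / (b * ((a-b)*(b-c)*(d-c)*(e-c))))
   = (a*b+c*d) * r * (c * pr6 c a b d e) * W6 a c b d e / (a^2 * e * root_diff c a b d e * M)"
proof -
  define K where "K = r * c / (a^2 * e * root_diff c a b d e * M) / (b - a)"
  have 1: "Z6 a b c d e / (a * M) * (r * c * (b - c) / (a * (b - a) * root_diff c a b d e)) = K * (e * Z6 a b c d e * (b - c))"
    and 2: "(a*c+b*d) * r * (b * pr6 b a c d e) * W6 b a c d e / (a^2 * e * M) * (c * (c - a) / (b * (b - a) * root_diff c a b d e)) = (K * ((a*c+b*d) * pr6 b a c d e * W6 a b c d e * (c - a)))"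
    and 3: "(a*b+c*d) * r * (c * pr6 c a b d e) * W6 a c b d e / (a^2 * e * root_diff c a b d e * M) = K * ((b - a) * (pr6 c a b d e * (a*b+c*d) * W6 a c b d e))"
    using nz rd_nz W6_commute[of b a c d e] W6_commute[of d c a b e]
    by (simp_all add: K_def power2_eq_square mult_ac)
  show ?thesis
    unfolding partial_c 1 2 3 using arg_cong[OF Z6_W6_relation[of e a b c d], of "\<lambda>y. K * y"]
    by (simp only: distrib_left)
qed

lemma double_root_entry_43:
  "a * pr6 a b c d e * W6 a d b c e / (d^2 * e * M) * ((a*d+b*c) * c / (a * ((b-a)*(a-c)*(d-c)*(e-c))))
   + (a*d+b*c) * (b * pr6 b a c d e) * W6 b d a c e / (d^2 * e * M) * (c / (b * ((a-b)*(b-c)*(d-c)*(e-c))))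
   = (a*d+b*c) * (c * pr6 c a b d e) * W6 d c a b e / (d^2 * e * root_diff c a b d e * M)"
proof -
  define K where "K = (a*d+b*c) * c / (d^2 * e * root_diff c a b d e * M) / (b - a)"
  have 1: "a * pr6 a b c d e * W6 a d b c e / (d^2 * e * M) * ((a*d+b*c) * c * (b - c) / (a * (b - a) * root_diff c a b d e)) = K * (pr6 a b c d e * W6 a d b c e * (b - c))"
    and 2: "(a*d+b*c) * (b * pr6 b a c d e) * W6 b d a c e / (d^2 * e * M) * (c * (c - a) / (b * (b - a) * root_diff c a b d e)) = (K * (pr6 b a c d e * W6 b d a c e * (c - a)))"
    and 3: "(a*d+b*c) * (c * pr6 c a b d e) * W6 d c a b e / (d^2 * e * root_diff c a b d e * M) = K * ((b - a) * (pr6 c a b d e * W6 c d a b e))"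
    using nz rd_nz W6_commute[of b a c d e] W6_commute[of d c a b e]
    by (simp_all add: K_def power2_eq_square mult_ac)
  show ?thesis
    unfolding partial_c 1 2 3 using arg_cong[OF W6_relation[of a b c d e], of "\<lambda>y. K * y"]
    by (simp only: distrib_left)
qed

lemma double_root_entry_33:
  "a * pr6 a b c d e * W6 a c b d e / (c^2 * e * M) * ((a*d+b*c) * c / (a * ((b-a)*(a-c)*(d-c)*(e-c))))
   + (a*c+b*d) * (b * pr6 b a c d e) * W6 b c a d e / (c^2 * e * M) * (c / (b * ((a-b)*(b-c)*(d-c)*(e-c))))
   = Z6 c b a d e / (c * M) / root_diff c a b d e"
proof -
  define K where "K = c / (c^2 * e * root_diff c a b d e * M) / (b - a)"
  have 1: "a * pr6 a b c d e * W6 a c b d e / (c^2 * e * M) * ((a*d+b*c) * c * (b - c) / (a * (b - a) * root_diff c a b d e)) = K * (pr6 a b c d e * W6 a c b d e * (a*d+b*c) * (b - c))"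
    and 2: "(a*c+b*d) * (b * pr6 b a c d e) * W6 b c a d e / (c^2 * e * M) * (c * (c - a) / (b * (b - a) * root_diff c a b d e)) = (K * ((a*c+b*d) * pr6 b a c d e * W6 b c a d e * (c - a)))"
    and 3: "Z6 c b a d e / (c * M) / root_diff c a b d e = K * ((b - a) * (e * Z6 c b a d e))"
    using nz rd_nz W6_commute[of b a c d e] W6_commute[of d c a b e]
    by (simp_all add: K_def power2_eq_square mult_ac)
  show ?thesis
    unfolding partial_c 1 2 3 using arg_cong[OF W6_Z6_relation[of a b c d e], of "\<lambda>y. K * y"]
    by (simp only: distrib_left)
qed

text \<open>
  The weighted identity in rows 5 and 6 is needed at $(5,1)$, $(6,1)$ and $(5,3)$. The other positions in
  the first four columns arise, up to factors $q_a$, by exchanging $x_1$ with $x_2$, or $x_3$ with $x_4$.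
\<close>
lemma weighted_entry_51:
  "1 / root_diff a b c d e * (a + t*a^2) * (num6 a b c d e / root_diff a b c d e)
   + (a*d+b*c) * c / (a * ((b-a)*(a-c)*(d-c)*(e-c))) * (c + t*c^2) * (a * pr6 a b c d e / (c^2 * root_diff a b c d e))
   + (a*c+b*d) * d / (a * ((b-a)*(a-d)*(c-d)*(e-d))) * (d + t*d^2) * (a * pr6 a b c d e / (d^2 * root_diff a b c d e))
   + (e + t*e^2) * (U6 a b c d e / ((b-a)*(a-e)*(c-e)*(d-e)) * (1 / root_diff a b c d e))
   = e * a * (1 / root_diff a b c d e)"
proof -
  have k: "q * y / (a * P) * (y + t*y^2) * (a * pr6 a b c d e / (y^2 * root_diff a b c d e))
    = 1 / root_diff a b c d e * ((1 + t*y) * (pr6 a b c d e * q) / P)" if "y \<noteq> 0" for q y P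
    using that nz unfolding weight by (simp add: power2_eq_square mult_ac)
  have k': "1 / P * w * (n / P) = 1 / P * (w * n / P)" for P w n :: complex by simp
  have e: "w * (U / P * (1 / R)) = 1 / R * (w * U / P)" for w U P R :: complex by simp
  have r: "e * a * (1 / R) = 1 / R * (a * e)" for R :: complex by simp
  show ?thesis
    unfolding k[OF nz(3)] k[OF nz(4)] k' e r
    using arg_cong[OF lagrange_entry_51[OF dist, of t], of "\<lambda>y. 1 / root_diff a b c d e * y"]
    by (simp only: distrib_left add_ac)
qed

lemma weighted_entry_61:
  "1 / root_diff b a c d e * (b + t*b^2) * (a * pr6 a b c d e / (b^2 * root_diff a b c d e))
   + c / (b * ((a-b)*(b-c)*(d-c)*(e-c))) * (c + t*c^2) * (a * pr6 a b c d e / (c^2 * root_diff a b c d e))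
   + d / (b * ((a-b)*(b-d)*(c-d)*(e-d))) * (d + t*d^2) * (a * pr6 a b c d e / (d^2 * root_diff a b c d e))
   + (e + t*e^2) * (a * pr6 a b c d e / (b * e * ((a-b)*(b-e)*(c-e)*(d-e))) * (1 / root_diff a b c d e))
   = 0"
proof -
  define F where "F = a * pr6 a b c d e / (b * root_diff a b c d e)"
  have b: "1 / P * (b + t*b^2) * (a * pr6 a b c d e / (b^2 * root_diff a b c d e)) = F * ((1 + t*b) / P)" for P
    using nz unfolding weight by (simp add: F_def power2_eq_square mult_ac)
  have k: "y / (b * P) * (y + t*y^2) * (a * pr6 a b c d e / (y^2 * root_diff a b c d e))
    = F * ((1 + t*y) / P)" if "y \<noteq> 0" for y P
    using that unfolding weight by (simp add: F_def power2_eq_square mult_ac)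
  have e: "(e + t*e^2) * (a * pr6 a b c d e / (b * e * P) * (1 / root_diff a b c d e)) = F * ((1 + t*e) / P)" for P
    using nz unfolding weight by (simp add: F_def mult_ac)
  show ?thesis
    unfolding b e k[OF nz(3)] k[OF nz(4)] distrib_left[symmetric] lagrange_entry_61[OF dist] by simp
qed

lemma weighted_entry_53:
  "1 / root_diff a b c d e * (a + t*a^2) * ((a*b+c*d) * (c * pr6 c a b d e) / (a^2 * root_diff c a b d e))
   + c / (a * ((b-a)*(a-c)*(d-c)*(e-c))) * (c + t*c^2) * (num6 c a b d e / root_diff c a b d e)
   + d / (a * ((b-a)*(a-d)*(c-d)*(e-d))) * (d + t*d^2) * ((a*c+b*d) * (c * pr6 c a b d e) / (d^2 * root_diff c a b d e))
   + (e + t*e^2) * (U6 a b c d e / ((b-a)*(a-e)*(c-e)*(d-e)) * (c / (a * ((b-a)*(a-c)*(d-c)*(e-c))))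
      + (a*c+b*d) * (b * pr6 b a c d e) / (a * e * ((b-a)*(a-e)*(c-e)*(d-e))) * (c / (b * ((a-b)*(b-c)*(d-c)*(e-c)))))
   = e * c * (c / (a * ((b-a)*(a-c)*(d-c)*(e-c))))"
proof -
  define F where "F = c / (a * (b - a) * root_diff c a b d e)"
  have 1: "1 / P * (a + t*a^2) * ((a*b+c*d) * (c * pr6 c a b d e) / (a^2 * root_diff c a b d e))
      = F * ((1 + t*a) * (pr6 c a b d e * (a*b+c*d) * (b-a)) / P)" for P
    using nz rd_nz unfolding weight by (simp add: F_def power2_eq_square mult_ac)
  have 3: "d / (a * P) * (d + t*d^2) * ((a*c+b*d) * (c * pr6 c a b d e) / (d^2 * root_diff c a b d e))
      = F * ((1 + t*d) * ((b-a) * pr6 c a b d e * (a*c+b*d)) / P)" for P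
    using nz rd_nz unfolding weight by (simp add: F_def power2_eq_square mult_ac)
  have 4: "(e + t*e^2) * (U6 a b c d e / P * (c * (b - c) / (a * (b - a) * root_diff c a b d e)))
      = F * ((e + t*e^2) * ((b-c) * U6 a b c d e) / P)" for P
    by (simp add: F_def mult_ac)
  have 5: "(e + t*e^2) * ((a*c+b*d) * (b * pr6 b a c d e) / (a * e * P) * (c * (c - a) / (b * (b - a) * root_diff c a b d e)))
      = F * ((1 + t*e) * ((c-a) * (a*c+b*d) * pr6 b a c d e) / P)" for P
    using nz unfolding weight by (simp add: F_def mult_ac)
  have 2: "c * (b - c) / (a * (b - a) * root_diff c a b d e) * (c + t*c^2) * (n / P)
      = F * ((c + t*c^2) * ((b - c) * n) / P)" for n P
    by (simp add: F_def mult_ac)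
  have 6: "e * c * (c * (b - c) / (a * (b - a) * root_diff c a b d e)) = F * ((b - c) * (e * c))"
    by (simp add: F_def mult_ac)
  show ?thesis
    unfolding partial_c distrib_left[of "e + t*e^2"] 1 2 3 4 5 6
    using arg_cong[OF lagrange_entry_53[OF dist, of t], of "\<lambda>y. F * y"]
    by (simp only: distrib_left[of F] add_ac)
qed

end

section \<open>The braid relation in dimension six\<close>

lemma root_diff_swaps:
  "root_diff a c b d e = root_diff a b c d e" "root_diff a b d c e = root_diff a b c d e"
  by (simp_all add: root_diff_def mult_ac)

lemma Z6_swaps: "Z6 a c b d e = Z6 a b c d e" "Z6 a b d c e = Z6 a b c d e"
  by (simp_all add: Z6_def add_ac mult_ac)

lemma num6_swaps: "num6 a c b d e = num6 a b c d e" "num6 a b d c e = num6 a b c d e"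
  by (simp_all add: num6_def add_ac mult_ac)

lemma U6_swap: "U6 a b d c e = U6 a b c d e"
  by (simp add: U6_def add_ac mult_ac)

context
  fixes x :: "nat \<Rightarrow> complex" and t :: complex
  assumes inj: "inj_on x {1..5}" and nz: "\<forall>i\<in>{1..5}. x i \<noteq> 0"
begin

lemma distinct_values:
  assumes "enum4 i j k l"
  shows "distinct [x i, x j, x k, x l, x 5]" "x i \<noteq> 0" "x j \<noteq> 0" "x k \<noteq> 0" "x l \<noteq> 0" "x 5 \<noteq> 0"
proof -
  have "distinct [i, j, k, l]" using assms by (simp only: enum4_def)
  then have "distinct [i, j, k, l, 5]" using Diff_enum4(6)[OF assms] by simp
  moreover have *: "{i, j, k, l, 5} = {1..5}" by (rule Diff_enum4(4)[OF assms, symmetric])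
  ultimately show "distinct [x i, x j, x k, x l, x 5]"
    using inj distinct_map[of x "[i, j, k, l, 5]"] by simp
  show "x i \<noteq> 0" "x j \<noteq> 0" "x k \<noteq> 0" "x l \<noteq> 0" "x 5 \<noteq> 0"
    by (rule nz[rule_format], unfold *[symmetric], simp)+
qed

private lemma std: "enum4 1 2 3 4" "enum4 2 1 3 4" "enum4 1 2 4 3" "enum4 2 1 4 3"
  by (simp_all add: enum4_def insert_commute)

private lemmas entries6 = g6_col5[of x] g6_col6[of x] g6_row5[of x] g6_row6[of x]

private abbreviation (input) "M \<equiv> root_diff (x 5) (x 1) (x 2) (x 3) (x 4)"

private lemma std': "enum4 3 1 2 4" "enum4 4 1 2 3"
  by (simp_all add: enum4_def insert_commute)

private lemmas data6_std = data6(4)[OF std(1), of x] data6(4)[OF std(2), of x]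
  data6(4)[OF std'(1), of x] data6(4)[OF std'(2), of x]
  data6(2)[OF std(1), of x] data6(2)[OF std(2), of x]
  data6(2)[OF std'(1), of x] data6(2)[OF std'(2), of x] data6(3)[OF std(1), of x]

private lemmas frac_ac =
  times_divide_eq_left times_divide_eq_right divide_divide_eq_left mult_1_left mult_ac add_ac

private lemmas sorted =
  pr6_swaps(1)[where b = "x 1" and c = "x 2"] root_diff_swaps(1)[where b = "x 1" and c = "x 2"]
  pr6_swaps(3)[where c = "x 3" and d = "x 4"] Z6_swaps(2)[where c = "x 3" and d = "x 4"]
  W6_swap[where c = "x 3" and d = "x 4"] root_diff_swaps(2)[where c = "x 3" and d = "x 4"]

private lemma q:
  "q6 x 2 = x 1 * x 2 + x 3 * x 4" "q6 x 3 = x 1 * x 3 + x 2 * x 4" "q6 x 4 = x 1 * x 4 + x 2 * x 3"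
  by (simp_all add: q6_def insert_Diff_if)

text \<open>
  Rows 1 and 2 of column 3 are one formula with $x_1$ and $x_2$ exchanged, and column 4 arises from
  column 3 by exchanging $x_3$ and $x_4$. In columns 1 and 2 one of the two products is 0.
\<close>
private lemma block3:
  "g6 x 1 5 * g6 x 5 3 + g6 x 1 6 * g6 x 6 3 = q6 x 2 * q6 x 4 * p6 x 3 * W6 (x 1) (x 3) (x 2) (x 4) (x 5)
    / ((x 1)\<^sup>2 * x 5 * Delta 3 x {1..5} * Delta 5 x {1..5})"
  "g6 x 2 5 * g6 x 5 3 + g6 x 2 6 * g6 x 6 3 = q6 x 2 * p6 x 3 * W6 (x 2) (x 3) (x 1) (x 4) (x 5)
    / ((x 2)\<^sup>2 * x 5 * Delta 3 x {1..5} * Delta 5 x {1..5})"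
  "g6 x 4 5 * g6 x 5 3 + g6 x 4 6 * g6 x 6 3 = q6 x 4 * p6 x 3 * W6 (x 4) (x 3) (x 1) (x 2) (x 5)
    / ((x 4)\<^sup>2 * x 5 * Delta 3 x {1..5} * Delta 5 x {1..5})"
  "g6 x 3 5 * g6 x 5 3 + g6 x 3 6 * g6 x 6 3 = Z6 (x 3) (x 2) (x 1) (x 4) (x 5) / (x 3 * Delta 5 x {1..5}) / Delta 3 x {1..5}"
  unfolding entries6 q data6_std
  using double_root_entry_13[OF distinct_values[OF std(1)], of M "x 1 * x 4 + x 2 * x 3"]
    double_root_entry_13[OF distinct_values[OF std(2)], of M 1, unfolded sorted]
    double_root_entry_43[OF distinct_values[OF std(1)], of M] double_root_entry_33[OF distinct_values[OF std(1)], of M]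
  by (simp_all only: frac_ac)

private lemma block4:
  "g6 x 1 5 * g6 x 5 4 + g6 x 1 6 * g6 x 6 4 = q6 x 2 * q6 x 3 * p6 x 4 * W6 (x 1) (x 4) (x 2) (x 3) (x 5)
    / ((x 1)\<^sup>2 * x 5 * Delta 4 x {1..5} * Delta 5 x {1..5})"
  "g6 x 2 5 * g6 x 5 4 + g6 x 2 6 * g6 x 6 4 = q6 x 2 * p6 x 4 * W6 (x 2) (x 4) (x 1) (x 3) (x 5)
    / ((x 2)\<^sup>2 * x 5 * Delta 4 x {1..5} * Delta 5 x {1..5})"
  "g6 x 3 5 * g6 x 5 4 + g6 x 3 6 * g6 x 6 4 = q6 x 3 * p6 x 4 * W6 (x 3) (x 4) (x 1) (x 2) (x 5)
    / ((x 3)\<^sup>2 * x 5 * Delta 4 x {1..5} * Delta 5 x {1..5})"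
  "g6 x 4 5 * g6 x 5 4 + g6 x 4 6 * g6 x 6 4 = Z6 (x 4) (x 2) (x 1) (x 3) (x 5) / (x 4 * Delta 5 x {1..5}) / Delta 4 x {1..5}"
  unfolding entries6 q data6_std
  using double_root_entry_13[OF distinct_values[OF std(3)], of M "x 1 * x 3 + x 2 * x 4", unfolded sorted]
    double_root_entry_13[OF distinct_values[OF std(4)], of M 1, unfolded sorted]
    double_root_entry_43[OF distinct_values[OF std(3)], of M, unfolded sorted]
    double_root_entry_33[OF distinct_values[OF std(3)], of M, unfolded sorted]
  by (simp_all only: frac_ac)

private lemma block12:
  "g6 x 2 5 * g6 x 5 1 + g6 x 2 6 * g6 x 6 1 = p6 x 1 * W6 (x 2) (x 1) (x 3) (x 4) (x 5)
    / ((x 2)\<^sup>2 * x 5 * Delta 1 x {1..5} * Delta 5 x {1..5})"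
  "g6 x 3 5 * g6 x 5 1 + g6 x 3 6 * g6 x 6 1 = p6 x 1 * W6 (x 3) (x 1) (x 2) (x 4) (x 5)
    / ((x 3)\<^sup>2 * x 5 * Delta 1 x {1..5} * Delta 5 x {1..5})"
  "g6 x 4 5 * g6 x 5 1 + g6 x 4 6 * g6 x 6 1 = p6 x 1 * W6 (x 4) (x 1) (x 2) (x 3) (x 5)
    / ((x 4)\<^sup>2 * x 5 * Delta 1 x {1..5} * Delta 5 x {1..5})"
  "g6 x 1 5 * g6 x 5 2 + g6 x 1 6 * g6 x 6 2 = q6 x 3 * q6 x 4 * p6 x 2 * W6 (x 1) (x 2) (x 3) (x 4) (x 5)
    / ((x 1)\<^sup>2 * x 5 * Delta 2 x {1..5} * Delta 5 x {1..5})"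
  "g6 x 3 5 * g6 x 5 2 + g6 x 3 6 * g6 x 6 2 = q6 x 3 * p6 x 2 * W6 (x 3) (x 2) (x 1) (x 4) (x 5)
    / ((x 3)\<^sup>2 * x 5 * Delta 2 x {1..5} * Delta 5 x {1..5})"
  "g6 x 4 5 * g6 x 5 2 + g6 x 4 6 * g6 x 6 2 = q6 x 4 * p6 x 2 * W6 (x 4) (x 2) (x 1) (x 3) (x 5)
    / ((x 4)\<^sup>2 * x 5 * Delta 2 x {1..5} * Delta 5 x {1..5})"
  "g6 x 1 5 * g6 x 5 1 + g6 x 1 6 * g6 x 6 1 = Z6 (x 1) (x 2) (x 3) (x 4) (x 5) / (x 1 * Delta 5 x {1..5}) / Delta 1 x {1..5}"
  "g6 x 2 5 * g6 x 5 2 + g6 x 2 6 * g6 x 6 2 = Z6 (x 2) (x 1) (x 3) (x 4) (x 5) / (x 2 * Delta 5 x {1..5}) / Delta 2 x {1..5}"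
  unfolding entries6 q data6_std
  by (simp_all only: frac_ac mult_zero_left mult_zero_right add_0_left add_0_right mult_1_right div_0 W6_commute)

private lemma kappa_values:
  "kappa r 1 2 = r 3 * r 4" "kappa r 1 3 = r 2 * r 4" "kappa r 1 4 = r 2 * r 3"
  "kappa r 2 1 = 1" "kappa r 3 1 = 1" "kappa r 4 1 = 1"
  "kappa r 2 3 = r 2" "kappa r 2 4 = r 2" "kappa r 3 2 = r 3" "kappa r 3 4 = r 3"
  "kappa r 4 2 = r 4" "kappa r 4 3 = r 4"
  by (simp_all add: kappa_def insert_Diff_if)

text \<open>
  The uniform shape of these sums is what makes them fit into \<open>off_diag_combine\<close>: they are the
  entry at $(i, j)$ times a factor symmetric in \<open>i\<close> and \<open>j\<close>.
\<close>
lemma g6_block_off_diag: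
  assumes "enum4 i j k l"
  shows "g6 x i 5 * g6 x 5 j + g6 x i 6 * g6 x 6 j
    = kappa (q6 x) i j * p6 x j * W6 (x i) (x j) (x k) (x l) (x 5)
      / ((x i)\<^sup>2 * x 5 * Delta j x {1..5} * Delta 5 x {1..5})"
  using enum4_cases[OF assms]
  by (elim insertE emptyE)
    (simp_all only: prod.inject block12 block3 block4 kappa_values W6_swap mult_1_left)

lemma g6_block_diag:
  assumes "enum4 i j k l"
  shows "g6 x i 5 * g6 x 5 i + g6 x i 6 * g6 x 6 i
    = Z6 (x i) (x j) (x k) (x l) (x 5) / (x i * Delta 5 x {1..5}) / Delta i x {1..5}"
  using enum4_cases[OF assms]
  by (elim insertE emptyE) (simp_all only: prod.inject block12 block3 block4 Z6_swaps)

private abbreviation (input) "\<phi> y \<equiv> y + t * y\<^sup>2"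

lemma g6_weighted_off_diag:
  assumes ijkl: "enum4 i j k l"
  shows "(\<Sum>m\<in>{1, 2, 3, 4}. g6 x i m * \<phi> (x m) * g6 x m j)
    + \<phi> (x 5) * (g6 x i 5 * g6 x 5 j + g6 x i 6 * g6 x 6 j) = x i * x j * g6 x i j"
proof -
  have perms: "enum4 j i k l" "enum4 k i j l" "enum4 l i j k" "enum4 i k j l" "enum4 i l j k" "enum4 k j i l" "enum4 l j i k"
    using ijkl by (auto simp: enum4_def)
  have I: "i \<in> {1, 2, 3, 4}" "j \<in> {1, 2, 3, 4}" using ijkl by (auto simp: enum4_def)
  have sum: "(\<Sum>m\<in>{1, 2, 3, 4}. h m) = h i + h j + h k + h l" for h :: "nat \<Rightarrow> complex"
  proof -
    have "{1, 2, 3, 4} = {i, j, k, l}" "distinct [i, j, k, l]" using ijkl by (simp_all only: enum4_def)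
    then show ?thesis by (simp add: add.assoc)
  qed
  note dist = distinct_values[OF ijkl]
  note data = data6[OF ijkl, of x] data6(1,2,4)[OF perms(1), of x] data6(1,2,4)[OF perms(2), of x] data6(1,2,4)[OF perms(3), of x]
  have chain: "kappa (q6 x) i k * kappa (q6 x) k j = kappa (q6 x) i j * (x i * x j + x k * x l)"
    "kappa (q6 x) i l * kappa (q6 x) l j = kappa (q6 x) i j * (x i * x j + x k * x l)"
    using kappa_chain[OF ijkl, of "q6 x"] kappa_chain[of i j l k "q6 x"] q6_pairing[OF ijkl, of x] ijkl
    by (auto simp: enum4_def insert_commute)
  have "g6 x i i * \<phi> (x i) * g6 x i j + g6 x i j * \<phi> (x j) * g6 x j j
      + g6 x i k * \<phi> (x k) * g6 x k j + g6 x i l * \<phi> (x l) * g6 x l j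
      + \<phi> (x 5) * (g6 x i 5 * g6 x 5 j + g6 x i 6 * g6 x 6 j) = x i * x j * g6 x i j"
    unfolding g6_diag[OF I(1)] g6_diag[OF I(2)] g6_off_diag[OF ijkl] g6_off_diag[OF perms(4)]
      g6_off_diag[OF perms(5)] g6_off_diag[OF perms(6)] g6_off_diag[OF perms(7)]
      g6_block_off_diag[OF ijkl] data
    by (rule off_diag_combine[OF dist(2-6) pair6[OF dist(1)] chain]) (simp only: mult.assoc)
  then show ?thesis unfolding sum .
qed

lemma g6_weighted_diag:
  assumes ijkl: "enum4 i j k l"
  shows "(\<Sum>m\<in>{1, 2, 3, 4}. g6 x i m * \<phi> (x m) * g6 x m i)
    + \<phi> (x 5) * (g6 x i 5 * g6 x 5 i + g6 x i 6 * g6 x 6 i)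
    = x i * x i * g6 x i i + t * (-((x 5)\<^sup>2 * (x i * x j * x k * x l)) / (x i)\<^sup>2)"
proof -
  have perms: "enum4 j i k l" "enum4 k i j l" "enum4 l i j k" "enum4 i k j l" "enum4 i l j k"
    using ijkl by (auto simp: enum4_def)
  have I: "i \<in> {1, 2, 3, 4}" using ijkl by (auto simp: enum4_def)
  have sum: "(\<Sum>m\<in>{1, 2, 3, 4}. h m) = h i + h j + h k + h l" for h :: "nat \<Rightarrow> complex"
  proof -
    have "{1, 2, 3, 4} = {i, j, k, l}" "distinct [i, j, k, l]" using ijkl by (simp_all only: enum4_def)
    then show ?thesis by (simp add: add.assoc)
  qed
  note dist = distinct_values[OF ijkl]
  note data = data6[OF ijkl, of x] data6(1,2,4)[OF perms(1), of x] data6(1,2,4)[OF perms(2), of x] data6(1,2,4)[OF perms(3), of x]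
  have D: "root_diff (x i) (x j) (x k) (x l) (x 5) \<noteq> 0" using dist(1) by (auto simp: root_diff_def)
  have cycle: "kappa (q6 x) i j * kappa (q6 x) j i = (x i * x k + x j * x l) * (x i * x l + x j * x k)"
    "kappa (q6 x) i k * kappa (q6 x) k i = (x i * x j + x k * x l) * (x i * x l + x j * x k)"
    "kappa (q6 x) i l * kappa (q6 x) l i = (x i * x j + x k * x l) * (x i * x k + x j * x l)"
    unfolding kappa_cycle[OF ijkl] kappa_cycle[OF perms(4)] kappa_cycle[OF perms(5)]
      q6_pairing[OF ijkl] q6_pairing[OF perms(4)] q6_pairing[OF perms(5)]
    by (simp_all only: mult.commute)
  have "g6 x i i * \<phi> (x i) * g6 x i i + g6 x i j * \<phi> (x j) * g6 x j i
      + g6 x i k * \<phi> (x k) * g6 x k i + g6 x i l * \<phi> (x l) * g6 x l i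
      + \<phi> (x 5) * (g6 x i 5 * g6 x 5 i + g6 x i 6 * g6 x 6 i)
      = x i * x i * g6 x i i + t * (-((x 5)\<^sup>2 * (x i * x j * x k * x l)) / (x i)\<^sup>2)"
    unfolding g6_diag[OF I] g6_off_diag[OF ijkl] g6_off_diag[OF perms(1)] g6_off_diag[OF perms(2)]
      g6_off_diag[OF perms(3)] g6_off_diag[OF perms(4)] g6_off_diag[OF perms(5)]
      g6_block_diag[OF ijkl] data
    by (rule diag_combine[OF dist(2-6) D diag6[OF dist(1)] cycle HOL.refl])
  then show ?thesis unfolding sum .
qed

private lemma g6_off_diag':
  assumes "i \<in> {1, 2, 3, 4}" "j \<in> {1, 2, 3, 4}" "i \<noteq> j"
  shows "g6 x i j = kappa (q6 x) i j * p6 x j / ((x i)\<^sup>2 * Delta j x {1..5})"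
  using enum4_exists[OF assms] g6_off_diag by blast

private lemma block_entries:
  "g6 x 1 1 = N6 x 1 / Delta 1 x {1..5}" "g6 x 2 2 = N6 x 2 / Delta 2 x {1..5}"
  "g6 x 3 3 = N6 x 3 / Delta 3 x {1..5}" "g6 x 4 4 = N6 x 4 / Delta 4 x {1..5}"
  "g6 x 2 1 = p6 x 1 / ((x 2)\<^sup>2 * Delta 1 x {1..5})" "g6 x 3 1 = p6 x 1 / ((x 3)\<^sup>2 * Delta 1 x {1..5})"
  "g6 x 4 1 = p6 x 1 / ((x 4)\<^sup>2 * Delta 1 x {1..5})"
  "g6 x 1 2 = q6 x 3 * q6 x 4 * p6 x 2 / ((x 1)\<^sup>2 * Delta 2 x {1..5})"
  "g6 x 3 2 = q6 x 3 * p6 x 2 / ((x 3)\<^sup>2 * Delta 2 x {1..5})"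
  "g6 x 4 2 = q6 x 4 * p6 x 2 / ((x 4)\<^sup>2 * Delta 2 x {1..5})"
  "g6 x 1 3 = q6 x 2 * q6 x 4 * p6 x 3 / ((x 1)\<^sup>2 * Delta 3 x {1..5})"
  "g6 x 2 3 = q6 x 2 * p6 x 3 / ((x 2)\<^sup>2 * Delta 3 x {1..5})"
  "g6 x 4 3 = q6 x 4 * p6 x 3 / ((x 4)\<^sup>2 * Delta 3 x {1..5})"
  "g6 x 1 4 = q6 x 2 * q6 x 3 * p6 x 4 / ((x 1)\<^sup>2 * Delta 4 x {1..5})"
  "g6 x 2 4 = q6 x 2 * p6 x 4 / ((x 2)\<^sup>2 * Delta 4 x {1..5})"
  "g6 x 3 4 = q6 x 3 * p6 x 4 / ((x 3)\<^sup>2 * Delta 4 x {1..5})"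
  by (simp_all add: g6_diag g6_off_diag' kappa_values del: One_nat_def)

private lemma N6_std:
  "N6 x 1 = num6 (x 1) (x 2) (x 3) (x 4) (x 5)" "N6 x 2 = num6 (x 2) (x 1) (x 3) (x 4) (x 5)"
  "N6 x 3 = num6 (x 3) (x 1) (x 2) (x 4) (x 5)" "N6 x 4 = num6 (x 4) (x 1) (x 2) (x 3) (x 5)"
  by (rule data6(1)[OF std(1)] data6(1)[OF std(2)] data6(1)[OF std'(1)] data6(1)[OF std'(2)])+

private lemmas sorted' = sorted U6_swap[where c = "x 3" and d = "x 4"]
  num6_swaps(1)[where b = "x 1" and c = "x 2"] num6_swaps(2)[where c = "x 3" and d = "x 4"]

private lemmas zero_ac = frac_ac mult_zero_left mult_zero_right add_0_left add_0_right div_0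

lemma g6_weighted_rows:
  assumes "i \<in> {5, 6}" "j \<in> {1, 2, 3, 4}"
  shows "g6 x i 1 * \<phi> (x 1) * g6 x 1 j + g6 x i 2 * \<phi> (x 2) * g6 x 2 j
    + g6 x i 3 * \<phi> (x 3) * g6 x 3 j + g6 x i 4 * \<phi> (x 4) * g6 x 4 j
    + \<phi> (x 5) * (g6 x i 5 * g6 x 5 j + g6 x i 6 * g6 x 6 j) = x 5 * x j * g6 x i j"
proof -
  note r51 = weighted_entry_51[OF distinct_values[OF std(1)], of t] weighted_entry_51[OF distinct_values[OF std(2)], of t]
  note r61 = weighted_entry_61[OF distinct_values[OF std(1)], of t] weighted_entry_61[OF distinct_values[OF std(2)], of t]
  note r53 = weighted_entry_53[OF distinct_values[OF std(1)], of t] weighted_entry_53[OF distinct_values[OF std(2)], of t, unfolded sorted']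
    weighted_entry_53[OF distinct_values[OF std(3)], of t, unfolded sorted'] weighted_entry_53[OF distinct_values[OF std(4)], of t, unfolded sorted']
  have pull: "r * (w * (y + z)) = w * (r * y + r * z)" for r w y z :: complex
    by (simp add: algebra_simps)
  \<comment> \<open>$g_{53}$ and $g_{54}$ have a factor $q_a$ that the formula with $x_1$ and $x_2$ exchanged lacks, and
    $g_{56}$, which enters at $(5, 2)$, has two of them.\<close>
  note scaled = arg_cong[OF r61(2), of "\<lambda>y. (q6 x 3 * q6 x 4) * y", unfolded distrib_left[of "q6 x 3 * q6 x 4"]]
    arg_cong[OF r53(1)[folded q], of "\<lambda>y. q6 x 4 * y", unfolded distrib_left[of "q6 x 4"] pull[of "q6 x 4" "\<phi> (x 5)"]]
    arg_cong[OF r53(3)[folded q], of "\<lambda>y. q6 x 3 * y", unfolded distrib_left[of "q6 x 3"] pull[of "q6 x 3" "\<phi> (x 5)"]]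
  let ?S = "\<lambda>i j. g6 x i 1 * \<phi> (x 1) * g6 x 1 j + g6 x i 2 * \<phi> (x 2) * g6 x 2 j
    + g6 x i 3 * \<phi> (x 3) * g6 x 3 j + g6 x i 4 * \<phi> (x 4) * g6 x 4 j
    + \<phi> (x 5) * (g6 x i 5 * g6 x 5 j + g6 x i 6 * g6 x 6 j)"
  have "?S 5 1 = x 5 * x 1 * g6 x 5 1"
    using r51(1) unfolding entries6 block_entries N6_std data6_std q by (simp only: zero_ac)
  moreover have "?S 6 2 = x 5 * x 2 * g6 x 6 2"
    using r51(2) unfolding entries6 block_entries N6_std data6_std q by (simp only: zero_ac)
  moreover have "?S 6 1 = x 5 * x 1 * g6 x 6 1"
    using r61(1) unfolding entries6 block_entries N6_std data6_std q by (simp only: zero_ac)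
  moreover have "?S 5 2 = x 5 * x 2 * g6 x 5 2"
    using scaled(1) unfolding entries6 block_entries N6_std data6_std q by (simp only: zero_ac)
  moreover have "?S 5 3 = x 5 * x 3 * g6 x 5 3"
    using scaled(2) unfolding entries6 block_entries N6_std data6_std q by (simp only: zero_ac)
  moreover have "?S 5 4 = x 5 * x 4 * g6 x 5 4"
    using scaled(3) unfolding entries6 block_entries N6_std data6_std q by (simp only: zero_ac)
  moreover have "?S 6 3 = x 5 * x 3 * g6 x 6 3"
    using r53(2) unfolding entries6 block_entries N6_std data6_std q by (simp only: zero_ac)
  moreover have "?S 6 4 = x 5 * x 4 * g6 x 6 4"
    using r53(4) unfolding entries6 block_entries N6_std data6_std q by (simp only: zero_ac)
  ultimately show ?thesis using assms by blast
qed

end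

theorem rho6_braid_matrix_pair:
  assumes inj: "inj_on x {1..5}" and nz: "\<forall>i\<in>{1..5}. x i \<noteq> 0"
  shows "braid_matrix_pair 6 (rho6_g1 x) (rho6_g2 x) (- x 5 * esym 5 x {1..5})"
  unfolding rho6_g1_def rho6_g2_eq_mat
proof (rule braid_matrix_pair_six)
  have std: "enum4 1 2 3 4" by (simp add: enum4_def)
  note dist = distinct_values[OF inj nz std, simplified]
  have e5: "esym 5 x {1..5} = x 1 * x 2 * x 3 * x 4 * x 5"
    unfolding Diff_enum4(4)[OF std] by (simp add: mult_ac)
  show "length [x 1, x 2, x 3, x 4, x 5, x 5] = 6" by simp
  show "0 \<notin> set [x 1, x 2, x 3, x 4, x 5, x 5]" "- x 5 * esym 5 x {1..5} \<noteq> 0"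
    using dist unfolding e5 by auto
  fix t :: complex and i j :: nat
  assume ij: "i < 6" "j < 4"
  let ?as = "[x 1, x 2, x 3, x 4, x 5, x 5]"
  let ?i = "Suc i" and ?j = "Suc j"
  let ?\<phi> = "\<lambda>y. y + t * y\<^sup>2"
  have j: "?j \<in> {1, 2, 3, 4}" using ij by auto
  have sum: "(\<Sum>k<6. g6 x ?i (Suc k) * (?as ! k + t * (?as ! k)\<^sup>2) * g6 x (Suc k) ?j)
    = (g6 x ?i 1 * ?\<phi> (x 1) * g6 x 1 ?j + g6 x ?i 2 * ?\<phi> (x 2) * g6 x 2 ?j
      + g6 x ?i 3 * ?\<phi> (x 3) * g6 x 3 ?j + g6 x ?i 4 * ?\<phi> (x 4) * g6 x 4 ?j)
      + ?\<phi> (x 5) * (g6 x ?i 5 * g6 x 5 ?j + g6 x ?i 6 * g6 x 6 ?j)"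
    by (simp add: eval_nat_numeral lessThan_Suc algebra_simps)
  have as: "?as ! j = x ?j" using ij by (auto simp: less_Suc_eq numeral_eq_Suc)
  have sum4: "(\<Sum>m\<in>{1, 2, 3, 4}. h m) = h 1 + h 2 + h 3 + h 4" for h :: "nat \<Rightarrow> complex"
    by (simp add: add.assoc)
  show "(\<Sum>k<6. g6 x ?i (Suc k) * (?as ! k + t * (?as ! k)\<^sup>2) * g6 x (Suc k) ?j)
    = ?as ! i * ?as ! j * g6 x ?i ?j
      + t * (if i = j then - x 5 * esym 5 x {1..5} / (?as ! i)\<^sup>2 else 0)"
  proof (cases "i < 4")
    case True
    then have i: "?i \<in> {1, 2, 3, 4}" and as_i: "?as ! i = x ?i"
      by (auto simp: less_Suc_eq numeral_eq_Suc)
    show ?thesis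
    proof (cases "i = j")
      case True
      obtain j' where "j' \<in> {1, 2, 3, 4}" "?i \<noteq> j'" by (metis insertI1 insertI2 n_not_Suc_n numeral_2_eq_2 One_nat_def)
      then obtain k l where enum: "enum4 ?i j' k l" using enum4_exists[OF i] by blast
      have "esym 5 x {1..5} = x ?i * x j' * x k * x l * x 5"
        unfolding Diff_enum4(4)[OF enum] using Diff_enum4(6)[OF enum] enum
        by (auto simp: enum4_def mult_ac)
      then show ?thesis
        using g6_weighted_diag[OF inj nz enum, of t] True
        unfolding sum as as_i sum4 by (simp add: power2_eq_square mult_ac)
    next
      case False
      then obtain k l where "enum4 ?i ?j k l" using enum4_exists[OF i j] by auto
      then show ?thesis
        using g6_weighted_off_diag[OF inj nz, of ?i ?j k l t] False
        unfolding sum as as_i sum4 by simp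
    qed
  next
    case False
    then have "?i \<in> {5, 6}" "?as ! i = x 5" "i \<noteq> j"
      using ij by (auto simp: less_Suc_eq numeral_eq_Suc)
    then show ?thesis
      using g6_weighted_rows[OF inj nz _ j, of ?i t] unfolding sum as by simp
  qed
next
  have "enum4 1 2 3 4" "enum4 2 1 3 4" by (simp_all add: enum4_def insert_commute)
  note dist = this[THEN distinct_values(1)[OF inj nz]]
  show "g6 x (Suc 4) (Suc 0) \<noteq> 0" "g6 x (Suc 5) (Suc 0) = 0" "g6 x (Suc 4) (Suc 1) = 0"
    "g6 x (Suc 5) (Suc 1) \<noteq> 0"
    using g6_row5[of x] g6_row6[of x] dist
    by (auto simp: root_diff_def numeral_2_eq_2[symmetric])
qed

section \<open>The representations and their inequivalence\<close>

lemma representation_from_braid_pair: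
  assumes "braid_matrix_pair d (mk_diagonal as) B s" "set as \<subseteq> x ` {1..n}"
  shows "\<exists>\<rho>. Q_rep_extending n x d (mk_diagonal as) B \<rho> \<and> \<rho> (Q_class n x c_elt) = s \<cdot>\<^sub>m 1\<^sub>m d"
  by (rule braid_matrix_pair.diagonal_braid_pair_representation[OF assms(1) HOL.refl assms(2)])

text \<open>
  The representations are chosen one by one. They are pairwise inequivalent because the scalars
  by which $c$ acts are different.
\<close>
lemma inequivalent_family:
  assumes rep: "\<And>a. a \<in> I \<Longrightarrow> \<exists>\<rho>. R a \<rho> \<and> \<rho> (Q_class n x c_elt) = s a \<cdot>\<^sub>m 1\<^sub>m d"
    and s: "inj_on s I" and d: "0 < d"
  shows "\<exists>\<rho>. (\<forall>a\<in>I. R a (\<rho> a)) \<and> (\<forall>a\<in>I. \<rho> a (Q_class n x c_elt) = s a \<cdot>\<^sub>m 1\<^sub>m d)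
    \<and> (\<forall>a\<in>I. \<forall>b\<in>I. a \<noteq> b \<longrightarrow> \<not> Q_equivalent n x (\<rho> a) (\<rho> b))"
proof -
  obtain \<rho> where \<rho>: "\<And>a. a \<in> I \<Longrightarrow> R a (\<rho> a) \<and> \<rho> a (Q_class n x c_elt) = s a \<cdot>\<^sub>m 1\<^sub>m d"
    using rep by metis
  have "\<not> Q_equivalent n x (\<rho> a) (\<rho> b)" if "a \<in> I" "b \<in> I" "a \<noteq> b" for a b
    using Q_equivalent_central_scalar[of n x "\<rho> a" "\<rho> b" d "s a" "s b"] \<rho> that s d
    by (auto dest: inj_onD)
  with \<rho> show ?thesis by blast
qed

theorem proposition2:
  fixes n :: nat and x :: "nat \<Rightarrow> complex"
  assumes "n \<le> 5"
    and "inj_on x {1..n}"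
    and "\<forall>i\<in>{1..n}. x i \<noteq> 0"
  shows
    "(n = 1 \<longrightarrow> (\<exists>\<rho>. Q_rep_extending n x 1 (rho1_mat x) (rho1_mat x) \<rho>)) \<and>
     (n = 2 \<longrightarrow> (\<exists>\<rho>. Q_rep_extending n x 2 (rho2_g1 x) (rho2_g2 x) \<rho>)) \<and>
     (n = 3 \<longrightarrow> (\<exists>\<rho>. Q_rep_extending n x 3 (rho3_g1 x) (rho3_g2 x) \<rho>)) \<and>
     (n = 4 \<longrightarrow>
        (let H = {h. h ^ 2 = esym 4 x {1..4}} in
         card H = 2 \<and>
         (\<exists>\<rho>. (\<forall>h\<in>H. Q_rep_extending n x 4 (rho4_g1 x) (rho4_g2 h x) (\<rho> h)) \<and>
              (\<forall>h\<in>H. \<forall>h'\<in>H. h \<noteq> h' \<longrightarrow> \<not> Q_equivalent n x (\<rho> h) (\<rho> h'))))) \<and>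
     (n = 5 \<longrightarrow>
        (let F = {f. f ^ 5 = esym 5 x {1..5}} in
         card F = 5 \<and>
         (\<exists>\<rho>. (\<forall>f\<in>F. Q_rep_extending n x 5 (rho5_g1 x) (rho5_g2 f x) (\<rho> f)) \<and>
              (\<forall>f\<in>F. \<forall>f'\<in>F. f \<noteq> f' \<longrightarrow> \<not> Q_equivalent n x (\<rho> f) (\<rho> f'))))) \<and>
     (n = 5 \<longrightarrow>
        (\<exists>\<rho>. Q_rep_extending n x 6 (rho6_g1 x) (rho6_g2 x) (\<rho> 5) \<and>
             (\<forall>i\<in>{1..4}. Q_rep_extending n x 6
                (sigma i 5 rho6_g1 x) (sigma i 5 rho6_g2 x) (\<rho> i)) \<and>
             (\<forall>i\<in>{1..5}. \<rho> i (Q_class n x c_elt) = (- x i * esym 5 x {1..5}) \<cdot>\<^sub>m 1\<^sub>m 6) \<and>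
             (\<forall>i\<in>{1..5}. \<forall>j\<in>{1..5::nat}. i \<noteq> j \<longrightarrow> \<not> Q_equivalent n x (\<rho> i) (\<rho> j))))"
proof (intro conjI impI)
  note inj = assms(2) and nz = assms(3)
  have e_nz: "esym n x {1..n} \<noteq> 0" unfolding esym_full using nz by simp
  have mem: "x i \<in> x ` {1..n}" if "1 \<le> i" "i \<le> n" for i using that by auto
  show "\<exists>\<rho>. Q_rep_extending n x 1 (rho1_mat x) (rho1_mat x) \<rho>" if n: "n = 1"
  proof -
    have "braid_matrix_pair 1 (rho1_mat x) (rho1_mat x) (x 1 ^ 6)"
      using nz n by (intro rho1_braid_matrix_pair) simp
    then have "\<exists>\<rho>. Q_rep_extending n x 1 (mk_diagonal [x 1]) (mk_diagonal [x 1]) \<rho>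
        \<and> \<rho> (Q_class n x c_elt) = (x 1 ^ 6) \<cdot>\<^sub>m 1\<^sub>m 1"
      unfolding rho1_mat_eq_diagonal by (rule representation_from_braid_pair) (use mem n in simp)
    then show ?thesis unfolding rho1_mat_eq_diagonal by blast
  qed
  show "\<exists>\<rho>. Q_rep_extending n x 2 (rho2_g1 x) (rho2_g2 x) \<rho>" if n: "n = 2"
  proof -
    have "braid_matrix_pair 2 (rho2_g1 x) (rho2_g2 x) (- ((x 1 * x 2) ^ 3))"
      using inj nz n by (intro rho2_braid_matrix_pair) simp_all
    then have "\<exists>\<rho>. Q_rep_extending n x 2 (mk_diagonal [x 1, x 2]) (rho2_g2 x) \<rho>
        \<and> \<rho> (Q_class n x c_elt) = (- ((x 1 * x 2) ^ 3)) \<cdot>\<^sub>m 1\<^sub>m 2"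
      unfolding rho2_g1_def by (rule representation_from_braid_pair) (use mem n in simp)
    then show ?thesis unfolding rho2_g1_def by blast
  qed
  show "\<exists>\<rho>. Q_rep_extending n x 3 (rho3_g1 x) (rho3_g2 x) \<rho>" if n: "n = 3"
  proof -
    have "braid_matrix_pair 3 (rho3_g1 x) (rho3_g2 x) ((x 1 * x 2 * x 3)\<^sup>2)"
      using inj nz n by (intro rho3_braid_matrix_pair) simp_all
    then have "\<exists>\<rho>. Q_rep_extending n x 3 (mk_diagonal [x 1, x 2, x 3]) (rho3_g2 x) \<rho>
        \<and> \<rho> (Q_class n x c_elt) = ((x 1 * x 2 * x 3)\<^sup>2) \<cdot>\<^sub>m 1\<^sub>m 3"
      unfolding rho3_g1_def by (rule representation_from_braid_pair) (use mem n in simp)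
    then show ?thesis unfolding rho3_g1_def by blast
  qed
  show "let H = {h. h ^ 2 = esym 4 x {1..4}} in card H = 2 \<and>
      (\<exists>\<rho>. (\<forall>h\<in>H. Q_rep_extending n x 4 (rho4_g1 x) (rho4_g2 h x) (\<rho> h)) \<and>
        (\<forall>h\<in>H. \<forall>h'\<in>H. h \<noteq> h' \<longrightarrow> \<not> Q_equivalent n x (\<rho> h) (\<rho> h')))" if n: "n = 4"
  proof -
    define H where "H = {h. h ^ 2 = esym 4 x {1..4}}"
    have e4: "esym 4 x {1..4} \<noteq> 0" using e_nz n by simp
    have card: "card H = 2" unfolding H_def by (rule card_nth_roots[OF e4]) simp
    have "\<exists>\<rho>. Q_rep_extending n x 4 (rho4_g1 x) (rho4_g2 h x) \<rho>
        \<and> \<rho> (Q_class n x c_elt) = h ^ 3 \<cdot>\<^sub>m 1\<^sub>m 4" if "h \<in> H" for h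
    proof -
      have "braid_matrix_pair 4 (rho4_g1 x) (rho4_g2 h x) (h ^ 3)"
        using inj nz n that by (intro rho4_braid_matrix_pair) (simp_all add: H_def)
      then show ?thesis
        unfolding rho4_g1_def by (rule representation_from_braid_pair) (use mem n in simp)
    qed
    moreover have "inj_on (\<lambda>h. h ^ 3) H"
    proof (rule inj_onI)
      fix h h' assume h: "h \<in> H" "h' \<in> H" "h ^ 3 = h' ^ 3"
      \<comment> \<open>On \<open>H\<close> the cube is $h^3 = e_4(X)\, h$.\<close>
      have "h ^ 3 = h * h ^ 2" "h' ^ 3 = h' * h' ^ 2" by (simp_all add: eval_nat_numeral)
      then show "h = h'" using h e4 unfolding H_def mem_Collect_eq by simp
    qed
    ultimately have "\<exists>\<rho>. (\<forall>h\<in>H. Q_rep_extending n x 4 (rho4_g1 x) (rho4_g2 h x) (\<rho> h))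
        \<and> (\<forall>h\<in>H. \<rho> h (Q_class n x c_elt) = h ^ 3 \<cdot>\<^sub>m 1\<^sub>m 4)
        \<and> (\<forall>h\<in>H. \<forall>h'\<in>H. h \<noteq> h' \<longrightarrow> \<not> Q_equivalent n x (\<rho> h) (\<rho> h'))"
      by (intro inequivalent_family
          [where R = "\<lambda>h. Q_rep_extending n x 4 (rho4_g1 x) (rho4_g2 h x)" and s = "\<lambda>h. h ^ 3"]) simp_all
    then show ?thesis unfolding H_def[symmetric] Let_def using card by blast
  qed
  show "let F = {f. f ^ 5 = esym 5 x {1..5}} in card F = 5 \<and>
      (\<exists>\<rho>. (\<forall>f\<in>F. Q_rep_extending n x 5 (rho5_g1 x) (rho5_g2 f x) (\<rho> f)) \<and>
        (\<forall>f\<in>F. \<forall>f'\<in>F. f \<noteq> f' \<longrightarrow> \<not> Q_equivalent n x (\<rho> f) (\<rho> f')))" if n: "n = 5"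
  proof -
    define F where "F = {f. f ^ 5 = esym 5 x {1..5}}"
    have e5: "esym 5 x {1..5} \<noteq> 0" using e_nz n by simp
    have card: "card F = 5" unfolding F_def by (rule card_nth_roots[OF e5]) simp
    have "\<exists>\<rho>. Q_rep_extending n x 5 (rho5_g1 x) (rho5_g2 f x) \<rho>
        \<and> \<rho> (Q_class n x c_elt) = f ^ 6 \<cdot>\<^sub>m 1\<^sub>m 5" if "f \<in> F" for f
    proof -
      have "braid_matrix_pair 5 (rho5_g1 x) (rho5_g2 f x) (f ^ 6)"
        using inj nz n that by (intro rho5_braid_matrix_pair) (simp_all add: F_def)
      then show ?thesis
        unfolding rho5_g1_def by (rule representation_from_braid_pair) (use mem n in simp)
    qed
    moreover have "inj_on (\<lambda>f. f ^ 6) F"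
    proof (rule inj_onI)
      fix f f' assume f: "f \<in> F" "f' \<in> F" "f ^ 6 = f' ^ 6"
      \<comment> \<open>On \<open>F\<close> the sixth power is $f^6 = e_5(X)\, f$.\<close>
      have "f ^ 6 = f * f ^ 5" "f' ^ 6 = f' * f' ^ 5" by (simp_all add: eval_nat_numeral)
      then show "f = f'" using f e5 unfolding F_def mem_Collect_eq by simp
    qed
    ultimately have "\<exists>\<rho>. (\<forall>f\<in>F. Q_rep_extending n x 5 (rho5_g1 x) (rho5_g2 f x) (\<rho> f))
        \<and> (\<forall>f\<in>F. \<rho> f (Q_class n x c_elt) = f ^ 6 \<cdot>\<^sub>m 1\<^sub>m 5)
        \<and> (\<forall>f\<in>F. \<forall>f'\<in>F. f \<noteq> f' \<longrightarrow> \<not> Q_equivalent n x (\<rho> f) (\<rho> f'))"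
      by (intro inequivalent_family
          [where R = "\<lambda>f. Q_rep_extending n x 5 (rho5_g1 x) (rho5_g2 f x)" and s = "\<lambda>f. f ^ 6"]) simp_all
    then show ?thesis unfolding F_def[symmetric] Let_def using card by blast
  qed
  show "\<exists>\<rho>. Q_rep_extending n x 6 (rho6_g1 x) (rho6_g2 x) (\<rho> 5) \<and>
      (\<forall>i\<in>{1..4}. Q_rep_extending n x 6 (sigma i 5 rho6_g1 x) (sigma i 5 rho6_g2 x) (\<rho> i)) \<and>
      (\<forall>i\<in>{1..5}. \<rho> i (Q_class n x c_elt) = (- x i * esym 5 x {1..5}) \<cdot>\<^sub>m 1\<^sub>m 6) \<and>
      (\<forall>i\<in>{1..5}. \<forall>j\<in>{1..5::nat}. i \<noteq> j \<longrightarrow> \<not> Q_equivalent n x (\<rho> i) (\<rho> j))" if n: "n = 5"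
  proof -
    have e5: "esym 5 x {1..5} \<noteq> 0" using e_nz n by simp
    have rep: "\<exists>\<rho>. Q_rep_extending n x 6 (sigma i 5 rho6_g1 x) (sigma i 5 rho6_g2 x) \<rho>
        \<and> \<rho> (Q_class n x c_elt) = (- x i * esym 5 x {1..5}) \<cdot>\<^sub>m 1\<^sub>m 6" if i: "i \<in> {1..5}" for i
    proof -
      \<comment> \<open>$\sigma_{i5}$ renames the variables by the transposition \<open>\<tau>\<close>, which preserves all
        hypotheses on \<open>x\<close> as well as $e_5(X)$.\<close>
      define \<tau> where "\<tau> = (\<lambda>k. if k = i then 5 else if k = 5 then i else k)"
      define y where "y = x(i := x 5, 5 := x i)"
      have y: "y k = x (\<tau> k)" for k by (simp add: y_def \<tau>_def)
      have \<tau>: "\<tau> k \<in> {1..5}" "\<tau> (\<tau> k) = k" if "k \<in> {1..5}" for k using that i by (auto simp: \<tau>_def)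
      have "inj_on y {1..5}"
      proof (rule inj_onI)
        fix k l assume kl: "k \<in> {1..5}" "l \<in> {1..5}" "y k = y l"
        have "x (\<tau> k) = x (\<tau> l)" using kl(3) unfolding y .
        then have "\<tau> k = \<tau> l" by (rule inj_onD[OF inj[unfolded n] _ \<tau>(1)[OF kl(1)] \<tau>(1)[OF kl(2)]])
        then have "\<tau> (\<tau> k) = \<tau> (\<tau> l)" by (rule arg_cong)
        then show "k = l" unfolding \<tau>(2)[OF kl(1)] \<tau>(2)[OF kl(2)] .
      qed
      moreover have "\<forall>k\<in>{1..5}. y k \<noteq> 0" using nz \<tau>(1) unfolding n y by blast
      moreover have "esym 5 y {1..5} = esym 5 x {1..5}"
        unfolding esym_full y by (rule prod.reindex_bij_witness[of _ \<tau> \<tau>]) (use \<tau> in blast)+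
      moreover have "y 5 = x i" by (simp add: y_def)
      ultimately have "braid_matrix_pair 6 (rho6_g1 y) (rho6_g2 y) (- x i * esym 5 x {1..5})"
        using rho6_braid_matrix_pair[of y] by simp
      moreover have "set [y 1, y 2, y 3, y 4, y 5, y 5] \<subseteq> x ` {1..n}"
      proof -
        have "y k \<in> x ` {1..n}" if "k \<in> {1..5}" for k
          using \<tau>(1)[OF that] unfolding n y by (rule imageI)
        then show ?thesis by simp
      qed
      ultimately show ?thesis
        unfolding sigma_def y_def[symmetric] rho6_g1_def by (rule representation_from_braid_pair)
    qed
    moreover have "inj_on (\<lambda>i. - x i * esym 5 x {1..5}) {1..5}"
      using inj e5 n by (auto simp: inj_on_def)
    ultimately have "\<exists>\<rho>. (\<forall>i\<in>{1..5}. Q_rep_extending n x 6 (sigma i 5 rho6_g1 x) (sigma i 5 rho6_g2 x) (\<rho> i))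
        \<and> (\<forall>i\<in>{1..5}. \<rho> i (Q_class n x c_elt) = (- x i * esym 5 x {1..5}) \<cdot>\<^sub>m 1\<^sub>m 6)
        \<and> (\<forall>i\<in>{1..5}. \<forall>j\<in>{1..5}. i \<noteq> j \<longrightarrow> \<not> Q_equivalent n x (\<rho> i) (\<rho> j))"
      by (intro inequivalent_family[where s = "\<lambda>i. - x i * esym 5 x {1..5}"
          and R = "\<lambda>i. Q_rep_extending n x 6 (sigma i 5 rho6_g1 x) (sigma i 5 rho6_g2 x)"]) simp_all
    then obtain \<rho> where \<rho>:
      "\<forall>i\<in>{1..5}. Q_rep_extending n x 6 (sigma i 5 rho6_g1 x) (sigma i 5 rho6_g2 x) (\<rho> i)"
      "\<forall>i\<in>{1..5}. \<rho> i (Q_class n x c_elt) = (- x i * esym 5 x {1..5}) \<cdot>\<^sub>m 1\<^sub>m 6"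
      "\<forall>i\<in>{1..5}. \<forall>j\<in>{1..5}. i \<noteq> j \<longrightarrow> \<not> Q_equivalent n x (\<rho> i) (\<rho> j)"
      by (elim exE conjE)
    have "sigma 5 5 rho6_g1 x = rho6_g1 x" "sigma 5 5 rho6_g2 x = rho6_g2 x"
      by (simp_all add: sigma_def)
    then have rho: "Q_rep_extending n x 6 (rho6_g1 x) (rho6_g2 x) (\<rho> 5)"
        "\<forall>i\<in>{1..4}. Q_rep_extending n x 6 (sigma i 5 rho6_g1 x) (sigma i 5 rho6_g2 x) (\<rho> i)"
      using bspec[OF \<rho>(1), of 5] \<rho>(1) by simp_all
    show ?thesis by (intro exI[of _ \<rho>] conjI rho \<rho>(2,3))
  qed
qed

end
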